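(* Let $\mathcal T$ be a spherically symmetric rooted tree with no vertex of branching index $4$, and let $G$ be a saturated weakly branch locally normal group acting on $\mathcal T$. Then $R(\phi)=\infty$ for every automorphism $\phi$ of $G$.
   Context: Reidemeister numbers: for an automorphism $\phi$ of a group $G$, elements $x,y\in G$ are $\phi$-conjugate if $y=gx\phi(g^{-1})$ for some $g\in G$; the equivalence classes are the Reidemeister classes $\{x\}_\phi$, and $R(\phi)$ is their number. Trees: $\mathcal T$ is a (locally finite) rooted tree that is spherically symmetric, i.e. all vertices of the same level have the same number of children. The branching index $k(v)$ of a vertex $v$ is its number of children; the root is at level $0$; $\mathcal T_v$ is the subtree with root $v$. $\operatorname{Iso}\mathcal T$ is the full automorphism group of the rooted tree $\mathcal T$. For $G\subset\operatorname{Iso}\mathcal T$, $\operatorname{St}_m(G)$ is the subgroup of elements fixing every vertex of level $m$. Weakly branch: a group $G$ acting faithfully on $\mathcal T$ (by rooted tree automorphisms) is weakly branch if for every vertex $v$ there is an element of $G$ acting nontrivially on $\mathcal T_v$ and trivially off it. Saturated: for every integer $n\ge 0$ there is a characteristic subgroup $H_n\subset G$ acting trivially on the $n$-th level of $\mathcal T$ and level-transitively (i.e. transitively on every level) on each subtree $\mathcal T_v$ with $v$ in the $n$-th level. Locally normal: for a vertex $v$ of level $m$ let $H(v)$ be the subgroup of the symmetric group $\Sigma_{k(v)}$ (on the set of children of $v$) representing the action of $\operatorname{St}_m(G)$ on the branches coming from $v$. A saturated group $G$ is locally normal if (1) $H(v)$ is normal in $\Sigma_{k(v)}$ for every vertex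 $v$; and (2) for every automorphism $\phi$ of $G$ that is defined by an isometry $t\in\operatorname{Iso}\mathcal T$ (i.e. $\phi(x)=txt^{-1}$) fixing $v$, the permutation of the children of $v$ induced by $t$ belongs to $H(v)$. *)

theory Defs
  imports "HOL-Algebra.Algebra" "HOL-Library.Extended_Nat"
begin

section \<open>Rooted trees\<close>

text \<open>
  A rooted tree is given by its vertices, its root and the map sending a vertex to its parent.
  By convention the root is its own parent; the edges are the pairs of a non-root vertex and
  its parent.
\<close>

record 'v tree =
  verts :: "'v set"
  root :: 'v
  parent :: "'v \<Rightarrow> 'v"

locale rooted_tree =
  fixes T :: "'v tree"
  assumes root_in_verts: "root T \<in> verts T"
    and parent_in_verts: "v \<in> verts T \<Longrightarrow> parent T v \<in> verts T"
    and parent_root: "parent T (root T) = root T"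
    and reaches_root: "v \<in> verts T \<Longrightarrow> \<exists>n. (parent T ^^ n) v = root T"

definition children :: "'v tree \<Rightarrow> 'v \<Rightarrow> 'v set" where
  "children T v = {w \<in> verts T. w \<noteq> root T \<and> parent T w = v}"

definition branching_index :: "'v tree \<Rightarrow> 'v \<Rightarrow> nat" where
  "branching_index T v = card (children T v)"

definition level :: "'v tree \<Rightarrow> 'v \<Rightarrow> nat" where
  "level T v = (LEAST n. (parent T ^^ n) v = root T)"

definition subtree_verts :: "'v tree \<Rightarrow> 'v \<Rightarrow> 'v set" where
  "subtree_verts T v = {w \<in> verts T. \<exists>n. (parent T ^^ n) w = v}"

locale spherically_symmetric_tree = rooted_tree +
  assumes locally_finite: "v \<in> verts T \<Longrightarrow> finite (children T v)"
    and spherically_symmetric: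
      "\<lbrakk>v \<in> verts T; w \<in> verts T; level T v = level T w\<rbrakk>
        \<Longrightarrow> branching_index T v = branching_index T w"

text \<open>
  \<open>Iso T\<close> is the set of automorphisms of the rooted tree; as in \<^const>\<open>Bij\<close>, they are extensional,
  so that they form a subgroup of \<^const>\<open>BijGroup\<close>.
\<close>

definition Iso :: "'v tree \<Rightarrow> ('v \<Rightarrow> 'v) set" where
  "Iso T = {t \<in> Bij (verts T).
     t (root T) = root T \<and> (\<forall>v \<in> verts T. t (parent T v) = parent T (t v))}"


section \<open>Groups acting on rooted trees\<close>

text \<open>
  The group \<open>G\<close> acts through \<open>\<rho>\<close>. Faithfulness identifies \<open>G\<close> with a subgroup of \<open>Iso T\<close>.
\<close>

locale faithful_tree_action = rooted_tree T + faithful_action G "verts T" \<rho>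
  for T :: "'v tree" and G :: "('a, 'b) monoid_scheme" (structure) and \<rho> :: "'a \<Rightarrow> 'v \<Rightarrow> 'v" +
  assumes acts_by_isos: "g \<in> carrier G \<Longrightarrow> \<rho> g \<in> Iso T"

definition level_stabilizer ::
    "'v tree \<Rightarrow> ('a, 'b) monoid_scheme \<Rightarrow> ('a \<Rightarrow> 'v \<Rightarrow> 'v) \<Rightarrow> nat \<Rightarrow> 'a set" where
  "level_stabilizer T G \<rho> m =
     {g \<in> carrier G. \<forall>v \<in> verts T. level T v = m \<longrightarrow> \<rho> g v = v}"

definition weakly_branch ::
    "'v tree \<Rightarrow> ('a, 'b) monoid_scheme \<Rightarrow> ('a \<Rightarrow> 'v \<Rightarrow> 'v) \<Rightarrow> bool" where
  "weakly_branch T G \<rho> \<longleftrightarrow>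
     faithful_tree_action T G \<rho> \<and>
     (\<forall>v \<in> verts T. \<exists>g \<in> carrier G.
        (\<exists>w \<in> subtree_verts T v. \<rho> g w \<noteq> w) \<and>
        (\<forall>w \<in> verts T - subtree_verts T v. \<rho> g w = w))"

definition characteristic_subgroup :: "'a set \<Rightarrow> ('a, 'b) monoid_scheme \<Rightarrow> bool" where
  "characteristic_subgroup H G \<longleftrightarrow> subgroup H G \<and> (\<forall>\<phi> \<in> iso G G. \<phi> ` H = H)"

definition level_transitive_on_subtree ::
    "'v tree \<Rightarrow> ('a \<Rightarrow> 'v \<Rightarrow> 'v) \<Rightarrow> 'a set \<Rightarrow> 'v \<Rightarrow> bool" where
  "level_transitive_on_subtree T \<rho> H v \<longleftrightarrow>
     (\<forall>u \<in> subtree_verts T v. \<forall>w \<in> subtree_verts T v.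
        level T u = level T w \<longrightarrow> (\<exists>h \<in> H. \<rho> h u = w))"

definition saturated ::
    "'v tree \<Rightarrow> ('a, 'b) monoid_scheme \<Rightarrow> ('a \<Rightarrow> 'v \<Rightarrow> 'v) \<Rightarrow> bool" where
  "saturated T G \<rho> \<longleftrightarrow>
     (\<forall>n. \<exists>H. characteristic_subgroup H G \<and>
        H \<subseteq> level_stabilizer T G \<rho> n \<and>
        (\<forall>v \<in> verts T. level T v = n \<longrightarrow> level_transitive_on_subtree T \<rho> H v))"

text \<open>
  The group \<open>H(v)\<close>, as a set of elements of the symmetric group \<open>BijGroup (children T v)\<close>.
\<close>

definition local_action ::
    "'v tree \<Rightarrow> ('a, 'b) monoid_scheme \<Rightarrow> ('a \<Rightarrow> 'v \<Rightarrow> 'v) \<Rightarrow> 'v \<Rightarrow> ('v \<Rightarrow> 'v) set" where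
  "local_action T G \<rho> v =
     (\<lambda>g. restrict (\<rho> g) (children T v)) ` level_stabilizer T G \<rho> (level T v)"

text \<open>
  The automorphism \<open>\<phi>\<close> is defined by \<open>t\<close> if \<open>\<phi> x = t x t\<^sup>-\<^sup>1\<close>, where \<open>x\<close> is identified with \<open>\<rho> x\<close>.
\<close>

definition defined_by_isometry ::
    "'v tree \<Rightarrow> ('a, 'b) monoid_scheme \<Rightarrow> ('a \<Rightarrow> 'v \<Rightarrow> 'v) \<Rightarrow> ('a \<Rightarrow> 'a) \<Rightarrow> ('v \<Rightarrow> 'v) \<Rightarrow> bool" where
  "defined_by_isometry T G \<rho> \<phi> t \<longleftrightarrow>
     (\<forall>x \<in> carrier G. \<rho> (\<phi> x) =
        t \<otimes>\<^bsub>BijGroup (verts T)\<^esub> \<rho> x \<otimes>\<^bsub>BijGroup (verts T)\<^esub> inv\<^bsub>BijGroup (verts T)\<^esub> t)"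

definition locally_normal ::
    "'v tree \<Rightarrow> ('a, 'b) monoid_scheme \<Rightarrow> ('a \<Rightarrow> 'v \<Rightarrow> 'v) \<Rightarrow> bool" where
  "locally_normal T G \<rho> \<longleftrightarrow>
     (\<forall>v \<in> verts T. local_action T G \<rho> v \<lhd> BijGroup (children T v)) \<and>
     (\<forall>v \<in> verts T. \<forall>\<phi> \<in> iso G G. \<forall>t \<in> Iso T.
        defined_by_isometry T G \<rho> \<phi> t \<and> t v = v \<longrightarrow>
        restrict t (children T v) \<in> local_action T G \<rho> v)"


section \<open>Reidemeister numbers\<close>

definition twisted_conjugacy ::
    "('a, 'b) monoid_scheme \<Rightarrow> ('a \<Rightarrow> 'a) \<Rightarrow> ('a \<times> 'a) set" where
  "twisted_conjugacy G \<phi> =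
     {(x, y). x \<in> carrier G \<and> y \<in> carrier G \<and>
        (\<exists>g \<in> carrier G. y = g \<otimes>\<^bsub>G\<^esub> x \<otimes>\<^bsub>G\<^esub> \<phi> (inv\<^bsub>G\<^esub> g))}"

definition reidemeister_classes ::
    "('a, 'b) monoid_scheme \<Rightarrow> ('a \<Rightarrow> 'a) \<Rightarrow> 'a set set" where
  "reidemeister_classes G \<phi> = carrier G // twisted_conjugacy G \<phi>"

definition reidemeister_number ::
    "('a, 'b) monoid_scheme \<Rightarrow> ('a \<Rightarrow> 'a) \<Rightarrow> enat" where
  "reidemeister_number G \<phi> =
     (if finite (reidemeister_classes G \<phi>)
      then enat (card (reidemeister_classes G \<phi>)) else \<infinity>)"

end

theory Submission
  imports Defs "HOL-Number_Theory.Cong"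
begin

text \<open>
  Every automorphism of a saturated weakly branch group is conjugation by an isometry \<open>t\<close> of the
  tree (\<open>automorphism_induced_by_isometry\<close>): the subgroups \<open>rist v \<inter> H n\<close>, with \<open>v\<close> on level \<open>n\<close>, are
  supported below a single vertex of level \<open>n\<close> both in the given action and in its twist by the
  automorphism, and \<open>t\<close> matches the two vertices. The Reidemeister classes of \<open>\<phi>\<close> are then the
  \<open>G\<close>-conjugacy classes in the coset \<open>G t\<close> of isometries.

  Suppose that there are finitely many. Then for some \<open>n\<^sub>0\<close>, elements of \<open>G t\<close> that agree on the first
  \<open>n\<^sub>0\<close> levels are conjugate on all finite truncations of the tree (\<open>conj_upto_stabilizes\<close>). So a
  class is as large as possible, and in each finite truncation the centralizer in \<open>G\<close> of an element
  of \<open>G t\<close> has at most as many elements as the truncation of \<open>G\<close> to \<open>n\<^sub>0\<close> levels (\<open>card_cent_le\<close>).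
  The contradiction consists in many elements that commute with one and the same element of \<open>G t\<close>.

  Local normality provides an element of \<open>G t\<close> that fixes a path from the root together with all
  children of the vertices of the path (\<open>fixed_path_exists\<close>): as long as it permutes the children of
  a fixed vertex of level \<open>m\<close> nontrivially, it can be corrected by an element of the stabiliser of
  level \<open>m\<close>. A first use of the bound on centralizers shows that the numbers of children are bounded
  (\<open>card_children_le\<close>). Now look at the first level on which the rigid stabiliser of a vertex acts
  nontrivially. Its orbits there have a common size greater than 1, which divides a number of
  children. By boundedness one prime \<open>p\<close> divides these sizes for infinitely many levels.

  Fix such a \<open>p\<close> and a deep truncation. By the Frattini argument some element \<open>x\<close> of \<open>G t\<close>, with
  prescribed action on the first \<open>n\<^sub>0\<close> levels, normalises a Sylow \<open>p\<close>-subgroup \<open>S\<close> of the stabiliser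
  of level \<open>n\<^sub>0\<close>. Stability is used once more: \<open>x\<close> is conjugate to an element with a fixed path as
  above, so it has such a path itself. The siblings of the vertices of this path are fixed by \<open>x\<close>,
  but nothing is known about \<open>x\<close> below them. The power \<open>z\<close> of \<open>x\<close> without \<open>p\<close>-part is under control:
  since \<open>z\<close> acts trivially on the children of a vertex of the path, coprime action provides an
  element of \<open>S\<close> that commutes with \<open>z\<close> and moves the path to a sibling \<open>w\<close>. So below \<open>w\<close> there is
  another path that is fixed by \<open>z\<close>, again with all children. By coprime action, \<open>z\<close> centralises a
  nontrivial subgroup of the \<open>p\<close>-group in which \<open>S\<close> meets the rigid stabiliser of \<open>w\<close>; on it \<open>x\<close> acts
  with \<open>p\<close>-power order, and so \<open>x\<close> commutes with a nontrivial element supported below \<open>w\<close>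
  (\<open>centralizing_element_off_path\<close>). Different levels give disjoint supports, hence more elements
  than the bound allows.
\<close>


section \<open>Counting orbits, and Sylow subgroups\<close>

lemma (in group) subgroup_memD:
  assumes "subgroup H G" "x \<in> H"
  shows "x \<in> carrier G"
  using assms by (rule subgroup.mem_carrier)

text \<open>
  Orbit-stabiliser counting for maps whose fibres are cosets: orbit maps, but also coset maps,
  conjugation and restriction to a subset.
\<close>

lemma (in group) card_eq_stabilizer_times_image:
  assumes A: "subgroup A G" "finite A" and B: "subgroup B G" "B \<subseteq> A"
    and f: "\<And>a b. a \<in> A \<Longrightarrow> b \<in> A \<Longrightarrow> f a = f b \<longleftrightarrow> inv a \<otimes> b \<in> B"
  shows "card A = card B * card (f ` A)"
proof -
  have "card {b \<in> A. f b = f a} = card B" if a: "a \<in> A" for a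
  proof -
    have ac: "a \<in> carrier G" using a subgroup_memD[OF A(1)] by blast
    have "{b \<in> A. f b = f a} = (\<lambda>b. a \<otimes> b) ` B"
    proof (intro Set.set_eqI iffI)
      fix b assume "b \<in> {b \<in> A. f b = f a}"
      then have b: "b \<in> A" "inv a \<otimes> b \<in> B" using f[of a b] a by auto
      have "b = a \<otimes> (inv a \<otimes> b)"
        using ac b(1) subgroup_memD[OF A(1)] by (simp add: m_assoc[symmetric])
      then show "b \<in> (\<lambda>b. a \<otimes> b) ` B" using b(2) by blast
    next
      fix b assume "b \<in> (\<lambda>b. a \<otimes> b) ` B"
      then obtain c where c: "c \<in> B" "b = a \<otimes> c" by blast
      have cc: "c \<in> carrier G" using c subgroup_memD[OF B(1)] by blast
      have "b \<in> A" using c a B(2) A(1) by (simp add: subgroup.m_closed subset_iff)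
      moreover have "inv a \<otimes> b \<in> B" using c ac cc by (simp add: m_assoc[symmetric])
      ultimately show "b \<in> {b \<in> A. f b = f a}" using f[of a b] a by auto
    qed
    moreover have "inj_on (\<lambda>b. a \<otimes> b) B"
    proof (rule inj_onI)
      fix u v assume "u \<in> B" "v \<in> B" "a \<otimes> u = a \<otimes> v"
      then show "u = v" using ac subgroup_memD[OF B(1)] by simp
    qed
    ultimately show ?thesis by (simp add: card_image)
  qed
  moreover have "card A = (\<Sum>y\<in>f ` A. card {b \<in> A. f b = y})"
    using sum.image_gen[OF A(2), of "\<lambda>_. 1::nat" f] by simp
  moreover have "(\<Sum>y\<in>f ` A. card {b \<in> A. f b = y}) = (\<Sum>y\<in>f ` A. card B)"
    using calculation(1) by (intro sum.cong) auto
  ultimately show ?thesis by (simp add: mult.commute)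
qed

text \<open>
  An action as a family of maps, without the extensionality of \<^const>\<open>Bij\<close>: conjugation,
  translation of cosets and the action on vertices all have this form.
\<close>

locale acting_group = group G for G (structure) +
  fixes \<Omega> :: "'x set" and act :: "'a \<Rightarrow> 'x \<Rightarrow> 'x"
  assumes act_closed: "g \<in> carrier G \<Longrightarrow> x \<in> \<Omega> \<Longrightarrow> act g x \<in> \<Omega>"
    and act_one: "x \<in> \<Omega> \<Longrightarrow> act \<one> x = x"
    and act_mult: "g \<in> carrier G \<Longrightarrow> h \<in> carrier G \<Longrightarrow> x \<in> \<Omega> \<Longrightarrow> act (g \<otimes> h) x = act g (act h x)"
begin

lemma act_inv: "g \<in> carrier G \<Longrightarrow> x \<in> \<Omega> \<Longrightarrow> act (inv g) (act g x) = x"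
  by (metis act_mult act_one inv_closed l_inv)

lemma act_inv': "g \<in> carrier G \<Longrightarrow> x \<in> \<Omega> \<Longrightarrow> act g (act (inv g) x) = x"
  by (metis act_mult act_one inv_closed r_inv)

lemma act_inj: "g \<in> carrier G \<Longrightarrow> x \<in> \<Omega> \<Longrightarrow> y \<in> \<Omega> \<Longrightarrow> act g x = act g y \<Longrightarrow> x = y"
  by (metis act_inv)

lemma act_pow_fixed:
  assumes "x \<in> carrier G" "v \<in> \<Omega>" "act x v = v"
  shows "act (x [^] (k::nat)) v = v"
proof (induction k)
  case 0 then show ?case using act_one assms by simp
next
  case (Suc k) then show ?case using act_mult[of "x [^] k" x v] assms by simp
qed

lemma subgroup_point_stabilizer:
  assumes H: "subgroup H G" and x: "x \<in> \<Omega>"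
  shows "subgroup {h \<in> H. act h x = x} G"
proof (rule subgroupI)
  show "{h \<in> H. act h x = x} \<subseteq> carrier G" using subgroup_memD[OF H(1)] by blast
  show "{h \<in> H. act h x = x} \<noteq> {}" using subgroup.one_closed[OF H] act_one[OF x] by blast
  show "inv a \<in> {h \<in> H. act h x = x}" if "a \<in> {h \<in> H. act h x = x}" for a
    using that subgroup.m_inv_closed[OF H] act_inv[of a x] subgroup_memD[OF H] x by auto
  show "a \<otimes> b \<in> {h \<in> H. act h x = x}"
    if "a \<in> {h \<in> H. act h x = x}" "b \<in> {h \<in> H. act h x = x}" for a b
    using that subgroup.m_closed[OF H] act_mult[of a b x] subgroup_memD[OF H] x by auto
qed

lemma card_orbit_stabilizer:
  assumes H: "subgroup H G" "finite H" and x: "x \<in> \<Omega>"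
  shows "card H = card {h \<in> H. act h x = x} * card ((\<lambda>h. act h x) ` H)"
proof (rule card_eq_stabilizer_times_image[OF H])
  show "subgroup {h \<in> H. act h x = x} G" using subgroup_point_stabilizer[OF H(1) x] .
  fix a b assume ab: "a \<in> H" "b \<in> H"
  then have c: "a \<in> carrier G" "b \<in> carrier G" using subgroup_memD[OF H(1)] by blast+
  have "inv a \<otimes> b \<in> H" using ab H(1) by (simp add: subgroup.m_closed subgroup.m_inv_closed)
  moreover have "act a x = act b x \<longleftrightarrow> act (inv a \<otimes> b) x = x"
    using c x by (metis act_closed act_inv act_inv' act_mult inv_closed)
  ultimately show "(act a x = act b x) = (inv a \<otimes> b \<in> {h \<in> H. act h x = x})" by blast
qed auto

lemma orbit_eq_or_disjoint:
  assumes H: "subgroup H G" and xy: "x \<in> \<Omega>" "y \<in> \<Omega>"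
    and meet: "(\<lambda>h. act h x) ` H \<inter> (\<lambda>h. act h y) ` H \<noteq> {}"
  shows "(\<lambda>h. act h x) ` H = (\<lambda>h. act h y) ` H"
proof -
  have *: "(\<lambda>h. act h x) ` H \<subseteq> (\<lambda>h. act h y) ` H"
    if "x \<in> \<Omega>" "y \<in> \<Omega>" "a \<in> H" "b \<in> H" "act a x = act b y" for x y a b
  proof
    fix w assume "w \<in> (\<lambda>h. act h x) ` H"
    then obtain h where h: "h \<in> H" "w = act h x" by blast
    have c: "a \<in> carrier G" "b \<in> carrier G" "h \<in> carrier G"
      using that h subgroup_memD[OF H(1)] by blast+
    have "x = act (inv a) (act b y)" using that c act_inv by metis
    then have "w = act (h \<otimes> (inv a \<otimes> b)) y" using h c that by (simp add: act_mult act_closed)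
    moreover have "h \<otimes> (inv a \<otimes> b) \<in> H"
      using h that H by (simp add: subgroup.m_closed subgroup.m_inv_closed)
    ultimately show "w \<in> (\<lambda>h. act h y) ` H" by blast
  qed
  obtain a b where "a \<in> H" "b \<in> H" "act a x = act b y" using meet by blast
  with *[of x y a b] *[of y x b a] xy show ?thesis by auto
qed

lemma mem_orbit: "subgroup H G \<Longrightarrow> x \<in> \<Omega> \<Longrightarrow> x \<in> (\<lambda>h. act h x) ` H"
  using act_one subgroup.one_closed by (metis image_eqI)

lemma dvd_card_if_dvd_orbits:
  assumes H: "subgroup H G" and Y: "Y \<subseteq> \<Omega>" "finite Y"
    and closed: "\<And>h y. h \<in> H \<Longrightarrow> y \<in> Y \<Longrightarrow> act h y \<in> Y"
    and d: "\<And>y. y \<in> Y \<Longrightarrow> d dvd card ((\<lambda>h. act h y) ` H)"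
  shows "d dvd card Y"
proof -
  let ?C = "(\<lambda>y. (\<lambda>h. act h y) ` H) ` Y"
  have U: "\<Union>?C = Y"
    using closed mem_orbit[OF H] Y(1) by blast
  have "d dvd card (\<Union>?C)"
  proof (rule dvd_partition)
    show "finite (\<Union>?C)" using U Y by simp
    show "\<forall>c\<in>?C. d dvd card c" using d by blast
    show "\<forall>c1\<in>?C. \<forall>c2\<in>?C. c1 \<noteq> c2 \<longrightarrow> c1 \<inter> c2 = {}"
      using orbit_eq_or_disjoint[OF H] Y(1) by blast
  qed
  then show ?thesis using U by simp
qed

lemma card_cong_card_fixed_points:
  assumes P: "subgroup P G" "card P = p ^ a" and p: "Factorial_Ring.prime (p::nat)"
    and Y: "Y \<subseteq> \<Omega>" "finite Y"
    and closed: "\<And>h y. h \<in> P \<Longrightarrow> y \<in> Y \<Longrightarrow> act h y \<in> Y"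
  shows "[card Y = card {y \<in> Y. \<forall>h\<in>P. act h y = y}] (mod p)"
proof -
  let ?F = "{y \<in> Y. \<forall>h\<in>P. act h y = y}"
  have finP: "finite P" using P(2) p prime_gt_0_nat by (metis card.infinite power_not_zero less_not_refl)
  have "p dvd card (Y - ?F)"
  proof (rule dvd_card_if_dvd_orbits[OF P(1)])
    show "Y - ?F \<subseteq> \<Omega>" "finite (Y - ?F)" using Y by auto
    show "act h y \<in> Y - ?F" if h: "h \<in> P" and y: "y \<in> Y - ?F" for h y
    proof -
      have hc: "h \<in> carrier G" using h subgroup_memD[OF P(1)] by blast
      have "y \<in> ?F" if "act h y \<in> ?F"
      proof -
        have "act (inv h) (act h y) = act h y"
          using that subgroup.m_inv_closed[OF P(1) h] by blast
        then have "act h y = y" using act_inv[OF hc, of y] y Y by auto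
        then show ?thesis using that by simp
      qed
      then show ?thesis using closed h y by blast
    qed
    show "p dvd card ((\<lambda>h. act h y) ` P)" if y: "y \<in> Y - ?F" for y
    proof -
      have "card ((\<lambda>h. act h y) ` P) dvd p ^ a"
      proof -
        have "y \<in> \<Omega>" using y Y by blast
        then show ?thesis using card_orbit_stabilizer[OF P(1) finP] P(2) by (metis dvd_triv_right)
      qed
      then obtain b where b: "card ((\<lambda>h. act h y) ` P) = p ^ b"
        using divides_primepow_nat[OF p] by blast
      have "b \<noteq> 0"
      proof
        assume "b = 0"
        then obtain w where "(\<lambda>h. act h y) ` P = {w}" using b card_1_singletonE by (metis power_0)
        moreover have "y \<in> (\<lambda>h. act h y) ` P" using mem_orbit[OF P(1)] y Y by blast
        ultimately have "\<forall>h\<in>P. act h y = y" by (metis image_eqI singletonD)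
        then show False using y by blast
      qed
      then show ?thesis using b by simp
    qed
  qed
  moreover have "card Y = card (Y - ?F) + card ?F"
    using Y(2) by (simp add: card_Diff_subset card_mono)
  ultimately show ?thesis
    by (auto simp: cong_def elim!: dvdE)
qed

text \<open>
  When \<open>D\<close> is normalised by \<open>E\<close>, the \<open>E\<close>-translates of a \<open>D\<close>-orbit are \<open>D\<close>-orbits of the
  same size, so an \<open>E\<close>-orbit is cut into equal pieces.
\<close>

lemma card_orbit_dvd_card_orbit_if_normalizes:
  assumes D: "subgroup D G" and E: "subgroup E G" and "D \<subseteq> E"
    and norm: "\<And>e d. e \<in> E \<Longrightarrow> d \<in> D \<Longrightarrow> e \<otimes> d \<otimes> inv e \<in> D"
    and x: "x \<in> \<Omega>" and fin: "finite ((\<lambda>e. act e x) ` E)"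
  shows "card ((\<lambda>d. act d x) ` D) dvd card ((\<lambda>e. act e x) ` E)"
proof (rule dvd_card_if_dvd_orbits[OF D _ fin])
  show "(\<lambda>e. act e x) ` E \<subseteq> \<Omega>" using act_closed x subgroup_memD[OF E(1)] by blast
  show "act h y \<in> (\<lambda>e. act e x) ` E" if hy: "h \<in> D" "y \<in> (\<lambda>e. act e x) ` E" for h y
  proof -
    obtain e where e: "e \<in> E" "y = act e x" using hy(2) by blast
    then have "act h y = act (h \<otimes> e) x" "h \<otimes> e \<in> E"
      using hy \<open>D \<subseteq> E\<close> x E subgroup_memD[OF E] by (auto simp: act_mult subgroup.m_closed subset_iff)
    then show ?thesis by blast
  qed
  show "card ((\<lambda>d. act d x) ` D) dvd card ((\<lambda>d. act d y) ` D)" if y: "y \<in> (\<lambda>e. act e x) ` E" for y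
  proof -
    obtain e where e: "e \<in> E" "y = act e x" using y by blast
    have ec: "e \<in> carrier G" using e subgroup_memD[OF E(1)] by blast
    have "(\<lambda>d. act d y) ` D = act e ` (\<lambda>d. act d x) ` D"
    proof (intro Set.set_eqI iffI)
      fix w assume "w \<in> (\<lambda>d. act d y) ` D"
      then obtain d where d: "d \<in> D" "w = act d y" by blast
      have dc: "d \<in> carrier G" using d subgroup_memD[OF D(1)] by blast
      have "inv e \<otimes> d \<otimes> inv (inv e) \<in> D" using norm d e subgroup.m_inv_closed[OF E] by blast
      then have "inv e \<otimes> d \<otimes> e \<in> D" using ec by simp
      moreover have "w = act e (act (inv e \<otimes> d \<otimes> e) x)"
        using d e ec dc x by (simp add: act_mult act_closed act_inv')
      ultimately show "w \<in> act e ` (\<lambda>d. act d x) ` D" by blast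
    next
      fix w assume "w \<in> act e ` (\<lambda>d. act d x) ` D"
      then obtain d where d: "d \<in> D" "w = act e (act d x)" by blast
      have dc: "d \<in> carrier G" using d subgroup_memD[OF D(1)] by blast
      have "w = act (e \<otimes> d \<otimes> inv e) y"
        using d e ec dc x by (simp add: act_mult act_closed act_inv)
      then show "w \<in> (\<lambda>d. act d y) ` D" using norm[OF e(1) d(1)] by blast
    qed
    moreover have "inj_on (act e) ((\<lambda>d. act d x) ` D)"
    proof (rule inj_onI)
      fix u v assume "u \<in> (\<lambda>d. act d x) ` D" "v \<in> (\<lambda>d. act d x) ` D" "act e u = act e v"
      moreover have "(\<lambda>d. act d x) ` D \<subseteq> \<Omega>" using act_closed x subgroup_memD[OF D(1)] by blast
      ultimately show "u = v" using act_inj[OF ec] by blast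
    qed
    ultimately show ?thesis by (simp add: card_image)
  qed
qed

end

text \<open>The cyclic group of order \<open>q ^ a\<close> acts through the iterates of \<open>f\<close>.\<close>

lemma card_cong_card_fixed_points_funpow:
  assumes q: "Factorial_Ring.prime (q::nat)" and Y: "finite Y" "f ` Y \<subseteq> Y"
    and pow: "\<And>y. y \<in> Y \<Longrightarrow> (f ^^ (q ^ a)) y = y"
  shows "[card Y = card {y \<in> Y. f y = y}] (mod q)"
proof -
  let ?n = "q ^ a"
  let ?G = "integer_mod_group ?n"
  have n: "?n > 0" using q prime_gt_0_nat by simp
  have carr: "carrier ?G = {0..<int ?n}" using n by (simp add: carrier_integer_mod_group)
  have closed: "(f ^^ k) y \<in> Y" if "y \<in> Y" for k y
    using that Y(2) by (induction k) auto
  interpret group ?G by simp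
  interpret acting_group ?G Y "\<lambda>k. f ^^ (nat k)"
  proof
    fix g y assume "y \<in> Y" then show "(f ^^ nat g) y \<in> Y" using closed by blast
  next
    fix y assume "y \<in> Y" then show "(f ^^ nat \<one>\<^bsub>?G\<^esub>) y = y" by simp
  next
    fix g h y assume gh: "g \<in> carrier ?G" "h \<in> carrier ?G" and y: "y \<in> Y"
    then have nn: "0 \<le> g" "0 \<le> h" using carr by auto
    have "g \<otimes>\<^bsub>?G\<^esub> h = (g + h) mod int ?n"
      by (simp only: mult_integer_mod_group)
    then have "nat (g \<otimes>\<^bsub>?G\<^esub> h) = (nat g + nat h) mod ?n"
      using nn by (metis nat_add_distrib nat_int nat_mod_distrib add_nonneg_nonneg of_nat_0_le_iff)
    then have "(f ^^ nat (g \<otimes>\<^bsub>?G\<^esub> h)) y = (f ^^ (nat g + nat h)) y"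
      using funpow_mod_eq[of ?n f y] pow[OF y] by simp
    then show "(f ^^ nat (g \<otimes>\<^bsub>?G\<^esub> h)) y = (f ^^ nat g) ((f ^^ nat h) y)" by (simp add: funpow_add)
  qed
  have "[card Y = card {y \<in> Y. \<forall>h\<in>carrier ?G. (f ^^ nat h) y = y}] (mod q)"
    by (rule card_cong_card_fixed_points[OF subgroup_self _ q _ Y(1), of a]) (auto simp: carr closed nat_power_eq)
  moreover have "{y \<in> Y. \<forall>h\<in>carrier ?G. (f ^^ nat h) y = y} = {y \<in> Y. f y = y}"
  proof (intro Set.set_eqI iffI)
    fix y assume y: "y \<in> {y \<in> Y. \<forall>h\<in>carrier ?G. (f ^^ nat h) y = y}"
    show "y \<in> {y \<in> Y. f y = y}"
    proof (cases "?n = 1")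
      case True
      then have "(f ^^ 1) y = y" using y pow[of y] by (metis (no_types, lifting) mem_Collect_eq)
      then show ?thesis using y by simp
    next
      case False
      then have "(1::int) \<in> carrier ?G" using n carr by (simp; linarith)
      then show ?thesis using y by fastforce
    qed
  next
    fix y assume y: "y \<in> {y \<in> Y. f y = y}"
    then have "(f ^^ k) y = y" for k by (induction k) auto
    then show "y \<in> {y \<in> Y. \<forall>h\<in>carrier ?G. (f ^^ nat h) y = y}" using y by blast
  qed
  ultimately show ?thesis by simp
qed


text \<open>The maximality of a Sylow subgroup is recorded through its order.\<close>

definition (in group) sylow_subgroup :: "nat \<Rightarrow> 'a set \<Rightarrow> 'a set \<Rightarrow> bool" where
  "sylow_subgroup p S K \<longleftrightarrow> subgroup S G \<and> S \<subseteq> K \<and>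
     (\<exists>a m. card S = p ^ a \<and> card K = p ^ a * m \<and> \<not> p dvd m)"

context group
begin

lemma left_coset_action: "acting_group G {C. C \<subseteq> carrier G} (l_coset G)"
proof
  fix g C assume "g \<in> carrier G" "C \<in> {C. C \<subseteq> carrier G}"
  then show "g <# C \<in> {C. C \<subseteq> carrier G}" using l_coset_subset_G by blast
next
  fix C assume "C \<in> {C. C \<subseteq> carrier G}"
  then show "\<one> <# C = C" using lcos_mult_one by blast
next
  fix g h C assume "g \<in> carrier G" "h \<in> carrier G" "C \<in> {C. C \<subseteq> carrier G}"
  then show "(g \<otimes> h) <# C = g <# (h <# C)" using lcos_m_assoc by simp
qed

lemma mem_l_coset_iff:
  assumes S: "subgroup S G" and g: "g \<in> carrier G" and x: "x \<in> carrier G"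
  shows "x \<in> g <# S \<longleftrightarrow> inv g \<otimes> x \<in> S"
proof
  assume "x \<in> g <# S"
  then obtain s where s: "s \<in> S" "x = g \<otimes> s" unfolding l_coset_def by blast
  then show "inv g \<otimes> x \<in> S" using g subgroup_memD[OF S] by (simp add: m_assoc[symmetric])
next
  assume a: "inv g \<otimes> x \<in> S"
  have "x = g \<otimes> (inv g \<otimes> x)" using g x by (simp add: m_assoc[symmetric])
  then show "x \<in> g <# S" using a unfolding l_coset_def by blast
qed

lemma l_coset_eq_iff:
  assumes S: "subgroup S G" and g: "g \<in> carrier G" and h: "h \<in> carrier G"
  shows "g <# S = h <# S \<longleftrightarrow> inv g \<otimes> h \<in> S"
proof
  assume "g <# S = h <# S"
  moreover have "h \<in> h <# S" using mem_l_coset_iff[OF S h h] h subgroup.one_closed[OF S] by simp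
  ultimately show "inv g \<otimes> h \<in> S" using mem_l_coset_iff[OF S g h] by simp
next
  assume "inv g \<otimes> h \<in> S"
  then have "h \<in> g <# S" using mem_l_coset_iff[OF S g h] by simp
  then show "g <# S = h <# S" using l_repr_independence[OF _ g S] by blast
qed

text \<open>
  The number of cosets of \<open>S\<close> in \<open>K\<close> is prime to \<open>p\<close>, so the \<open>p\<close>-group \<open>P\<close> fixes one of them.
\<close>

lemma sylow_subgroup_contains_conjugate:
  assumes K: "subgroup K G" "finite K" and p: "Factorial_Ring.prime (p::nat)"
    and S: "sylow_subgroup p S K" and P: "subgroup P G" "P \<subseteq> K" "card P = p ^ b"
  shows "\<exists>g\<in>K. \<forall>u\<in>P. inv g \<otimes> u \<otimes> g \<in> S"
proof -
  obtain a m where S': "subgroup S G" "S \<subseteq> K" "card S = p ^ a" "card K = p ^ a * m" "\<not> p dvd m"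
    using S unfolding sylow_subgroup_def by blast
  interpret acting_group G "{C. C \<subseteq> carrier G}" "l_coset G" by (rule left_coset_action)
  let ?Y = "(\<lambda>k. k <# S) ` K"
  have Ksub: "K \<subseteq> carrier G" using subgroup.subset[OF K(1)] .
  have "card K = card S * card ?Y"
  proof (rule card_eq_stabilizer_times_image[OF K S'(1,2)])
    fix a b assume "a \<in> K" "b \<in> K"
    then show "(a <# S = b <# S) = (inv a \<otimes> b \<in> S)" using l_coset_eq_iff[OF S'(1)] Ksub by blast
  qed
  then have m: "card ?Y = m" using S' p prime_gt_0_nat[of p] by simp
  have "[card ?Y = card {y \<in> ?Y. \<forall>h\<in>P. h <# y = y}] (mod p)"
  proof (rule card_cong_card_fixed_points[OF P(1,3) p])
    show "?Y \<subseteq> {C. C \<subseteq> carrier G}" using Ksub S' l_coset_subset_G by blast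
    show "finite ?Y" using K by simp
    fix h y assume h: "h \<in> P" and "y \<in> ?Y"
    then obtain k where k: "k \<in> K" "y = k <# S" by blast
    have "h <# y = (h \<otimes> k) <# S" using k h P(2) Ksub S' by (metis lcos_m_assoc subgroup.subset subsetD)
    moreover have "h \<otimes> k \<in> K" using subgroup.m_closed[OF K(1)] h k P(2) by blast
    ultimately show "h <# y \<in> ?Y" by blast
  qed
  then have "card {y \<in> ?Y. \<forall>h\<in>P. h <# y = y} \<noteq> 0"
    using m S'(5) by (metis cong_0_iff)
  then have "{y \<in> ?Y. \<forall>h\<in>P. h <# y = y} \<noteq> {}" by (metis card.empty)
  then obtain g where g: "g \<in> K" "\<forall>h\<in>P. h <# (g <# S) = g <# S" by blast
  have gc: "g \<in> carrier G" using g Ksub by blast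
  have "inv g \<otimes> u \<otimes> g \<in> S" if u: "u \<in> P" for u
  proof -
    have uc: "u \<in> carrier G" using u P(2) Ksub by blast
    have "g <# S = (u \<otimes> g) <# S" using g u uc gc S' by (metis lcos_m_assoc subgroup.subset)
    then have "inv g \<otimes> (u \<otimes> g) \<in> S" using l_coset_eq_iff[OF S'(1) gc, of "u \<otimes> g"] uc gc by simp
    then show ?thesis using uc gc by (simp add: m_assoc)
  qed
  then show ?thesis using g by blast
qed

lemma sylow_subgroup_exists:
  assumes K: "subgroup K G" "finite K" and p: "Factorial_Ring.prime (p::nat)"
  shows "\<exists>S. sylow_subgroup p S K"
proof -
  have K0: "card K \<noteq> 0" using K subgroup.one_closed[OF K(1)] by auto
  have "\<not> is_unit p" using p by (simp add: prime_nat_iff)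
  then obtain m where m: "card K = p ^ multiplicity p (card K) * m" "\<not> p dvd m"
    using multiplicity_decompose'[OF K0] by blast
  interpret K: group "G\<lparr>carrier := K\<rparr>" using subgroup.subgroup_is_group[OF K(1) is_group] .
  obtain S where S: "subgroup S (G\<lparr>carrier := K\<rparr>)" "card S = p ^ multiplicity p (card K)"
    using sylow_thm[OF p K.is_group, of "multiplicity p (card K)" m] m(1) K by (auto simp: order_def)
  have "subgroup S G" using incl_subgroup[OF K(1) S(1)] .
  moreover have "S \<subseteq> K" using subgroup.subset[OF S(1)] by simp
  ultimately show ?thesis unfolding sylow_subgroup_def using S(2) m by blast
qed

lemma conjugate_image_subgroup:
  assumes S: "subgroup S G" and x: "x \<in> carrier G"
  shows "subgroup ((\<lambda>s. x \<otimes> s \<otimes> inv x) ` S) G"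
proof (rule subgroupI)
  have Sc: "s \<in> carrier G" if "s \<in> S" for s using that subgroup_memD[OF S] by blast
  show "(\<lambda>s. x \<otimes> s \<otimes> inv x) ` S \<subseteq> carrier G" using Sc x by auto
  show "(\<lambda>s. x \<otimes> s \<otimes> inv x) ` S \<noteq> {}" using subgroup.one_closed[OF S] by blast
  fix a assume a: "a \<in> (\<lambda>s. x \<otimes> s \<otimes> inv x) ` S"
  then obtain s where s: "s \<in> S" "a = x \<otimes> s \<otimes> inv x" by blast
  have "inv a = x \<otimes> inv s \<otimes> inv x" using s Sc x by (simp add: inv_mult_group m_assoc)
  then show "inv a \<in> (\<lambda>s. x \<otimes> s \<otimes> inv x) ` S" using subgroup.m_inv_closed[OF S s(1)] by blast
  fix b assume "b \<in> (\<lambda>s. x \<otimes> s \<otimes> inv x) ` S"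
  then obtain u where u: "u \<in> S" "b = x \<otimes> u \<otimes> inv x" by blast
  have "a \<otimes> b = x \<otimes> s \<otimes> (inv x \<otimes> x) \<otimes> u \<otimes> inv x"
    unfolding s u using Sc[OF s(1)] Sc[OF u(1)] x by (simp only: m_assoc inv_closed m_closed)
  also have "\<dots> = x \<otimes> (s \<otimes> u) \<otimes> inv x" using Sc[OF s(1)] Sc[OF u(1)] x by (simp add: m_assoc)
  finally show "a \<otimes> b \<in> (\<lambda>s. x \<otimes> s \<otimes> inv x) ` S" using subgroup.m_closed[OF S s(1) u(1)] by blast
qed

lemma card_conjugate_image:
  assumes "S \<subseteq> carrier G" "x \<in> carrier G"
  shows "card ((\<lambda>s. x \<otimes> s \<otimes> inv x) ` S) = card S"
  using assms by (intro card_image inj_onI) (simp add: subset_iff)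

text \<open>
  Frattini argument: \<open>x\<close> moves a Sylow subgroup of \<open>K\<close> to another one, and an element of \<open>K\<close>
  moves it back.
\<close>

lemma coset_element_normalizing_sylow_subgroup:
  assumes K: "subgroup K G" "finite K" and p: "Factorial_Ring.prime (p::nat)"
    and x: "x \<in> carrier G" and norm: "\<And>k. k \<in> K \<Longrightarrow> x \<otimes> k \<otimes> inv x \<in> K"
  shows "\<exists>k\<in>K. \<exists>S. sylow_subgroup p S K \<and> (\<forall>s\<in>S. (k \<otimes> x) \<otimes> s \<otimes> inv (k \<otimes> x) \<in> S)"
proof -
  obtain S where S: "sylow_subgroup p S K" using sylow_subgroup_exists[OF K p] by blast
  then obtain a m where S': "subgroup S G" "S \<subseteq> K" "card S = p ^ a"
    unfolding sylow_subgroup_def by blast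
  have Sc: "S \<subseteq> carrier G" using subgroup.subset[OF S'(1)] .
  let ?P = "(\<lambda>s. x \<otimes> s \<otimes> inv x) ` S"
  have "\<exists>g\<in>K. \<forall>u\<in>?P. inv g \<otimes> u \<otimes> g \<in> S"
  proof (rule sylow_subgroup_contains_conjugate[OF K p S])
    show "subgroup ?P G" using conjugate_image_subgroup[OF S'(1) x] .
    show "?P \<subseteq> K" using norm S'(2) by blast
    show "card ?P = p ^ a" using card_conjugate_image[OF Sc x] S' by simp
  qed
  then obtain g where g: "g \<in> K" "\<And>s. s \<in> S \<Longrightarrow> inv g \<otimes> (x \<otimes> s \<otimes> inv x) \<otimes> g \<in> S" by blast
  have gc: "g \<in> carrier G" using g subgroup_memD[OF K(1)] by blast
  have "(inv g \<otimes> x) \<otimes> s \<otimes> inv (inv g \<otimes> x) \<in> S" if "s \<in> S" for s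
  proof -
    have sc: "s \<in> carrier G" using that Sc by blast
    show ?thesis using g(2)[OF that] gc x sc by (simp add: inv_mult_group m_assoc)
  qed
  moreover have "inv g \<in> K" using subgroup.m_inv_closed[OF K(1) g(1)] .
  ultimately show ?thesis using S by blast
qed

lemma card_subgroup_dvd:
  assumes A: "subgroup A G" "finite A" and B: "subgroup B G" "B \<subseteq> A"
  shows "card B dvd card A"
proof -
  have "card A = card B * card ((\<lambda>k. k <# B) ` A)"
  proof (rule card_eq_stabilizer_times_image[OF A B])
    fix a b assume "a \<in> A" "b \<in> A"
    then show "(a <# B = b <# B) = (inv a \<otimes> b \<in> B)"
      using l_coset_eq_iff[OF B(1)] subgroup_memD[OF A(1)] by blast
  qed
  then show ?thesis by simp
qed

text \<open>
  Some conjugate of a Sylow subgroup of \<open>N\<close> lies in \<open>S\<close>, and also in \<open>N\<close> by normality; so \<open>S \<inter> N\<close>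
  is large enough.
\<close>

lemma sylow_subgroup_Int_normal:
  assumes K: "subgroup K G" "finite K" and p: "Factorial_Ring.prime (p::nat)"
    and S: "sylow_subgroup p S K" and N: "subgroup N G" "N \<subseteq> K"
    and norm: "\<And>k n. k \<in> K \<Longrightarrow> n \<in> N \<Longrightarrow> k \<otimes> n \<otimes> inv k \<in> N"
  shows "sylow_subgroup p (S \<inter> N) N"
proof -
  have finN: "finite N" using N K finite_subset by blast
  obtain Q where Q: "sylow_subgroup p Q N" using sylow_subgroup_exists[OF N(1) finN p] by blast
  then obtain a m where Q': "subgroup Q G" "Q \<subseteq> N" "card Q = p ^ a" "card N = p ^ a * m" "\<not> p dvd m"
    unfolding sylow_subgroup_def by blast
  obtain c where S': "subgroup S G" "S \<subseteq> K" "card S = p ^ c"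
    using S unfolding sylow_subgroup_def by blast
  have "\<exists>g\<in>K. \<forall>u\<in>Q. inv g \<otimes> u \<otimes> g \<in> S"
    using sylow_subgroup_contains_conjugate[OF K p S Q'(1) _ Q'(3)] Q'(2) N(2) by blast
  then obtain g where g: "g \<in> K" "\<And>u. u \<in> Q \<Longrightarrow> inv g \<otimes> u \<otimes> g \<in> S" by blast
  have gi: "inv g \<in> K" "g \<in> carrier G" using subgroup.m_inv_closed[OF K(1) g(1)] g subgroup_memD[OF K(1)] by blast+
  have SN: "subgroup (S \<inter> N) G" using subgroups_Inter_pair[OF S'(1) N(1)] .
  have finSN: "finite (S \<inter> N)" using finN by blast
  have "(\<lambda>u. inv g \<otimes> u \<otimes> inv (inv g)) ` Q \<subseteq> S \<inter> N"
  proof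
    fix w assume "w \<in> (\<lambda>u. inv g \<otimes> u \<otimes> inv (inv g)) ` Q"
    then obtain u where u: "u \<in> Q" "w = inv g \<otimes> u \<otimes> inv (inv g)" by blast
    then show "w \<in> S \<inter> N" using g(2)[OF u(1)] norm[OF gi(1), of u] Q'(2) gi by auto
  qed
  then have "p ^ a \<le> card (S \<inter> N)"
    using card_conjugate_image[of Q "inv g"] Q' gi card_mono[OF finSN]
    by (metis inv_closed subgroup.subset)
  moreover have "card (S \<inter> N) dvd p ^ c"
    using card_subgroup_dvd[OF S'(1) _ SN] S'(2,3) K(2) finite_subset[of S K] by auto
  then obtain d where d: "card (S \<inter> N) = p ^ d" using divides_primepow_nat[OF p] by blast
  moreover have "p ^ d dvd p ^ a * m" using card_subgroup_dvd[OF N(1) finN SN] d Q'(4) by simp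
  then have "d \<le> a" using Q'(5) p
    by (metis coprime_dvd_mult_left_iff coprime_power_left_iff prime_imp_coprime power_dvd_imp_le prime_gt_1_nat coprime_commute dvd_refl zero_less_iff_neq_zero power_0 le0)
  ultimately have "card (S \<inter> N) = p ^ a" using p
    by (metis le_antisym power_increasing_iff prime_gt_1_nat)
  then show ?thesis unfolding sylow_subgroup_def using SN Q' by blast
qed

end

text \<open>The order of a subgroup that fixes \<open>x\<close> divides the order of the point stabiliser.\<close>

lemma (in acting_group) sylow_subgroup_moves_point:
  assumes K: "subgroup K G" "finite K" and p: "Factorial_Ring.prime (p::nat)"
    and S: "sylow_subgroup p S K" and x: "x \<in> \<Omega>"
    and dvd: "p dvd card ((\<lambda>k. act k x) ` K)"
  shows "\<exists>s\<in>S. act s x \<noteq> x"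
proof (rule ccontr)
  assume "\<not> ?thesis"
  then have fixed: "\<And>s. s \<in> S \<Longrightarrow> act s x = x" by blast
  obtain a m where S': "subgroup S G" "S \<subseteq> K" "card S = p ^ a" "card K = p ^ a * m" "\<not> p dvd m"
    using S unfolding sylow_subgroup_def by blast
  let ?H = "{k \<in> K. act k x = x}"
  have "card S dvd card ?H"
    by (rule card_subgroup_dvd) (use subgroup_point_stabilizer[OF K(1) x] K S' fixed in auto)
  then obtain u where u: "card ?H = p ^ a * u" using S'(3) by (metis dvdE)
  obtain v where v: "card ((\<lambda>k. act k x) ` K) = p * v" using dvd by (metis dvdE)
  have "p ^ a * m = p ^ a * (u * (p * v))"
    using card_orbit_stabilizer[OF K x] S'(4) u v by (simp add: mult.assoc)
  then have "m = p * (u * v)" using p prime_gt_0_nat[of p] by simp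
  then show False using S'(5) by simp
qed


section \<open>Coprime action on \<open>p\<close>-groups\<close>

context group
begin

lemma subgroup_centralizer:
  assumes A: "subgroup A G" and z: "z \<in> carrier G"
  shows "subgroup {a \<in> A. z \<otimes> a = a \<otimes> z} G"
proof (rule subgroupI)
  show "{a \<in> A. z \<otimes> a = a \<otimes> z} \<subseteq> carrier G" using subgroup_memD[OF A] by blast
  show "{a \<in> A. z \<otimes> a = a \<otimes> z} \<noteq> {}" using subgroup.one_closed[OF A] z by force
  fix a assume a: "a \<in> {a \<in> A. z \<otimes> a = a \<otimes> z}"
  then have ac: "a \<in> carrier G" using subgroup_memD[OF A] by blast
  have "inv a \<otimes> (z \<otimes> a) \<otimes> inv a = inv a \<otimes> (a \<otimes> z) \<otimes> inv a" using a by simp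
  then have "z \<otimes> inv a = inv a \<otimes> z"
    using ac z by (metis inv_closed inv_solve_left m_assoc m_closed inv_solve_right)
  then show "inv a \<in> {a \<in> A. z \<otimes> a = a \<otimes> z}" using a subgroup.m_inv_closed[OF A] by blast
  fix b assume b: "b \<in> {a \<in> A. z \<otimes> a = a \<otimes> z}"
  then have bc: "b \<in> carrier G" using subgroup_memD[OF A] by blast
  have "z \<otimes> (a \<otimes> b) = a \<otimes> (z \<otimes> b)" using a ac bc z by (simp add: m_assoc[symmetric])
  also have "\<dots> = (a \<otimes> b) \<otimes> z" using b ac bc z by (simp add: m_assoc)
  finally show "a \<otimes> b \<in> {a \<in> A. z \<otimes> a = a \<otimes> z}" using a b subgroup.m_closed[OF A] by blast
qed

lemma commute_iff_conj_eq:
  assumes "z \<in> carrier G" "a \<in> carrier G"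
  shows "z \<otimes> a = a \<otimes> z \<longleftrightarrow> z \<otimes> a \<otimes> inv z = a"
  using assms by (metis inv_solve_right m_closed)

lemma conj_eq_conj_iff:
  assumes "x \<in> carrier G" "a \<in> carrier G" "b \<in> carrier G"
  shows "a \<otimes> x \<otimes> inv a = b \<otimes> x \<otimes> inv b \<longleftrightarrow> x \<otimes> (inv a \<otimes> b) = (inv a \<otimes> b) \<otimes> x"
proof -
  have "a \<otimes> x \<otimes> inv a = b \<otimes> x \<otimes> inv b \<longleftrightarrow> a \<otimes> x \<otimes> inv a \<otimes> b = b \<otimes> x"
    using assms by (metis inv_solve_right m_closed inv_closed)
  also have "\<dots> \<longleftrightarrow> a \<otimes> (x \<otimes> (inv a \<otimes> b)) = b \<otimes> x"
    using assms by (simp add: m_assoc)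
  also have "\<dots> \<longleftrightarrow> x \<otimes> (inv a \<otimes> b) = inv a \<otimes> (b \<otimes> x)"
    using assms by (metis inv_solve_left m_closed inv_closed)
  finally show ?thesis using assms by (simp add: m_assoc)
qed

lemma funpow_conj:
  assumes "z \<in> carrier G" "a \<in> carrier G"
  shows "((\<lambda>h. z \<otimes> h \<otimes> inv z) ^^ n) a = z [^] n \<otimes> a \<otimes> inv (z [^] n)"
proof (induction n)
  case 0 then show ?case using assms by simp
next
  case (Suc n)
  have "z [^] Suc n = z \<otimes> z [^] n" using assms by (metis nat_pow_Suc2)
  then show ?case using Suc assms by (simp add: m_assoc inv_mult_group)
qed

lemma pow_conj_closed:
  assumes "z \<in> carrier G" "S \<subseteq> carrier G" "\<And>s. s \<in> S \<Longrightarrow> z \<otimes> s \<otimes> inv z \<in> S" "s \<in> S"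
  shows "z [^] (n::nat) \<otimes> s \<otimes> inv (z [^] n) \<in> S"
proof -
  have "((\<lambda>h. z \<otimes> h \<otimes> inv z) ^^ n) s \<in> S"
    by (induction n) (use assms in auto)
  then show ?thesis using funpow_conj assms by (metis subsetD)
qed

lemma conj_mult:
  assumes "z \<in> carrier G" "a \<in> carrier G" "b \<in> carrier G"
  shows "z \<otimes> (a \<otimes> b) \<otimes> inv z = (z \<otimes> a \<otimes> inv z) \<otimes> (z \<otimes> b \<otimes> inv z)"
proof -
  have "(z \<otimes> a \<otimes> inv z) \<otimes> (z \<otimes> b \<otimes> inv z) = z \<otimes> a \<otimes> (inv z \<otimes> z) \<otimes> b \<otimes> inv z"
    using assms by (simp only: m_assoc inv_closed m_closed)
  then show ?thesis using assms by (simp add: m_assoc)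
qed

text \<open>
  Coprime action: an automorphism of order prime to \<open>p\<close> that preserves a coset in a \<open>p\<close>-group
  fixes an element of it. The fixed points of a proper power form a coset of a subgroup, hence a
  set of \<open>p\<close>-power size, and the remaining prime \<open>q \<noteq> p\<close> cannot move all of them.
\<close>

lemma coprime_conj_fixes_coset_element:
  assumes p: "Factorial_Ring.prime (p::nat)"
    and S: "subgroup S G" "card S = p ^ c" and B: "subgroup B G" "B \<subseteq> S" and s: "s \<in> S"
    and z: "z \<in> carrier G" and norm: "\<And>b. b \<in> B \<Longrightarrow> z \<otimes> b \<otimes> inv z \<in> B"
    and normS: "\<And>b. b \<in> S \<Longrightarrow> z \<otimes> b \<otimes> inv z \<in> S"
    and quot: "inv s \<otimes> (z \<otimes> s \<otimes> inv z) \<in> B"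
    and n: "z [^] n = \<one>" "\<not> p dvd n"
  shows "\<exists>h\<in>S. inv s \<otimes> h \<in> B \<and> z \<otimes> h = h \<otimes> z"
  using z norm normS quot n
proof (induction n arbitrary: z rule: less_induct)
  case (less n)
  have Sc: "S \<subseteq> carrier G" and Bc: "B \<subseteq> carrier G" using S B subgroup.subset by blast+
  have sc: "s \<in> carrier G" using s Sc by blast
  have zc: "z \<in> carrier G" using less.prems(1) .
  have finS: "finite S" using S(2) p prime_gt_0_nat by (metis card.infinite power_not_zero less_not_refl)
  show ?case
  proof (cases "n = 1")
    case True
    then have "z = \<one>" using less.prems by simp
    then show ?thesis using s sc subgroup.one_closed[OF B(1)] by (intro bexI[of _ s]) auto
  next
    case False
    then obtain q where q: "Factorial_Ring.prime q" "q dvd n" using prime_factor_nat by blast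
    then obtain k where k: "n = q * k" by (metis dvdE)
    have n0: "n \<noteq> 0" using less.prems(6) by (intro notI) simp
    have kn: "k < n" using k q n0 prime_gt_1_nat[of q] by simp
    have pk: "\<not> p dvd k" using k less.prems(6) by auto
    have pq: "p \<noteq> q" using q less.prems(6) by blast
    let ?z = "z [^] q"
    have zq: "?z \<in> carrier G" using zc by simp
    have coset: "inv s \<otimes> (z \<otimes> h \<otimes> inv z) \<in> B" if h: "h \<in> S" "inv s \<otimes> h \<in> B" for h
    proof -
      have hc: "h \<in> carrier G" using h Sc by blast
      have "z \<otimes> h \<otimes> inv z = z \<otimes> (s \<otimes> (inv s \<otimes> h)) \<otimes> inv z" using sc hc by (simp add: m_assoc[symmetric])
      also have "\<dots> = (z \<otimes> s \<otimes> inv z) \<otimes> (z \<otimes> (inv s \<otimes> h) \<otimes> inv z)"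
        using conj_mult zc sc hc by simp
      finally have "inv s \<otimes> (z \<otimes> h \<otimes> inv z) = (inv s \<otimes> (z \<otimes> s \<otimes> inv z)) \<otimes> (z \<otimes> (inv s \<otimes> h) \<otimes> inv z)"
        using zc sc hc by (simp add: m_assoc)
      then show ?thesis using subgroup.m_closed[OF B(1) less.prems(4) less.prems(2)[OF h(2)]] by simp
    qed
    have "((\<lambda>h. z \<otimes> h \<otimes> inv z) ^^ j) s \<in> S \<and> inv s \<otimes> ((\<lambda>h. z \<otimes> h \<otimes> inv z) ^^ j) s \<in> B" for j
    proof (induction j)
      case 0 then show ?case using s sc subgroup.one_closed[OF B(1)] by simp
    next
      case (Suc j) then show ?case using coset less.prems(3) by simp
    qed
    then have quot': "inv s \<otimes> (?z \<otimes> s \<otimes> inv ?z) \<in> B" using funpow_conj[OF zc sc] by metis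
    have "?z [^] k = \<one>" using less.prems(5) k zc by (simp add: nat_pow_pow)
    then obtain h0 where h0: "h0 \<in> S" "inv s \<otimes> h0 \<in> B" "?z \<otimes> h0 = h0 \<otimes> ?z"
      using less.IH[OF kn zq _ _ quot' _ pk] pow_conj_closed[OF zc Bc less.prems(2)]
        pow_conj_closed[OF zc Sc less.prems(3)] by blast
    have h0c: "h0 \<in> carrier G" using h0 Sc by blast
    let ?Y = "{h \<in> S. inv s \<otimes> h \<in> B \<and> ?z \<otimes> h = h \<otimes> ?z}"
    let ?C = "{b \<in> B. ?z \<otimes> b = b \<otimes> ?z}"
    have "?Y = (\<lambda>b. h0 \<otimes> b) ` ?C"
    proof (intro Set.set_eqI iffI)
      fix h assume h: "h \<in> ?Y"
      then have hc: "h \<in> carrier G" using Sc by blast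
      have "inv h0 \<otimes> h = inv (inv s \<otimes> h0) \<otimes> (inv s \<otimes> h)"
        using h0c hc sc by (simp add: inv_mult_group m_assoc) (simp add: m_assoc[symmetric])
      then have "inv h0 \<otimes> h \<in> B" using h h0 subgroup.m_closed[OF B(1)] subgroup.m_inv_closed[OF B(1)] by simp
      moreover have "?z \<otimes> (inv h0 \<otimes> h) = (inv h0 \<otimes> h) \<otimes> ?z"
      proof -
        have cs: "subgroup {a \<in> S. ?z \<otimes> a = a \<otimes> ?z} G" using subgroup_centralizer[OF S(1) zq] .
        have "inv h0 \<in> {a \<in> S. ?z \<otimes> a = a \<otimes> ?z}" using subgroup.m_inv_closed[OF cs] h0 by blast
        then show ?thesis using subgroup.m_closed[OF cs, of "inv h0" h] h by blast
      qed
      moreover have "h = h0 \<otimes> (inv h0 \<otimes> h)" using h0c hc by (simp add: m_assoc[symmetric])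
      ultimately show "h \<in> (\<lambda>b. h0 \<otimes> b) ` ?C" by blast
    next
      fix h assume "h \<in> (\<lambda>b. h0 \<otimes> b) ` ?C"
      then obtain b where b: "b \<in> B" "?z \<otimes> b = b \<otimes> ?z" "h = h0 \<otimes> b" by blast
      have bc: "b \<in> carrier G" using b Bc by blast
      have "inv s \<otimes> h = (inv s \<otimes> h0) \<otimes> b" using b sc h0c bc by (simp add: m_assoc)
      then have "inv s \<otimes> h \<in> B" using subgroup.m_closed[OF B(1) h0(2) b(1)] by simp
      moreover have "?z \<otimes> h = h \<otimes> ?z"
      proof -
        have "?z \<otimes> h = h0 \<otimes> ?z \<otimes> b" using h0(3) b(3) zq h0c bc by (simp add: m_assoc[symmetric])
        also have "\<dots> = h0 \<otimes> (b \<otimes> ?z)" using b(2) zq h0c bc by (simp add: m_assoc)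
        finally show ?thesis using b(3) zq h0c bc by (simp add: m_assoc)
      qed
      moreover have "h \<in> S" using b(1,3) h0(1) B(2) subgroup.m_closed[OF S(1)] by blast
      ultimately show "h \<in> ?Y" by blast
    qed
    moreover have "inj_on (\<lambda>b. h0 \<otimes> b) ?C" using h0c Bc by (intro inj_onI) (auto simp: subset_iff)
    ultimately have "card ?Y = card ?C" by (simp add: card_image)
    moreover have "card ?C dvd p ^ c"
      using card_subgroup_dvd[OF S(1) finS subgroup_centralizer[OF B(1) zq]] B(2) S(2) by auto
    ultimately obtain e where e: "card ?Y = p ^ e" using divides_primepow_nat[OF p] by metis
    have "[card ?Y = card {y \<in> ?Y. z \<otimes> y \<otimes> inv z = y}] (mod q)"
    proof (rule card_cong_card_fixed_points_funpow[OF q(1), of _ _ 1])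
      show "finite ?Y" using finS by simp
      show "(\<lambda>h. z \<otimes> h \<otimes> inv z) ` ?Y \<subseteq> ?Y"
      proof
        fix w assume "w \<in> (\<lambda>h. z \<otimes> h \<otimes> inv z) ` ?Y"
        then obtain h where h: "h \<in> ?Y" "w = z \<otimes> h \<otimes> inv z" by blast
        then have hc: "h \<in> carrier G" using Sc by blast
        have zz: "z \<otimes> ?z = ?z \<otimes> z" using zc by (metis nat_pow_Suc nat_pow_Suc2)
        then have zi: "inv z \<otimes> ?z = ?z \<otimes> inv z"
          using zc zq by (metis inv_closed inv_solve_left inv_solve_right m_assoc m_closed)
        have "?z \<otimes> w = z \<otimes> (?z \<otimes> h) \<otimes> inv z" using h(2) zz zc zq hc by (simp add: m_assoc[symmetric])
        also have "\<dots> = z \<otimes> h \<otimes> (?z \<otimes> inv z)" using h(1) zc zq hc by (simp add: m_assoc)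
        also have "\<dots> = w \<otimes> ?z" using h(2) zi zc zq hc by (simp add: m_assoc)
        finally show "w \<in> ?Y" using h coset[of h] less.prems(3) by simp
      qed
      fix y assume y: "y \<in> ?Y"
      then have yc: "y \<in> carrier G" using Sc by blast
      have "?z \<otimes> y \<otimes> inv ?z = y" using y commute_iff_conj_eq[OF zq yc] by blast
      then show "((\<lambda>h. z \<otimes> h \<otimes> inv z) ^^ q ^ 1) y = y" using funpow_conj[OF zc yc] by simp
    qed
    moreover have "\<not> q dvd p ^ e" using p q pq by (metis prime_dvd_power primes_dvd_imp_eq)
    ultimately have "card {y \<in> ?Y. z \<otimes> y \<otimes> inv z = y} \<noteq> 0"
      using e by (metis cong_0_iff)
    then have "{y \<in> ?Y. z \<otimes> y \<otimes> inv z = y} \<noteq> {}" by (metis card.empty)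
    then obtain h where h: "h \<in> S" "inv s \<otimes> h \<in> B" "z \<otimes> h \<otimes> inv z = h" by blast
    then show ?thesis using commute_iff_conj_eq[OF zc, of h] Sc by blast
  qed
qed

text \<open>
  Conjugation by \<open>x\<close> permutes \<open>S\<close> with \<open>p\<close>-power order, so the number of its fixed points is divisible
  by \<open>p\<close>.
\<close>

lemma p_power_conj_fixes_nontrivial:
  assumes p: "Factorial_Ring.prime (p::nat)" and S: "subgroup S G" "card S = p ^ c"
    and nontriv: "\<exists>s\<in>S. s \<noteq> \<one>"
    and x: "x \<in> carrier G" and norm: "\<And>s. s \<in> S \<Longrightarrow> x \<otimes> s \<otimes> inv x \<in> S"
    and pow: "\<And>s. s \<in> S \<Longrightarrow> x [^] (p ^ a) \<otimes> s = s \<otimes> x [^] (p ^ a)"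
  shows "\<exists>s\<in>S. s \<noteq> \<one> \<and> x \<otimes> s = s \<otimes> x"
proof -
  have Sc: "S \<subseteq> carrier G" using S subgroup.subset by blast
  have finS: "finite S" using S(2) p prime_gt_0_nat by (metis card.infinite power_not_zero less_not_refl)
  have one: "\<one> \<in> S" using subgroup.one_closed[OF S(1)] .
  let ?F = "{s \<in> S. x \<otimes> s \<otimes> inv x = s}"
  have "[card S = card ?F] (mod p)"
  proof (rule card_cong_card_fixed_points_funpow[OF p finS, of _ a])
    show "(\<lambda>s. x \<otimes> s \<otimes> inv x) ` S \<subseteq> S" using norm by blast
    fix y assume y: "y \<in> S"
    then have yc: "y \<in> carrier G" using Sc by blast
    have "x [^] (p ^ a) \<otimes> y \<otimes> inv (x [^] (p ^ a)) = y"
      using pow[OF y] commute_iff_conj_eq[of "x [^] (p ^ a)" y] x yc by simp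
    then show "((\<lambda>h. x \<otimes> h \<otimes> inv x) ^^ p ^ a) y = y" using funpow_conj[OF x yc] by metis
  qed
  moreover have "c \<noteq> 0"
  proof
    assume "c = 0"
    then obtain w where "S = {w}" using S(2) card_1_singletonE by (metis power_0)
    then show False using one nontriv by blast
  qed
  then have "p dvd card S" using S(2) by simp
  ultimately have "p dvd card ?F" by (metis cong_dvd_iff)
  have "?F \<noteq> {\<one>}"
  proof
    assume "?F = {\<one>}"
    then have "p dvd 1" using \<open>p dvd card ?F\<close> by simp
    then show False using p by (simp add: prime_nat_iff)
  qed
  moreover have "\<one> \<in> ?F" using one x by simp
  ultimately obtain s where "s \<in> ?F" "s \<noteq> \<one>" by blast
  then show ?thesis using commute_iff_conj_eq[OF x, of s] Sc by blast
qed

end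

text \<open>
  Apply the preceding lemma to the coset of \<open>s\<close> modulo the elements of \<open>P\<close> that act trivially on
  \<open>Y\<close>: it is preserved by \<open>z\<close>, because \<open>z\<close> itself acts trivially on \<open>Y\<close>.
\<close>

lemma (in acting_group) commuting_element_moving_point:
  assumes p: "Factorial_Ring.prime (p::nat)" and P: "subgroup P G" "card P = p ^ c"
    and z: "z \<in> carrier G" and norm: "\<And>b. b \<in> P \<Longrightarrow> z \<otimes> b \<otimes> inv z \<in> P"
    and n: "z [^] n = \<one>" "\<not> p dvd n"
    and Y: "Y \<subseteq> \<Omega>" and zY: "\<And>y. y \<in> Y \<Longrightarrow> act z y = y"
    and PY: "\<And>b y. b \<in> P \<Longrightarrow> y \<in> Y \<Longrightarrow> act b y \<in> Y"
    and s: "s \<in> P" and y0: "y0 \<in> Y" "act s y0 \<noteq> y0"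
  shows "\<exists>h\<in>P. act h y0 \<noteq> y0 \<and> z \<otimes> h = h \<otimes> z"
proof -
  let ?B = "{b \<in> P. \<forall>y\<in>Y. act b y = y}"
  have Pc: "b \<in> carrier G" if "b \<in> P" for b using subgroup_memD[OF P(1) that] .
  have Yo: "y \<in> \<Omega>" if "y \<in> Y" for y using Y that by blast
  have B: "subgroup ?B G"
  proof (rule subgroupI)
    show "?B \<subseteq> carrier G" using Pc by blast
    show "?B \<noteq> {}" using subgroup.one_closed[OF P(1)] act_one Yo by blast
    fix a assume a: "a \<in> ?B"
    have "act (inv a) y = y" if "y \<in> Y" for y using act_inv[OF Pc Yo[OF that], of a] a that by auto
    then show "inv a \<in> ?B" using a subgroup.m_inv_closed[OF P(1)] by blast
    fix b assume b: "b \<in> ?B"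
    have "act (a \<otimes> b) y = y" if "y \<in> Y" for y using a b that by (simp add: act_mult Pc Yo)
    then show "a \<otimes> b \<in> ?B" using a b subgroup.m_closed[OF P(1)] by blast
  qed
  have ziY: "act (inv z) y = y" if "y \<in> Y" for y using act_inv[OF z Yo[OF that]] zY[OF that] by simp
  have "\<exists>h\<in>P. inv s \<otimes> h \<in> ?B \<and> z \<otimes> h = h \<otimes> z"
  proof (rule coprime_conj_fixes_coset_element[OF p P B _ s z _ norm _ n])
    show "?B \<subseteq> P" by blast
    fix b assume b: "b \<in> ?B"
    have "act (z \<otimes> b \<otimes> inv z) y = y" if "y \<in> Y" for y
      using b that z by (simp add: act_mult Pc Yo ziY zY)
    then show "z \<otimes> b \<otimes> inv z \<in> ?B" using norm b by blast
  next
    have "act (inv s \<otimes> (z \<otimes> s \<otimes> inv z)) y = y" if y: "y \<in> Y" for y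
    proof -
      have "act (inv s \<otimes> (z \<otimes> s \<otimes> inv z)) y = act (inv s) (act z (act s (act (inv z) y)))"
        using z Pc[OF s] Yo[OF y] by (simp add: act_mult act_closed)
      then show ?thesis using ziY[OF y] zY[OF PY[OF s y]] act_inv[OF Pc[OF s] Yo[OF y]] by simp
    qed
    then show "inv s \<otimes> (z \<otimes> s \<otimes> inv z) \<in> ?B"
      using subgroup.m_closed[OF P(1) subgroup.m_inv_closed[OF P(1) s] norm[OF s]] by blast
  qed
  then obtain h where h: "h \<in> P" "inv s \<otimes> h \<in> ?B" "z \<otimes> h = h \<otimes> z" by blast
  have "act (inv s) (act h y0) = y0" using h(1,2) y0(1) Pc s by (auto simp: act_mult Yo)
  then have "act h y0 = act s y0" using act_inv'[OF Pc[OF s], of "act h y0"] act_closed[OF Pc[OF h(1)] Yo[OF y0(1)]] by simp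
  then show ?thesis using h(1,3) y0(2) by (intro bexI[of _ h]) auto
qed


section \<open>Vertices, levels and subtrees\<close>

context rooted_tree
begin

lemma funpow_parent_in_verts: "v \<in> verts T \<Longrightarrow> (parent T ^^ n) v \<in> verts T"
  by (induction n) (auto simp: parent_in_verts)

lemma funpow_level: "v \<in> verts T \<Longrightarrow> (parent T ^^ level T v) v = root T"
  unfolding level_def using reaches_root by (metis (mono_tags, lifting) LeastI)

lemma level_root: "level T (root T) = 0"
  unfolding level_def by (rule Least_equality) auto

lemma level_eq_0_iff: "v \<in> verts T \<Longrightarrow> level T v = 0 \<longleftrightarrow> v = root T"
  using funpow_level[of v] level_root by auto

lemma level_parent_Suc:
  assumes "v \<in> verts T" "v \<noteq> root T"
  shows "level T v = Suc (level T (parent T v))"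
proof -
  obtain n where "(parent T ^^ n) v = root T" using reaches_root assms by blast
  then have "(LEAST n. (parent T ^^ n) v = root T) = Suc (LEAST m. (parent T ^^ Suc m) v = root T)"
    by (rule Least_Suc) (use assms in simp)
  then show ?thesis unfolding level_def by (simp add: funpow_Suc_right del: funpow.simps)
qed

lemma level_parent: "v \<in> verts T \<Longrightarrow> level T (parent T v) = level T v - 1"
  using level_parent_Suc[of v] level_root parent_root by (cases "v = root T") auto

lemma level_funpow_parent: "v \<in> verts T \<Longrightarrow> level T ((parent T ^^ n) v) = level T v - n"
  by (induction n) (auto simp: level_parent funpow_parent_in_verts)

end

definition ancestor :: "'v tree \<Rightarrow> nat \<Rightarrow> 'v \<Rightarrow> 'v" where
  "ancestor T n v = (parent T ^^ (level T v - n)) v"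

context rooted_tree
begin

lemma ancestor_in_verts: "v \<in> verts T \<Longrightarrow> ancestor T n v \<in> verts T"
  unfolding ancestor_def by (rule funpow_parent_in_verts)

lemma level_ancestor: "v \<in> verts T \<Longrightarrow> n \<le> level T v \<Longrightarrow> level T (ancestor T n v) = n"
  unfolding ancestor_def by (simp add: level_funpow_parent)

lemma ancestor_level_self: "ancestor T (level T v) v = v"
  unfolding ancestor_def by simp

lemma ancestor_ancestor:
  assumes "v \<in> verts T" "m \<le> n" "n \<le> level T v"
  shows "ancestor T m (ancestor T n v) = ancestor T m v"
proof -
  have "ancestor T m (ancestor T n v) = (parent T ^^ (n - m)) ((parent T ^^ (level T v - n)) v)"
    using level_ancestor[OF assms(1,3)] unfolding ancestor_def by simp
  also have "\<dots> = (parent T ^^ ((n - m) + (level T v - n))) v" by (simp add: funpow_add)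
  also have "(n - m) + (level T v - n) = level T v - m" using assms by simp
  finally show ?thesis unfolding ancestor_def .
qed

lemma ancestor_Suc:
  assumes "v \<in> verts T" "n < level T v"
  shows "ancestor T n v = parent T (ancestor T (Suc n) v)"
proof -
  have "level T v - n = Suc (level T v - Suc n)" using assms by simp
  then show ?thesis unfolding ancestor_def by simp
qed

lemma mem_subtree_iff:
  assumes "v \<in> verts T" "w \<in> verts T"
  shows "w \<in> subtree_verts T v \<longleftrightarrow> level T v \<le> level T w \<and> ancestor T (level T v) w = v"
proof
  assume "w \<in> subtree_verts T v"
  then obtain n where n: "(parent T ^^ n) w = v" unfolding subtree_verts_def by blast
  show "level T v \<le> level T w \<and> ancestor T (level T v) w = v"
  proof (cases "n \<le> level T w")
    case True
    then have "level T w - level T v = n" using level_funpow_parent[OF assms(2), of n] n by simp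
    then show ?thesis using n level_funpow_parent[OF assms(2), of n] unfolding ancestor_def by simp
  next
    case False
    then have "level T v = 0" using level_funpow_parent[OF assms(2), of n] n by simp
    then show ?thesis using level_eq_0_iff[OF assms(1)] funpow_level[OF assms(2)]
      unfolding ancestor_def by simp
  qed
next
  assume "level T v \<le> level T w \<and> ancestor T (level T v) w = v"
  then show "w \<in> subtree_verts T v" using assms unfolding subtree_verts_def ancestor_def by blast
qed

lemma subtree_in_verts: "w \<in> subtree_verts T v \<Longrightarrow> w \<in> verts T"
  unfolding subtree_verts_def by blast

lemma self_in_subtree: "v \<in> verts T \<Longrightarrow> v \<in> subtree_verts T v"
  using mem_subtree_iff ancestor_level_self by simp

lemma in_subtree_ancestor: "w \<in> verts T \<Longrightarrow> n \<le> level T w \<Longrightarrow> w \<in> subtree_verts T (ancestor T n w)"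
  unfolding subtree_verts_def ancestor_def by blast

lemma level_le_of_subtree: "v \<in> verts T \<Longrightarrow> w \<in> subtree_verts T v \<Longrightarrow> level T v \<le> level T w"
  using mem_subtree_iff subtree_in_verts by blast

lemma subtree_trans:
  assumes "w \<in> subtree_verts T v" "u \<in> subtree_verts T w"
  shows "u \<in> subtree_verts T v"
proof -
  obtain m n where "(parent T ^^ m) w = v" "(parent T ^^ n) u = w" "u \<in> verts T"
    using assms unfolding subtree_verts_def by blast
  then have "(parent T ^^ (m + n)) u = v" by (simp add: funpow_add)
  then show ?thesis using \<open>u \<in> verts T\<close> unfolding subtree_verts_def by blast
qed

lemma same_level_subtrees_disjoint:
  assumes "v \<in> verts T" "w \<in> verts T" "level T v = level T w"
    and "u \<in> subtree_verts T v" "u \<in> subtree_verts T w"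
  shows "v = w"
  using assms mem_subtree_iff subtree_in_verts by metis

lemma subtrees_meet_nested:
  assumes v: "v \<in> verts T" and w: "w \<in> verts T" and le: "level T v \<le> level T w"
    and u: "u \<in> subtree_verts T v" "u \<in> subtree_verts T w"
  shows "w \<in> subtree_verts T v"
proof -
  have uv: "u \<in> verts T" using u subtree_in_verts by blast
  have "ancestor T (level T v) w = ancestor T (level T v) u"
    using u mem_subtree_iff[OF w uv] ancestor_ancestor[OF uv le] by auto
  then show ?thesis using u mem_subtree_iff[OF v uv] mem_subtree_iff[OF v w] le by simp
qed

lemma children_iff:
  "w \<in> children T v \<longleftrightarrow> w \<in> verts T \<and> parent T w = v \<and> level T w = Suc (level T v)"
proof
  assume "w \<in> children T v"
  then show "w \<in> verts T \<and> parent T w = v \<and> level T w = Suc (level T v)"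
    unfolding children_def using level_parent_Suc by auto
next
  assume "w \<in> verts T \<and> parent T w = v \<and> level T w = Suc (level T v)"
  then show "w \<in> children T v" unfolding children_def using level_root by auto
qed

lemma child_in_subtree: "w \<in> children T v \<Longrightarrow> w \<in> subtree_verts T v"
  unfolding children_def subtree_verts_def by (auto intro: exI[of _ 1])

lemma subtree_child_of_neq:
  assumes v: "v \<in> verts T" and u: "u \<in> subtree_verts T v" "u \<noteq> v"
  shows "ancestor T (Suc (level T v)) u \<in> children T v" "Suc (level T v) \<le> level T u"
proof -
  have uv: "u \<in> verts T" using u subtree_in_verts by blast
  have m: "level T v \<le> level T u" "ancestor T (level T v) u = v" using mem_subtree_iff[OF v uv] u by auto
  show l: "Suc (level T v) \<le> level T u"
  proof (rule ccontr)
    assume "\<not> ?thesis"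
    then have "level T v = level T u" using m by simp
    then show False using m(2) u(2) ancestor_level_self[of u] by simp
  qed
  have "parent T (ancestor T (Suc (level T v)) u) = v"
    using ancestor_Suc[OF uv, of "level T v"] l m by simp
  then show "ancestor T (Suc (level T v)) u \<in> children T v"
    using children_iff ancestor_in_verts[OF uv] level_ancestor[OF uv l] by blast
qed

end

context spherically_symmetric_tree
begin

lemma finite_level: "finite {v \<in> verts T. level T v = n}"
proof (induction n)
  case 0
  have "{v \<in> verts T. level T v = 0} \<subseteq> {root T}" using level_eq_0_iff by blast
  then show ?case using finite_subset by blast
next
  case (Suc n)
  have "{v \<in> verts T. level T v = Suc n} \<subseteq> (\<Union>u\<in>{v \<in> verts T. level T v = n}. children T u)"
  proof
    fix v assume "v \<in> {v \<in> verts T. level T v = Suc n}"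
    then have v: "v \<in> verts T" "level T v = Suc n" by auto
    then have "v \<noteq> root T" using level_root by auto
    then have "v \<in> children T (parent T v)" using v unfolding children_def by blast
    moreover have "parent T v \<in> {v \<in> verts T. level T v = n}"
      using v level_parent parent_in_verts by auto
    ultimately show "v \<in> (\<Union>u\<in>{v \<in> verts T. level T v = n}. children T u)" by blast
  qed
  moreover have "finite (\<Union>u\<in>{v \<in> verts T. level T v = n}. children T u)"
    using Suc locally_finite by blast
  ultimately show ?case using finite_subset by blast
qed

lemma finite_levels_upto: "finite {v \<in> verts T. level T v \<le> n}"
proof -
  have "{v \<in> verts T. level T v \<le> n} = (\<Union>m\<in>{..n}. {v \<in> verts T. level T v = m})" by auto
  then show ?thesis using finite_level by auto
qed

end

subsection \<open>Isometries\<close>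

context rooted_tree
begin

lemma Iso_in_verts: "t \<in> Iso T \<Longrightarrow> v \<in> verts T \<Longrightarrow> t v \<in> verts T"
  unfolding Iso_def using Bij_imp_funcset by blast

lemma Iso_inj: "t \<in> Iso T \<Longrightarrow> v \<in> verts T \<Longrightarrow> w \<in> verts T \<Longrightarrow> t v = t w \<Longrightarrow> v = w"
  unfolding Iso_def Bij_def bij_betw_def inj_on_def by blast

lemma Iso_parent: "t \<in> Iso T \<Longrightarrow> v \<in> verts T \<Longrightarrow> t (parent T v) = parent T (t v)"
  unfolding Iso_def by blast

lemma Iso_root: "t \<in> Iso T \<Longrightarrow> t (root T) = root T"
  unfolding Iso_def by blast

lemma Iso_funpow_parent:
  "t \<in> Iso T \<Longrightarrow> v \<in> verts T \<Longrightarrow> t ((parent T ^^ n) v) = (parent T ^^ n) (t v)"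
  by (induction n) (auto simp: Iso_parent funpow_parent_in_verts)

lemma Iso_level:
  assumes t: "t \<in> Iso T" and v: "v \<in> verts T"
  shows "level T (t v) = level T v"
proof -
  have "(parent T ^^ n) (t v) = root T \<longleftrightarrow> (parent T ^^ n) v = root T" for n
    using Iso_funpow_parent[OF t v] Iso_root[OF t] Iso_inj[OF t] funpow_parent_in_verts[OF v]
      root_in_verts by metis
  then show ?thesis unfolding level_def by simp
qed

end

subsection \<open>Groups of isometries\<close>

text \<open>A faithful action by isometries in pointwise form, free of extensionality.\<close>

locale tree_action = spherically_symmetric_tree T + acting_group G "verts T" \<rho>
  for T :: "'v tree" and G :: "('a, 'b) monoid_scheme" (structure) and \<rho> :: "'a \<Rightarrow> 'v \<Rightarrow> 'v" +
  assumes act_parent: "g \<in> carrier G \<Longrightarrow> v \<in> verts T \<Longrightarrow> \<rho> g (parent T v) = parent T (\<rho> g v)"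
    and act_level: "g \<in> carrier G \<Longrightarrow> v \<in> verts T \<Longrightarrow> level T (\<rho> g v) = level T v"
    and act_faithful: "g \<in> carrier G \<Longrightarrow> (\<And>v. v \<in> verts T \<Longrightarrow> \<rho> g v = v) \<Longrightarrow> g = \<one>"
begin

lemma act_funpow_parent:
  "g \<in> carrier G \<Longrightarrow> v \<in> verts T \<Longrightarrow> \<rho> g ((parent T ^^ n) v) = (parent T ^^ n) (\<rho> g v)"
  by (induction n) (auto simp: act_parent funpow_parent_in_verts)

lemma act_ancestor:
  "g \<in> carrier G \<Longrightarrow> v \<in> verts T \<Longrightarrow> \<rho> g (ancestor T n v) = ancestor T n (\<rho> g v)"
  unfolding ancestor_def by (simp add: act_funpow_parent act_level)

lemma act_subtree:
  "g \<in> carrier G \<Longrightarrow> w \<in> subtree_verts T v \<Longrightarrow> \<rho> g w \<in> subtree_verts T (\<rho> g v)"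
  unfolding subtree_verts_def using act_funpow_parent act_closed by (auto; metis)

lemma act_children:
  "g \<in> carrier G \<Longrightarrow> v \<in> verts T \<Longrightarrow> w \<in> children T v \<Longrightarrow> \<rho> g w \<in> children T (\<rho> g v)"
  unfolding children_iff using act_closed act_level act_parent by auto

lemma act_eqI:
  assumes "g \<in> carrier G" "h \<in> carrier G" "\<And>v. v \<in> verts T \<Longrightarrow> \<rho> g v = \<rho> h v"
  shows "g = h"
proof -
  have "inv h \<otimes> g = \<one>"
    by (rule act_faithful) (use assms act_inv in \<open>auto simp: act_mult\<close>)
  then show ?thesis using assms by (metis inv_closed inv_equality inv_inv)
qed

lemma act_inv_fixed: "g \<in> carrier G \<Longrightarrow> v \<in> verts T \<Longrightarrow> \<rho> g v = v \<Longrightarrow> \<rho> (inv g) v = v"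
  using act_inv[of g v] by simp

text \<open>The rigid stabiliser of a vertex.\<close>

definition rist :: "'v \<Rightarrow> 'a set" where
  "rist v = {g \<in> carrier G. \<forall>w \<in> verts T - subtree_verts T v. \<rho> g w = w}"

abbreviation St :: "nat \<Rightarrow> 'a set" where
  "St n \<equiv> level_stabilizer T G \<rho> n"

lemma rist_subgroup: "subgroup (rist v) G"
proof (rule subgroupI)
  show "rist v \<subseteq> carrier G" unfolding rist_def by blast
  show "rist v \<noteq> {}" unfolding rist_def using act_one by auto
  fix g assume g: "g \<in> rist v"
  show "inv g \<in> rist v" using g unfolding rist_def by (simp add: act_inv_fixed)
  fix h assume "h \<in> rist v"
  then show "g \<otimes> h \<in> rist v" using g unfolding rist_def by (simp add: act_mult)
qed

lemma St_subgroup: "subgroup (St n) G"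
proof (rule subgroupI)
  show "St n \<subseteq> carrier G" unfolding level_stabilizer_def by blast
  show "St n \<noteq> {}" unfolding level_stabilizer_def using act_one by auto
  fix g assume g: "g \<in> St n"
  show "inv g \<in> St n" using g unfolding level_stabilizer_def by (simp add: act_inv_fixed)
  fix h assume "h \<in> St n"
  then show "g \<otimes> h \<in> St n" using g unfolding level_stabilizer_def by (simp add: act_mult)
qed

lemma rist_conj:
  assumes g: "g \<in> carrier G" and v: "v \<in> verts T" and h: "h \<in> rist v"
  shows "g \<otimes> h \<otimes> inv g \<in> rist (\<rho> g v)"
proof -
  have hc: "h \<in> carrier G" using h unfolding rist_def by blast
  have "\<rho> (g \<otimes> h \<otimes> inv g) w = w" if w: "w \<in> verts T" "w \<notin> subtree_verts T (\<rho> g v)" for w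
  proof -
    have "\<rho> (inv g) w \<notin> subtree_verts T v"
      using act_subtree[OF g, of "\<rho> (inv g) w" v] w g act_inv' by auto
    then have "\<rho> h (\<rho> (inv g) w) = \<rho> (inv g) w" using h g w act_closed unfolding rist_def by simp
    then show ?thesis using g hc w by (simp add: act_mult act_closed act_inv')
  qed
  then show ?thesis using g hc unfolding rist_def by simp
qed

lemma St_conj:
  assumes g: "g \<in> carrier G" and h: "h \<in> St n"
  shows "g \<otimes> h \<otimes> inv g \<in> St n"
proof -
  have hc: "h \<in> carrier G" using h unfolding level_stabilizer_def by blast
  have "\<rho> (g \<otimes> h \<otimes> inv g) w = w" if w: "w \<in> verts T" "level T w = n" for w
  proof -
    have "\<rho> h (\<rho> (inv g) w) = \<rho> (inv g) w"
      using h g w act_closed act_level unfolding level_stabilizer_def by simp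
    then show ?thesis using g hc w by (simp add: act_mult act_closed act_inv')
  qed
  then show ?thesis using g hc unfolding level_stabilizer_def by simp
qed

lemma rist_mono: "w \<in> subtree_verts T v \<Longrightarrow> rist w \<subseteq> rist v"
  unfolding rist_def using subtree_trans by blast

lemma rist_fixes_root_of_subtree:
  assumes v: "v \<in> verts T" and g: "g \<in> rist v"
  shows "\<rho> g v = v"
proof (rule ccontr)
  assume ne: "\<rho> g v \<noteq> v"
  have gc: "g \<in> carrier G" using g unfolding rist_def by blast
  have vv: "\<rho> g v \<in> verts T" using act_closed gc v by blast
  have "\<rho> g v \<notin> subtree_verts T v"
    using same_level_subtrees_disjoint[OF vv v act_level[OF gc v] self_in_subtree[OF vv]] ne by blast
  then have "\<rho> g (\<rho> g v) = \<rho> g v" using g vv unfolding rist_def by blast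
  then show False using act_inj[OF gc vv v] ne by blast
qed

lemma rist_le_St:
  assumes v: "v \<in> verts T" and l: "l \<le> level T v"
  shows "rist v \<subseteq> St l"
proof
  fix g assume g: "g \<in> rist v"
  then have gc: "g \<in> carrier G" unfolding rist_def by blast
  have "\<rho> g w = w" if w: "w \<in> verts T" "level T w = l" for w
  proof (cases "w \<in> subtree_verts T v")
    case True
    then have "w = v"
      using mem_subtree_iff[OF v w(1)] w l ancestor_level_self[of w] by auto
    then show ?thesis using rist_fixes_root_of_subtree[OF v g] by simp
  next
    case False then show ?thesis using g w unfolding rist_def by blast
  qed
  then show "g \<in> St l" using gc unfolding level_stabilizer_def by blast
qed

lemma rist_commute:
  assumes u: "u \<in> verts T" and w: "w \<in> verts T" and disj: "subtree_verts T u \<inter> subtree_verts T w = {}"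
    and a: "a \<in> rist u" and b: "b \<in> rist w"
  shows "a \<otimes> b = b \<otimes> a"
proof (rule act_eqI)
  have ac: "a \<in> carrier G" and bc: "b \<in> carrier G" using a b unfolding rist_def by blast+
  show "a \<otimes> b \<in> carrier G" "b \<otimes> a \<in> carrier G" using ac bc by auto
  fix v assume v: "v \<in> verts T"
  have fa: "\<And>x. x \<in> verts T \<Longrightarrow> x \<notin> subtree_verts T u \<Longrightarrow> \<rho> a x = x"
    and fb: "\<And>x. x \<in> verts T \<Longrightarrow> x \<notin> subtree_verts T w \<Longrightarrow> \<rho> b x = x"
    using a b unfolding rist_def by blast+
  have sa: "\<And>x. x \<in> subtree_verts T u \<Longrightarrow> \<rho> a x \<in> subtree_verts T u"
    using act_subtree[OF ac] rist_fixes_root_of_subtree[OF u a] by metis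
  have sb: "\<And>x. x \<in> subtree_verts T w \<Longrightarrow> \<rho> b x \<in> subtree_verts T w"
    using act_subtree[OF bc] rist_fixes_root_of_subtree[OF w b] by metis
  have "\<rho> a (\<rho> b v) = \<rho> b (\<rho> a v)"
  proof (cases "v \<in> subtree_verts T u")
    case True
    then have "\<rho> b v = v" "\<rho> b (\<rho> a v) = \<rho> a v"
      using fb v sa act_closed[OF ac] disj by blast+
    then show ?thesis by simp
  next
    case False
    have "\<rho> b v \<notin> subtree_verts T u"
      using False fb[OF v] sb[of v] disj by (cases "v \<in> subtree_verts T w") auto
    then show ?thesis using fa False v act_closed[OF bc] by auto
  qed
  then show "\<rho> (a \<otimes> b) v = \<rho> (b \<otimes> a) v" using ac bc v by (simp add: act_mult)
qed

text \<open>
  If \<open>h\<close> moves \<open>w\<close>, then \<open>h b\<^sup>-\<^sup>1 h\<^sup>-\<^sup>1\<close> is supported off the subtree of \<open>w\<close>; hence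
  \<open>b (h b\<^sup>-\<^sup>1 h\<^sup>-\<^sup>1)\<close>, which is built from conjugates of \<open>h\<close>, has the same commutator
  with \<open>c\<close> as \<open>b\<close>.
\<close>

lemma commutator_of_rist_mem:
  assumes N: "subgroup N G" and h: "h \<in> N" and w: "w \<in> verts T" and moved: "\<rho> h w \<noteq> w"
    and b: "b \<in> rist w" and c: "c \<in> rist w"
    and nb: "\<And>k. k \<in> N \<Longrightarrow> b \<otimes> k \<otimes> inv b \<in> N" and nc: "\<And>k. k \<in> N \<Longrightarrow> c \<otimes> k \<otimes> inv c \<in> N"
  shows "b \<otimes> c \<otimes> inv b \<otimes> inv c \<in> N"
proof -
  have hc: "h \<in> carrier G" using subgroup_memD[OF N h] .
  have bc: "b \<in> carrier G" and cc: "c \<in> carrier G" using b c unfolding rist_def by blast+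
  define d where "d = h \<otimes> inv b \<otimes> inv h"
  have d: "d \<in> rist (\<rho> h w)" unfolding d_def
    using rist_conj[OF hc w subgroup.m_inv_closed[OF rist_subgroup b]] .
  have dc: "d \<in> carrier G" unfolding d_def using hc bc by simp
  have "subtree_verts T (\<rho> h w) \<inter> subtree_verts T w = {}"
    using same_level_subtrees_disjoint[of "\<rho> h w" w] act_closed[OF hc w] w act_level[OF hc w] moved by blast
  then have comm: "d \<otimes> c = c \<otimes> d" using rist_commute[OF act_closed[OF hc w] w _ d c] by blast
  define a where "a = b \<otimes> d"
  have ac: "a \<in> carrier G" unfolding a_def using bc dc by simp
  have "a = (b \<otimes> h \<otimes> inv b) \<otimes> inv h" unfolding a_def d_def using bc hc by (simp add: m_assoc)
  then have aN: "a \<in> N" using nb[OF h] h subgroup.m_closed[OF N] subgroup.m_inv_closed[OF N] by simp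
  then have "a \<otimes> (c \<otimes> inv a \<otimes> inv c) \<in> N"
    using nc subgroup.m_closed[OF N] subgroup.m_inv_closed[OF N] by blast
  moreover have "a \<otimes> (c \<otimes> inv a \<otimes> inv c) = b \<otimes> c \<otimes> inv b \<otimes> inv c"
  proof -
    have "a \<otimes> (c \<otimes> inv a \<otimes> inv c) = b \<otimes> (d \<otimes> c) \<otimes> inv d \<otimes> inv b \<otimes> inv c"
      unfolding a_def using bc dc cc by (simp add: inv_mult_group m_assoc)
    also have "\<dots> = b \<otimes> c \<otimes> (d \<otimes> inv d) \<otimes> inv b \<otimes> inv c"
      unfolding comm using bc dc cc by (simp only: m_assoc inv_closed m_closed)
    also have "\<dots> = b \<otimes> c \<otimes> inv b \<otimes> inv c" using bc dc cc by simp
    finally show ?thesis .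
  qed
  ultimately show ?thesis by simp
qed

text \<open>
  \<open>g\<close> moves the support of \<open>a\<close> to the subtree of another vertex of the same level.
\<close>

lemma rist_noncommuting:
  assumes y: "y \<in> verts T" and g: "g \<in> carrier G" "\<rho> g y \<noteq> y" and a: "a \<in> rist y" "a \<noteq> \<one>"
  shows "g \<otimes> a \<otimes> inv g \<otimes> inv a \<noteq> \<one>"
proof
  assume e: "g \<otimes> a \<otimes> inv g \<otimes> inv a = \<one>"
  have ac: "a \<in> carrier G" using a unfolding rist_def by blast
  have ga: "g \<otimes> a = a \<otimes> g"
    using e g ac by (metis inv_closed inv_equality inv_inv inv_solve_right m_closed)
  obtain u where u: "u \<in> verts T" "\<rho> a u \<noteq> u" using act_faithful[OF ac] a by blast
  then have uy: "u \<in> subtree_verts T y" using a unfolding rist_def by blast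
  have "\<rho> g u \<notin> subtree_verts T y"
    using act_subtree[OF g(1) uy] same_level_subtrees_disjoint[OF act_closed[OF g(1) y] y act_level[OF g(1) y]] g
    by blast
  then have "\<rho> a (\<rho> g u) = \<rho> g u" using a act_closed[OF g(1) u(1)] unfolding rist_def by blast
  moreover have "\<rho> g (\<rho> a u) = \<rho> a (\<rho> g u)" using ga g ac u by (metis act_mult)
  ultimately show False using act_inj[OF g(1) act_closed[OF ac u(1)] u(1)] u by simp
qed

end


section \<open>Rigidity: every automorphism is induced by an isometry\<close>

text \<open>
  Saturation through a choice of the subgroups \<open>H n\<close>. That they are characteristic is kept apart,
  because it does not speak of the action.
\<close>

locale saturated_action = tree_action +
  fixes H :: "nat \<Rightarrow> 'b set"
  assumes rist_nontrivial: "v \<in> verts T \<Longrightarrow> \<exists>g\<in>rist v. g \<noteq> \<one>"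
    and H_subgroup: "subgroup (H n) G"
    and H_conj: "g \<in> carrier G \<Longrightarrow> h \<in> H n \<Longrightarrow> g \<otimes> h \<otimes> inv g \<in> H n"
    and H_le_St: "H n \<subseteq> St n"
    and H_transitive: "v \<in> verts T \<Longrightarrow> level T v = n \<Longrightarrow> level_transitive_on_subtree T \<rho> (H n) v"
begin

lemma rist_moves:
  assumes v: "v \<in> verts T" and g: "g \<in> rist v" "g \<noteq> \<one>"
  shows "\<exists>w\<in>subtree_verts T v. \<rho> g w \<noteq> w"
proof -
  have "g \<in> carrier G" using g unfolding rist_def by blast
  then obtain w where "w \<in> verts T" "\<rho> g w \<noteq> w" using act_faithful g(2) by blast
  then show ?thesis using g(1) unfolding rist_def by blast
qed

lemma has_child:
  assumes v: "v \<in> verts T" shows "\<exists>w. w \<in> children T v"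
proof -
  obtain g where g: "g \<in> rist v" "g \<noteq> \<one>" using rist_nontrivial[OF v] by blast
  then obtain w where w: "w \<in> subtree_verts T v" "\<rho> g w \<noteq> w" using rist_moves[OF v] by blast
  then have "w \<noteq> v" using rist_fixes_root_of_subtree[OF v g(1)] by auto
  then show ?thesis using subtree_child_of_neq(1)[OF v w(1)] by blast
qed

lemma has_descendant:
  assumes v: "v \<in> verts T" and n: "level T v \<le> n"
  shows "\<exists>w\<in>subtree_verts T v. level T w = n"
  using n
proof (induction n rule: dec_induct)
  case base then show ?case using self_in_subtree[OF v] by blast
next
  case (step n)
  then obtain w where w: "w \<in> subtree_verts T v" "level T w = n" by blast
  then obtain u where u: "u \<in> children T w" using has_child subtree_in_verts by blast
  then have "level T u = Suc n" using children_iff w by simp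
  then show ?case using subtree_trans[OF w(1) child_in_subtree[OF u]] by blast
qed

lemma St_antimono: assumes "l \<le> n" shows "St n \<subseteq> St l"
proof
  fix g assume g: "g \<in> St n"
  then have gc: "g \<in> carrier G" unfolding level_stabilizer_def by blast
  have "\<rho> g v = v" if v: "v \<in> verts T" "level T v = l" for v
  proof -
    obtain w where w: "w \<in> subtree_verts T v" "level T w = n" using has_descendant[OF v(1)] v assms by blast
    have wv: "w \<in> verts T" using w subtree_in_verts by blast
    have "v = ancestor T l w" using mem_subtree_iff[OF v(1) wv] w v by simp
    moreover have "\<rho> g w = w" using g w wv unfolding level_stabilizer_def by blast
    ultimately show ?thesis using act_ancestor[OF gc wv] by simp
  qed
  then show "g \<in> St l" using gc unfolding level_stabilizer_def by blast
qed

lemma H_carrier: "h \<in> H n \<Longrightarrow> h \<in> carrier G"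
  using H_subgroup subgroup_memD by blast

lemma St_fixes: "g \<in> St n \<Longrightarrow> v \<in> verts T \<Longrightarrow> level T v \<le> n \<Longrightarrow> \<rho> g v = v"
  using St_antimono[of "level T v" n] unfolding level_stabilizer_def by blast

text \<open>
  The subtree of \<open>v\<close> has at least two vertices on every deep level, and \<open>H n\<close> permutes them
  transitively.
\<close>

lemma H_moves_deep_vertices:
  assumes v: "v \<in> verts T" "level T v = n"
  shows "\<exists>L. \<forall>y\<in>subtree_verts T v. level T y \<ge> L \<longrightarrow> (\<exists>h\<in>H n. \<rho> h y \<noteq> y)"
proof -
  obtain g where g: "g \<in> rist v" "g \<noteq> \<one>" using rist_nontrivial[OF v(1)] by blast
  then have gc: "g \<in> carrier G" unfolding rist_def by blast
  obtain w where w: "w \<in> subtree_verts T v" "\<rho> g w \<noteq> w" using rist_moves[OF v(1) g] by blast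
  have wv: "w \<in> verts T" using w subtree_in_verts by blast
  have w': "\<rho> g w \<in> subtree_verts T v" "\<rho> g w \<in> verts T"
    using act_subtree[OF gc w(1)] rist_fixes_root_of_subtree[OF v(1) g(1)] act_closed[OF gc wv] by auto
  have "\<exists>h\<in>H n. \<rho> h y \<noteq> y" if y: "y \<in> subtree_verts T v" "level T y \<ge> level T w" for y
  proof -
    obtain u where u: "u \<in> subtree_verts T w" "level T u = level T y"
      using has_descendant[OF wv] y by blast
    obtain u' where u': "u' \<in> subtree_verts T (\<rho> g w)" "level T u' = level T y"
      using has_descendant[OF w'(2)] y act_level[OF gc wv] by auto
    have "u \<noteq> u'"
      using same_level_subtrees_disjoint[OF w'(2) wv act_level[OF gc wv]] u u' w(2) by blast
    moreover have "u \<in> subtree_verts T v" "u' \<in> subtree_verts T v"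
      using subtree_trans w(1) w'(1) u u' by blast+
    ultimately obtain u'' where "u'' \<in> subtree_verts T v" "level T y = level T u''" "u'' \<noteq> y"
      using u u' by metis
    then obtain h where "h \<in> H n" "\<rho> h y = u''"
      using H_transitive[OF v] y(1) unfolding level_transitive_on_subtree_def by blast
    then show ?thesis using \<open>u'' \<noteq> y\<close> by blast
  qed
  then show ?thesis by blast
qed

lemma rist_has_commutator:
  assumes v: "v \<in> verts T"
  shows "\<exists>b\<in>rist v. \<exists>c\<in>rist v. b \<otimes> c \<otimes> inv b \<otimes> inv c \<noteq> \<one>"
proof -
  obtain g where g: "g \<in> rist v" "g \<noteq> \<one>" using rist_nontrivial[OF v] by blast
  then have gc: "g \<in> carrier G" unfolding rist_def by blast
  obtain y where y: "y \<in> subtree_verts T v" "\<rho> g y \<noteq> y" using rist_moves[OF v g] by blast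
  have yv: "y \<in> verts T" using y subtree_in_verts by blast
  obtain a where a: "a \<in> rist y" "a \<noteq> \<one>" using rist_nontrivial[OF yv] by blast
  then show ?thesis using rist_noncommuting[OF yv gc y(2) a] rist_mono[OF y(1)] g by blast
qed

text \<open>Below \<open>v\<close> all of the finitely many subgroups \<open>H m\<close> with \<open>m\<close> in \<open>M\<close> move deep vertices, so they
  share the commutators of a deep rigid stabiliser.\<close>

lemma rist_Int_H_nontrivial:
  assumes v: "v \<in> verts T" and M: "finite M" "\<And>m. m \<in> M \<Longrightarrow> m \<le> level T v"
  shows "\<exists>a\<in>rist v. a \<noteq> \<one> \<and> (\<forall>m\<in>M. a \<in> H m)"
proof -
  have "\<exists>L. \<forall>y\<in>subtree_verts T v. level T y \<ge> L \<longrightarrow> (\<exists>h\<in>H m. \<rho> h y \<noteq> y)" if m: "m \<in> M" for m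
  proof -
    let ?u = "ancestor T m v"
    have u: "?u \<in> verts T" "level T ?u = m" "v \<in> subtree_verts T ?u"
      using ancestor_in_verts[OF v] level_ancestor[OF v] in_subtree_ancestor[OF v] M(2)[OF m] by auto
    show ?thesis using H_moves_deep_vertices[OF u(1,2)] subtree_trans[OF u(3)] by blast
  qed
  then obtain L where L: "\<And>m y. m \<in> M \<Longrightarrow> y \<in> subtree_verts T v \<Longrightarrow> level T y \<ge> L m \<Longrightarrow> (\<exists>h\<in>H m. \<rho> h y \<noteq> y)"
    by metis
  let ?L = "\<Sum>m\<in>M. L m"
  obtain y where y: "y \<in> subtree_verts T v" "level T y = level T v + ?L"
    using has_descendant[OF v, of "level T v + ?L"] by auto
  have yv: "y \<in> verts T" using y subtree_in_verts by blast
  obtain b c where bc: "b \<in> rist y" "c \<in> rist y" "b \<otimes> c \<otimes> inv b \<otimes> inv c \<noteq> \<one>"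
    using rist_has_commutator[OF yv] by blast
  have cc: "b \<in> carrier G" "c \<in> carrier G" using bc unfolding rist_def by blast+
  have "b \<otimes> c \<otimes> inv b \<otimes> inv c \<in> H m" if m: "m \<in> M" for m
  proof -
    have "L m \<le> ?L" using m M(1) by (simp add: member_le_sum)
    then have "L m \<le> level T y" using y(2) by simp
    then obtain h where h: "h \<in> H m" "\<rho> h y \<noteq> y" using L[OF m y(1)] by blast
    show ?thesis using commutator_of_rist_mem[OF H_subgroup h(1) yv h(2) bc(1,2)] H_conj cc by blast
  qed
  moreover have "b \<otimes> c \<otimes> inv b \<otimes> inv c \<in> rist v"
    by (intro subgroup.m_closed[OF rist_subgroup] subgroup.m_inv_closed[OF rist_subgroup])
      (use bc rist_mono[OF y(1)] in auto)
  ultimately show ?thesis using bc(3) by blast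
qed

lemma rist_Int_H_has_commutator:
  assumes v: "v \<in> verts T" and n: "n \<le> level T v"
  shows "\<exists>b\<in>rist v \<inter> H n. \<exists>c\<in>rist v \<inter> H n. b \<otimes> c \<otimes> inv b \<otimes> inv c \<noteq> \<one>"
proof -
  obtain g where g: "g \<in> rist v" "g \<noteq> \<one>" "g \<in> H n"
    using rist_Int_H_nontrivial[OF v, of "{n}"] n by auto
  then have gc: "g \<in> carrier G" unfolding rist_def by blast
  obtain y where y: "y \<in> subtree_verts T v" "\<rho> g y \<noteq> y" using rist_moves[OF v g(1,2)] by blast
  have yv: "y \<in> verts T" using y subtree_in_verts by blast
  obtain a where a: "a \<in> rist y" "a \<noteq> \<one>" "a \<in> H n"
    using rist_Int_H_nontrivial[OF yv, of "{n}"] n level_le_of_subtree[OF v y(1)] by auto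
  then show ?thesis using rist_noncommuting[OF yv gc y(2) a(1,2)] rist_mono[OF y(1)] g by blast
qed

end

text \<open>
  Two actions of the same group: the given one, and its twist by an automorphism. The rigid
  stabilisers are algebraic enough to be compared: for \<open>v\<close> on level \<open>n\<close>, the subgroup
  \<open>rist v \<inter> H n\<close> is normal in \<open>H n\<close>, so in the second action it either acts trivially below a
  vertex of level \<open>n\<close> or contains many commutators there. The latter cannot happen below one vertex
  for two distinct \<open>v\<close>, because the two subgroups would share a nontrivial element.
\<close>

locale two_saturated_actions = saturated_action T G \<rho> H + second: saturated_action T G \<sigma> H
  for T :: "'v tree" and G :: "('b, 'c) monoid_scheme" (structure) and \<rho> \<sigma> H
begin

definition active_at :: "'v \<Rightarrow> 'v \<Rightarrow> bool" where
  "active_at v w \<longleftrightarrow> (\<exists>a\<in>rist v \<inter> H (level T v). \<exists>u\<in>subtree_verts T w. \<sigma> a u \<noteq> u)"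

lemma active_somewhere:
  assumes v: "v \<in> verts T" shows "\<exists>w\<in>verts T. level T w = level T v \<and> active_at v w"
proof -
  obtain a where a: "a \<in> rist v" "a \<noteq> \<one>" "a \<in> H (level T v)"
    using rist_Int_H_nontrivial[OF v, of "{level T v}"] by auto
  then have ac: "a \<in> carrier G" unfolding rist_def by blast
  obtain u where u: "u \<in> verts T" "\<sigma> a u \<noteq> u" using second.act_faithful[OF ac] a(2) by blast
  have "level T v \<le> level T u"
    using second.St_fixes[of a "level T v" u] second.H_le_St a(3) u by (meson nle_le subsetD)
  then show ?thesis unfolding active_at_def
    using in_subtree_ancestor[OF u(1)] ancestor_in_verts[OF u(1)] level_ancestor[OF u(1)] a u by blast
qed

text \<open>
  In the second action \<open>H n\<close> is transitive on the levels below \<open>w\<close>, and it normalises \<open>rist v \<inter> H n\<close>.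
\<close>

lemma active_at_moves_deep_vertices:
  assumes v: "v \<in> verts T" and w: "w \<in> verts T" "level T w = level T v" and act: "active_at v w"
  shows "\<exists>L. \<forall>y\<in>subtree_verts T w. level T y \<ge> L \<longrightarrow> (\<exists>a\<in>rist v \<inter> H (level T v). \<sigma> a y \<noteq> y)"
proof -
  let ?n = "level T v"
  obtain a u where a: "a \<in> rist v" "a \<in> H ?n" and u: "u \<in> subtree_verts T w" "\<sigma> a u \<noteq> u"
    using act unfolding active_at_def by blast
  have ac: "a \<in> carrier G" using a H_carrier by blast
  have uv: "u \<in> verts T" using u subtree_in_verts by blast
  have "\<exists>a\<in>rist v \<inter> H ?n. \<sigma> a y \<noteq> y" if y: "y \<in> subtree_verts T w" "level T y \<ge> level T u" for y
  proof -
    have yv: "y \<in> verts T" using y subtree_in_verts by blast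
    let ?x = "ancestor T (level T u) y"
    have x: "?x \<in> verts T" "level T ?x = level T u"
      using ancestor_in_verts[OF yv] level_ancestor[OF yv] y by auto
    have "?x \<in> subtree_verts T w"
      using subtrees_meet_nested[OF w(1) x(1) _ y(1)] in_subtree_ancestor[OF yv y(2)] x(2)
        level_le_of_subtree[OF w(1) u(1)] by simp
    then obtain h where h: "h \<in> H ?n" "\<sigma> h u = ?x"
      using second.H_transitive[OF w] u(1) x(2) unfolding level_transitive_on_subtree_def by metis
    have hc: "h \<in> carrier G" using h H_carrier by blast
    let ?b = "h \<otimes> a \<otimes> inv h"
    have "?b \<in> rist (\<rho> h v)" using rist_conj[OF hc v a(1)] .
    moreover have "\<rho> h v = v" using St_fixes[of h ?n v] h H_le_St v by blast
    moreover have "?b \<in> H ?n" using H_conj[OF hc a(2)] .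
    moreover have "\<sigma> ?b ?x = \<sigma> h (\<sigma> a u)"
      using hc ac uv h second.act_inv[OF hc uv] by (simp add: second.act_mult second.act_closed flip: h(2))
    then have "\<sigma> ?b ?x \<noteq> ?x"
      using u(2) second.act_inj[OF hc _ uv] second.act_closed[OF ac uv] h(2) by metis
    then have "\<sigma> ?b y \<noteq> y"
      using second.act_ancestor[of ?b y "level T u"] hc ac yv by auto
    ultimately show ?thesis by auto
  qed
  then show ?thesis by blast
qed

text \<open>
  Otherwise \<open>rist v \<inter> H n\<close> and \<open>rist v' \<inter> H n\<close> would share the commutators of a deep rigid stabiliser
  of the second action, although they meet trivially.
\<close>

lemma active_at_unique:
  assumes v: "v \<in> verts T" and v': "v' \<in> verts T" "level T v' = level T v"
    and w: "w \<in> verts T" "level T w = level T v" and act: "active_at v w" "active_at v' w"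
  shows "v = v'"
proof (rule ccontr)
  assume ne: "v \<noteq> v'"
  let ?n = "level T v"
  obtain L where L: "\<And>y. y \<in> subtree_verts T w \<Longrightarrow> level T y \<ge> L \<Longrightarrow> \<exists>a\<in>rist v \<inter> H ?n. \<sigma> a y \<noteq> y"
    using active_at_moves_deep_vertices[OF v w act(1)] by blast
  obtain L' where L': "\<And>y. y \<in> subtree_verts T w \<Longrightarrow> level T y \<ge> L' \<Longrightarrow> \<exists>a\<in>rist v' \<inter> H ?n. \<sigma> a y \<noteq> y"
    using active_at_moves_deep_vertices[OF v'(1) w(1) _ act(2)] w v'(2) by auto
  obtain y where y: "y \<in> subtree_verts T w" "level T y = ?n + L + L'"
    using has_descendant[OF w(1), of "?n + L + L'"] w by auto
  have yv: "y \<in> verts T" using y subtree_in_verts by blast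
  obtain b c where bc: "b \<in> second.rist y \<inter> H ?n" "c \<in> second.rist y \<inter> H ?n"
      "b \<otimes> c \<otimes> inv b \<otimes> inv c \<noteq> \<one>"
    using second.rist_Int_H_has_commutator[OF yv, of ?n] y(2) by auto
  have *: "b \<otimes> c \<otimes> inv b \<otimes> inv c \<in> rist x"
    if x: "x \<in> verts T" "level T x = ?n" and ex: "\<exists>a\<in>rist x \<inter> H ?n. \<sigma> a y \<noteq> y" for x
  proof -
    obtain a where a: "a \<in> rist x \<inter> H ?n" "\<sigma> a y \<noteq> y" using ex by blast
    have conj: "d \<otimes> k \<otimes> inv d \<in> rist x \<inter> H ?n" if d: "d \<in> H ?n" and k: "k \<in> rist x \<inter> H ?n" for d k
    proof -
      have dc: "d \<in> carrier G" using d H_carrier by blast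
      have "\<rho> d x = x" using St_fixes[of d ?n x] d H_le_St x by auto
      then show ?thesis using rist_conj[OF dc x(1), of k] H_conj[OF dc, of k] k by auto
    qed
    have "b \<otimes> c \<otimes> inv b \<otimes> inv c \<in> rist x \<inter> H ?n"
      using second.commutator_of_rist_mem[OF subgroups_Inter_pair[OF rist_subgroup H_subgroup] a(1) yv a(2)]
        bc conj by blast
    then show ?thesis by blast
  qed
  have "b \<otimes> c \<otimes> inv b \<otimes> inv c \<in> rist v" "b \<otimes> c \<otimes> inv b \<otimes> inv c \<in> rist v'"
    using *[OF v refl] *[OF v'] L[OF y(1)] L'[OF y(1)] y(2) by auto
  moreover have "rist v \<inter> rist v' = {\<one>}"
  proof -
    have "a = \<one>" if a: "a \<in> rist v" "a \<in> rist v'" for a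
    proof (rule ccontr)
      assume "a \<noteq> \<one>"
      then obtain u where u: "u \<in> subtree_verts T v" "\<rho> a u \<noteq> u" using rist_moves[OF v a(1)] by blast
      then have "u \<in> subtree_verts T v'" using a(2) subtree_in_verts unfolding rist_def by blast
      then show False using same_level_subtrees_disjoint[OF v v'(1) _ u(1)] v'(2) ne by simp
    qed
    then show ?thesis using subgroup.one_closed[OF rist_subgroup] by blast
  qed
  ultimately show False using bc(3) by blast
qed

text \<open>
  On a finite level, a choice of vertices where the subgroups \<open>rist u \<inter> H n\<close> are active is injective,
  hence bijective; so \<open>rist v \<inter> H n\<close> is active below one vertex only.
\<close>

lemma matching_exists:
  assumes v: "v \<in> verts T"
  shows "\<exists>w\<in>verts T. level T w = level T v \<and> rist v \<inter> H (level T v) \<subseteq> second.rist w"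
proof -
  let ?n = "level T v"
  let ?L = "{u \<in> verts T. level T u = ?n}"
  obtain f where f: "\<And>u. u \<in> ?L \<Longrightarrow> f u \<in> ?L \<and> active_at u (f u)"
    using active_somewhere by (metis (mono_tags, lifting) mem_Collect_eq)
  have "inj_on f ?L"
  proof (rule inj_onI)
    fix u u' assume u: "u \<in> ?L" "u' \<in> ?L" "f u = f u'"
    show "u = u'"
      using active_at_unique[of u u' "f u"] f[OF u(1)] f[OF u(2)] u by auto
  qed
  then have surj: "f ` ?L = ?L"
    using f finite_level[of ?n] by (intro endo_inj_surj) auto
  have only: "w = f v" if w: "w \<in> ?L" "active_at v w" for w
  proof -
    obtain u where u: "u \<in> ?L" "w = f u" using surj w(1) by blast
    have "active_at u w" using f[OF u(1)] u(2) by simp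
    then have "v = u" using active_at_unique[OF v _ _ _ _ w(2)] u(1) w(1) by blast
    then show ?thesis using u(2) by simp
  qed
  have fv: "f v \<in> verts T" "level T (f v) = ?n" using f[of v] v by auto
  have "a \<in> second.rist (f v)" if a: "a \<in> rist v \<inter> H ?n" for a
  proof -
    have "\<sigma> a u = u" if u: "u \<in> verts T" "u \<notin> subtree_verts T (f v)" for u
    proof (cases "level T u \<le> ?n")
      case True
      then show ?thesis using second.St_fixes[of a ?n u] second.H_le_St a u(1) by blast
    next
      case False
      show ?thesis
      proof (rule ccontr)
        assume "\<sigma> a u \<noteq> u"
        then have "active_at v (ancestor T ?n u)"
          unfolding active_at_def using a in_subtree_ancestor[OF u(1), of ?n] False by auto
        then have "ancestor T ?n u = f v"
          using only ancestor_in_verts[OF u(1)] level_ancestor[OF u(1), of ?n] False by auto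
        then show False using in_subtree_ancestor[OF u(1), of ?n] u(2) False by auto
      qed
    qed
    then show ?thesis using a H_carrier unfolding second.rist_def by blast
  qed
  then show ?thesis using fv by blast
qed

text \<open>
  A common nontrivial element of \<open>rist v \<inter> H (level v)\<close> and \<open>H (level u)\<close> moves a vertex below both
  \<open>w\<close> and \<open>x\<close> in the second action.
\<close>

lemma matching_nested:
  assumes v: "v \<in> verts T" and u: "u \<in> verts T" and vu: "v \<in> subtree_verts T u"
    and w: "w \<in> verts T" "level T w = level T v" "rist v \<inter> H (level T v) \<subseteq> second.rist w"
    and x: "x \<in> verts T" "level T x = level T u" "rist u \<inter> H (level T u) \<subseteq> second.rist x"
  shows "w \<in> subtree_verts T x"
proof -
  have le: "level T u \<le> level T v" using level_le_of_subtree[OF u vu] .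
  obtain a where a: "a \<in> rist v" "a \<noteq> \<one>" "a \<in> H (level T u)" "a \<in> H (level T v)"
    using rist_Int_H_nontrivial[OF v, of "{level T u, level T v}"] le by auto
  have aw: "a \<in> second.rist w" using a w by blast
  have ax: "a \<in> second.rist x" using a x rist_mono[OF vu] by blast
  obtain y where y: "y \<in> subtree_verts T w" "\<sigma> a y \<noteq> y" using second.rist_moves[OF w(1) aw a(2)] by blast
  then have "y \<in> subtree_verts T x" using ax subtree_in_verts unfolding second.rist_def by blast
  then show ?thesis using subtrees_meet_nested[OF x(1) w(1)] x(2) w(2) le y(1) by simp
qed

definition matching :: "'v \<Rightarrow> 'v" where
  "matching = (\<lambda>v\<in>verts T. SOME w. w \<in> verts T \<and> level T w = level T v \<and>
     rist v \<inter> H (level T v) \<subseteq> second.rist w)"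

lemma matching:
  assumes "v \<in> verts T"
  shows "matching v \<in> verts T" "level T (matching v) = level T v"
    "rist v \<inter> H (level T v) \<subseteq> second.rist (matching v)"
  using someI_ex[of "\<lambda>w. w \<in> verts T \<and> level T w = level T v \<and>
     rist v \<inter> H (level T v) \<subseteq> second.rist w"] matching_exists[OF assms] assms
  unfolding matching_def by auto

lemma matching_eqI:
  assumes v: "v \<in> verts T"
    and w: "w \<in> verts T" "level T w = level T v" "rist v \<inter> H (level T v) \<subseteq> second.rist w"
  shows "matching v = w"
  using matching_nested[OF v v self_in_subtree[OF v] w matching[OF v]] mem_subtree_iff[OF matching(1)[OF v] w(1)]
    w(2) matching(2)[OF v] ancestor_level_self[of w] by simp

lemma matching_parent:
  assumes v: "v \<in> verts T" shows "matching (parent T v) = parent T (matching v)"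
proof (cases "v = root T")
  case True
  then have "matching v = root T" using matching[OF v] level_root level_eq_0_iff by simp
  then show ?thesis using True parent_root by simp
next
  case False
  have p: "parent T v \<in> verts T" using parent_in_verts[OF v] .
  have vp: "v \<in> subtree_verts T (parent T v)"
    using v False child_in_subtree unfolding children_def by blast
  have l: "level T v = Suc (level T (parent T v))" using level_parent_Suc[OF v False] .
  have "matching v \<in> subtree_verts T (matching (parent T v))"
    using matching_nested[OF v p vp matching[OF v] matching[OF p]] .
  then have "matching (parent T v) = ancestor T (level T (parent T v)) (matching v)"
    using mem_subtree_iff[OF matching(1)[OF p] matching(1)[OF v]] matching(2)[OF p] by simp
  also have "\<dots> = parent T (ancestor T (level T v) (matching v))"
    using ancestor_Suc[OF matching(1)[OF v]] matching(2)[OF v] l by simp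
  also have "\<dots> = parent T (matching v)" using ancestor_level_self[of "matching v"] matching(2)[OF v] by simp
  finally show ?thesis .
qed

lemma matching_equivariant:
  assumes g: "g \<in> carrier G" and v: "v \<in> verts T"
  shows "matching (\<rho> g v) = \<sigma> g (matching v)"
proof (rule matching_eqI)
  show "\<rho> g v \<in> verts T" using act_closed[OF g v] .
  show "\<sigma> g (matching v) \<in> verts T" using second.act_closed[OF g matching(1)[OF v]] .
  show "level T (\<sigma> g (matching v)) = level T (\<rho> g v)"
    using second.act_level[OF g matching(1)[OF v]] matching(2)[OF v] act_level[OF g v] by simp
  show "rist (\<rho> g v) \<inter> H (level T (\<rho> g v)) \<subseteq> second.rist (\<sigma> g (matching v))"
  proof
    fix a assume a: "a \<in> rist (\<rho> g v) \<inter> H (level T (\<rho> g v))"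
    then have ac: "a \<in> carrier G" using H_carrier by blast
    let ?b = "inv g \<otimes> a \<otimes> g"
    have "?b \<in> rist v"
      using rist_conj[of "inv g" "\<rho> g v" a] act_inv[OF g v] act_closed[OF g v] a g by simp
    moreover have "?b \<in> H (level T v)" using H_conj[of "inv g" a] a act_level[OF g v] g by simp
    ultimately have "?b \<in> second.rist (matching v)" using matching(3)[OF v] by blast
    then have "g \<otimes> ?b \<otimes> inv g \<in> second.rist (\<sigma> g (matching v))"
      using second.rist_conj[OF g matching(1)[OF v]] by blast
    moreover have "g \<otimes> ?b \<otimes> inv g = a"
    proof -
      have "g \<otimes> ?b \<otimes> inv g = (g \<otimes> inv g) \<otimes> a \<otimes> (g \<otimes> inv g)"
        using g ac by (simp only: m_assoc inv_closed m_closed)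
      then show ?thesis using g ac by simp
    qed
    ultimately show "a \<in> second.rist (\<sigma> g (matching v))" by simp
  qed
qed

lemma matching_inj:
  assumes v: "v \<in> verts T" and u: "u \<in> verts T" and e: "matching v = matching u"
  shows "v = u"
proof -
  have l: "level T u = level T v" using matching(2)[OF v] matching(2)[OF u] e by simp
  have "active_at x (matching x)" if x: "x \<in> verts T" for x
  proof -
    obtain a where a: "a \<in> rist x" "a \<noteq> \<one>" "a \<in> H (level T x)"
      using rist_Int_H_nontrivial[OF x, of "{level T x}"] by auto
    then show ?thesis unfolding active_at_def
      using second.rist_moves[OF matching(1)[OF x] _ a(2)] matching(3)[OF x] by blast
  qed
  from this[OF v] this[OF u] show ?thesis
    using active_at_unique[OF v u l matching(1,2)[OF v]] e by simp
qed

lemma matching_in_Iso: "matching \<in> Iso T"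
proof -
  have "matching ` verts T = verts T"
  proof
    show "matching ` verts T \<subseteq> verts T" using matching(1) by blast
    show "verts T \<subseteq> matching ` verts T"
    proof
      fix w assume w: "w \<in> verts T"
      let ?L = "{u \<in> verts T. level T u = level T w}"
      have "matching ` ?L = ?L"
        using matching matching_inj finite_level[of "level T w"] by (intro endo_inj_surj) (auto intro!: inj_onI)
      then show "w \<in> matching ` verts T" using w by blast
    qed
  qed
  then have "bij_betw matching (verts T) (verts T)"
    using matching_inj unfolding bij_betw_def inj_on_def by blast
  then have "matching \<in> Bij (verts T)" unfolding Bij_def matching_def by simp
  moreover have "matching (root T) = root T"
    using matching[OF root_in_verts] level_root level_eq_0_iff by simp
  ultimately show ?thesis unfolding Iso_def using matching_parent by blast
qed

end


lemma tree_action_if_faithful: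
  assumes "spherically_symmetric_tree T" and "faithful_tree_action T G \<rho>"
  shows "tree_action T G \<rho>"
proof -
  interpret spherically_symmetric_tree T by fact
  interpret A: faithful_tree_action T G \<rho> by fact
  interpret G: group G using A.group_hom by (simp add: group_hom_def)
  show ?thesis
  proof
    fix g x assume "g \<in> carrier G" "x \<in> verts T"
    then show "\<rho> g x \<in> verts T" using A.element_image by blast
  next
    fix x assume "x \<in> verts T"
    then show "\<rho> \<one>\<^bsub>G\<^esub> x = x" using A.id_eq_one by (metis restrict_apply')
  next
    fix g h x assume "g \<in> carrier G" "h \<in> carrier G" "x \<in> verts T"
    then show "\<rho> (g \<otimes>\<^bsub>G\<^esub> h) x = \<rho> g (\<rho> h x)" using A.composition_rule by blast
  next
    fix g v assume "g \<in> carrier G" "v \<in> verts T"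
    then show "\<rho> g (parent T v) = parent T (\<rho> g v)" using A.acts_by_isos Iso_parent by blast
  next
    fix g v assume "g \<in> carrier G" "v \<in> verts T"
    then show "level T (\<rho> g v) = level T v" using A.acts_by_isos Iso_level by blast
  next
    fix g assume g: "g \<in> carrier G" and fixed: "\<And>v. v \<in> verts T \<Longrightarrow> \<rho> g v = v"
    have "\<rho> g = (\<lambda>v\<in>verts T. v)"
      using A.bij_prop0[OF g] fixed by (intro extensionalityI[of _ "verts T"]) (auto simp: Bij_def)
    then have "\<rho> g = \<rho> \<one>\<^bsub>G\<^esub>" using A.id_eq_one by simp
    then show "g = \<one>\<^bsub>G\<^esub>" using A.faithful g G.one_closed by (metis inj_onD)
  qed
qed

lemma (in group) conj_in_iso:
  assumes g: "g \<in> carrier G"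
  shows "(\<lambda>h. g \<otimes> h \<otimes> inv g) \<in> iso G G"
proof -
  have "(\<lambda>h. g \<otimes> h \<otimes> inv g) \<in> hom G G"
    using g conj_mult by (auto simp: hom_def)
  moreover have "bij_betw (\<lambda>h. g \<otimes> h \<otimes> inv g) (carrier G) (carrier G)"
  proof (rule bij_betw_byWitness[of _ "\<lambda>h. inv g \<otimes> h \<otimes> g"])
    have "inv g \<otimes> (g \<otimes> a \<otimes> inv g) \<otimes> g = a" if "a \<in> carrier G" for a
    proof -
      have "inv g \<otimes> (g \<otimes> a \<otimes> inv g) \<otimes> g = (inv g \<otimes> g) \<otimes> a \<otimes> (inv g \<otimes> g)"
        using g that by (simp only: m_assoc inv_closed m_closed)
      then show ?thesis using g that by simp
    qed
    then show "\<forall>a\<in>carrier G. inv g \<otimes> (g \<otimes> a \<otimes> inv g) \<otimes> g = a" by blast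
    have "g \<otimes> (inv g \<otimes> a \<otimes> g) \<otimes> inv g = a" if "a \<in> carrier G" for a
    proof -
      have "g \<otimes> (inv g \<otimes> a \<otimes> g) \<otimes> inv g = (g \<otimes> inv g) \<otimes> a \<otimes> (g \<otimes> inv g)"
        using g that by (simp only: m_assoc inv_closed m_closed)
      then show ?thesis using g that by simp
    qed
    then show "\<forall>a\<in>carrier G. g \<otimes> (inv g \<otimes> a \<otimes> g) \<otimes> inv g = a" by blast
  qed (use g in auto)
  ultimately show ?thesis by (simp add: iso_def)
qed

lemma saturated_action_exists:
  assumes sym: "spherically_symmetric_tree T" and wb: "weakly_branch T G \<rho>" and sat: "saturated T G \<rho>"
  shows "\<exists>H. saturated_action T G \<rho> H \<and> (\<forall>n. characteristic_subgroup (H n) G)"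
proof -
  interpret tree_action T G \<rho>
    using tree_action_if_faithful[OF sym] wb unfolding weakly_branch_def by blast
  obtain H where H: "\<And>n. characteristic_subgroup (H n) G" "\<And>n. H n \<subseteq> level_stabilizer T G \<rho> n"
      "\<And>n v. v \<in> verts T \<Longrightarrow> level T v = n \<Longrightarrow> level_transitive_on_subtree T \<rho> (H n) v"
    using sat unfolding saturated_def by metis
  have "saturated_action T G \<rho> H"
  proof (intro saturated_action.intro saturated_action_axioms.intro tree_action_axioms)
    fix v assume v: "v \<in> verts T"
    then obtain g where g: "g \<in> carrier G" "\<exists>w\<in>subtree_verts T v. \<rho> g w \<noteq> w"
        "\<forall>w\<in>verts T - subtree_verts T v. \<rho> g w = w"
      using wb unfolding weakly_branch_def by blast
    then have "g \<in> rist v" "g \<noteq> \<one>\<^bsub>G\<^esub>" using act_one subtree_in_verts unfolding rist_def by blast+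
    then show "\<exists>g\<in>rist v. g \<noteq> \<one>\<^bsub>G\<^esub>" by blast
  next
    fix n show "subgroup (H n) G" using H(1) unfolding characteristic_subgroup_def by auto
  next
    fix g h n assume "g \<in> carrier G" "h \<in> H n"
    then show "g \<otimes>\<^bsub>G\<^esub> h \<otimes>\<^bsub>G\<^esub> inv\<^bsub>G\<^esub> g \<in> H n"
      using H(1)[of n] conj_in_iso unfolding characteristic_subgroup_def by blast
  qed (use H in auto)
  then show ?thesis using H(1) by blast
qed

lemma saturated_action_twist:
  assumes S: "saturated_action T G \<rho> H" and char: "\<And>n. characteristic_subgroup (H n) G"
    and iso: "\<phi> \<in> iso G G"
  shows "saturated_action T G (\<rho> \<circ> \<phi>) H"
proof -
  interpret saturated_action T G \<rho> H by fact
  have hom: "\<phi> \<in> hom G G" and bij: "bij_betw \<phi> (carrier G) (carrier G)"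
    using iso by (auto simp: iso_def)
  have c: "\<phi> g \<in> carrier G" if "g \<in> carrier G" for g using hom that by (simp add: hom_in_carrier)
  have one: "\<phi> \<one>\<^bsub>G\<^esub> = \<one>\<^bsub>G\<^esub>" using hom_one[OF hom] is_group by blast
  have im: "\<phi> ` H n = H n" for n using char[of n] iso unfolding characteristic_subgroup_def by blast
  interpret tw: tree_action T G "\<rho> \<circ> \<phi>"
  proof
    fix g assume g: "g \<in> carrier G" and fixed: "\<And>v. v \<in> verts T \<Longrightarrow> (\<rho> \<circ> \<phi>) g v = v"
    have "\<phi> g = \<one>\<^bsub>G\<^esub>" using act_faithful[OF c[OF g]] fixed by simp
    then show "g = \<one>\<^bsub>G\<^esub>" using bij g one by (metis bij_betw_def inj_onD one_closed)
  qed (use c one hom in \<open>auto simp: act_closed act_one act_mult hom_mult act_parent act_level\<close>)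
  show ?thesis
  proof (intro saturated_action.intro saturated_action_axioms.intro tw.tree_action_axioms)
    fix v assume v: "v \<in> verts T"
    obtain g where g: "g \<in> rist v" "g \<noteq> \<one>\<^bsub>G\<^esub>" using rist_nontrivial[OF v] by blast
    then have "g \<in> carrier G" unfolding rist_def by blast
    then obtain g' where g': "g' \<in> carrier G" "\<phi> g' = g" using bij by (metis bij_betw_def imageE)
    then have "g' \<in> tw.rist v" using g(1) unfolding tw.rist_def rist_def by simp
    moreover have "g' \<noteq> \<one>\<^bsub>G\<^esub>" using g(2) g'(2) one by blast
    ultimately show "\<exists>g\<in>tw.rist v. g \<noteq> \<one>\<^bsub>G\<^esub>" by blast
  next
    fix n show "subgroup (H n) G" by (rule H_subgroup)
  next
    fix g h n assume "g \<in> carrier G" "h \<in> H n"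
    then show "g \<otimes>\<^bsub>G\<^esub> h \<otimes>\<^bsub>G\<^esub> inv\<^bsub>G\<^esub> g \<in> H n" by (rule H_conj)
  next
    fix n
    have "h \<in> tw.St n" if h: "h \<in> H n" for h
    proof -
      have "\<phi> h \<in> St n" using im[of n] H_le_St h by blast
      then show ?thesis using H_carrier[OF h] unfolding level_stabilizer_def by simp
    qed
    then show "H n \<subseteq> tw.St n" by blast
  next
    fix v n assume v: "v \<in> verts T" "level T v = n"
    show "level_transitive_on_subtree T (\<rho> \<circ> \<phi>) (H n) v"
      unfolding level_transitive_on_subtree_def
    proof (intro ballI impI)
      fix u w assume "u \<in> subtree_verts T v" "w \<in> subtree_verts T v" "level T u = level T w"
      then obtain h where h: "h \<in> H n" "\<rho> h u = w"
        using H_transitive[OF v] unfolding level_transitive_on_subtree_def by blast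
      then obtain h' where "h' \<in> H n" "h = \<phi> h'" using im[of n] by blast
      then show "\<exists>h\<in>H n. (\<rho> \<circ> \<phi>) h u = w" using h(2) by auto
    qed
  qed
qed

lemma automorphism_induced_by_isometry:
  assumes S: "saturated_action T G \<rho> H" and char: "\<And>n. characteristic_subgroup (H n) G"
    and iso: "\<phi> \<in> iso G G"
  shows "\<exists>t\<in>Iso T. \<forall>g\<in>carrier G. \<forall>v\<in>verts T. t (\<rho> g v) = \<rho> (\<phi> g) (t v)"
proof -
  interpret two_saturated_actions T G \<rho> "\<rho> \<circ> \<phi>" H
    using S saturated_action_twist[OF S char iso] by (simp add: two_saturated_actions_def)
  show ?thesis using matching_in_Iso matching_equivariant by auto
qed

section \<open>Twisted conjugacy as conjugacy of isometries\<close>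

text \<open>
  For \<open>\<phi> x = t x t\<^sup>-\<^sup>1\<close> the elements \<open>g t\<close> of the coset \<open>G t\<close> satisfy
  \<open>(a g \<phi>(a\<^sup>-\<^sup>1)) t = a (g t) a\<^sup>-\<^sup>1\<close>, so Reidemeister classes are the \<open>G\<close>-conjugacy classes in that
  coset. The last assumption is the second condition of local normality, applied to the
  automorphisms \<open>x \<mapsto> g \<phi>(x) g\<^sup>-\<^sup>1\<close>, which are defined by the isometries \<open>g t\<close>.
\<close>

locale twisted_action = saturated_action T G \<rho> H
  for T :: "'v tree" and G :: "('b, 'c) monoid_scheme" (structure) and \<rho> H +
  fixes \<phi> :: "'b \<Rightarrow> 'b" and t :: "'v \<Rightarrow> 'v"
  assumes aut: "\<phi> \<in> iso G G" and isometry: "t \<in> Iso T"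
    and equivariant: "g \<in> carrier G \<Longrightarrow> v \<in> verts T \<Longrightarrow> t (\<rho> g v) = \<rho> (\<phi> g) (t v)"
    and local_action_of_coset: "g \<in> carrier G \<Longrightarrow> v \<in> verts T \<Longrightarrow> \<rho> g (t v) = v \<Longrightarrow>
      \<exists>s\<in>St (level T v). \<forall>c\<in>children T v. \<rho> s c = \<rho> g (t c)"

lemma twisted_action_if_locally_normal:
  assumes S: "saturated_action T G \<rho> H" and iso: "\<phi> \<in> iso G G" and t: "t \<in> Iso T"
    and eqv: "\<And>g v. g \<in> carrier G \<Longrightarrow> v \<in> verts T \<Longrightarrow> t (\<rho> g v) = \<rho> (\<phi> g) (t v)"
    and faithful: "faithful_tree_action T G \<rho>" and normal: "locally_normal T G \<rho>"
  shows "twisted_action T G \<rho> H \<phi> t"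
proof -
  interpret saturated_action T G \<rho> H by fact
  interpret A: faithful_tree_action T G \<rho> by fact
  show ?thesis
  proof
    fix g v assume g: "g \<in> carrier G" and v: "v \<in> verts T" and gt: "\<rho> g (t v) = v"
    let ?X = "compose (verts T) (\<rho> g) t"
    let ?B = "BijGroup (verts T)"
    interpret B: group ?B by (rule group_BijGroup)
    have tB: "t \<in> Bij (verts T)" using t unfolding Iso_def by blast
    have \<rho>B: "\<rho> h \<in> Bij (verts T)" if "h \<in> carrier G" for h
      using A.acts_by_isos[OF that] unfolding Iso_def by blast
    have XB: "?X \<in> Bij (verts T)" using compose_Bij[OF \<rho>B[OF g] tB] .
    have Xapp: "?X u = \<rho> g (t u)" if "u \<in> verts T" for u using that by (simp add: compose_def)
    have XI: "?X \<in> Iso T"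
      using XB v t g root_in_verts parent_in_verts Iso_in_verts[OF t] Iso_root[OF t] Iso_parent[OF t]
        Iso_root[OF A.acts_by_isos[OF g]] act_parent[OF g]
      unfolding Iso_def by (auto simp: Xapp)
    let ?\<psi> = "(\<lambda>h. g \<otimes>\<^bsub>G\<^esub> h \<otimes>\<^bsub>G\<^esub> inv\<^bsub>G\<^esub> g) \<circ> \<phi>"
    have \<psi>: "?\<psi> \<in> iso G G" using iso_set_trans[OF iso conj_in_iso[OF g]] by (simp add: comp_def)
    have \<phi>c: "\<phi> x \<in> carrier G" if "x \<in> carrier G" for x
      using iso that by (auto simp: iso_def hom_in_carrier)
    have "defined_by_isometry T G \<rho> ?\<psi> ?X"
      unfolding defined_by_isometry_def
    proof
      fix x assume x: "x \<in> carrier G"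
      have "\<rho> (?\<psi> x) \<otimes>\<^bsub>?B\<^esub> ?X = ?X \<otimes>\<^bsub>?B\<^esub> \<rho> x"
      proof -
        have "compose (verts T) (\<rho> (?\<psi> x)) ?X = compose (verts T) ?X (\<rho> x)"
        proof (rule extensionalityI[of _ "verts T"])
          fix u assume u: "u \<in> verts T"
          have tu: "t u \<in> verts T" using Iso_in_verts[OF t u] .
          have "\<rho> (?\<psi> x) (\<rho> g (t u)) = \<rho> g (\<rho> (\<phi> x) (t u))"
            using g \<phi>c[OF x] tu by (simp add: act_mult act_closed act_inv)
          then show "compose (verts T) (\<rho> (?\<psi> x)) ?X u = compose (verts T) ?X (\<rho> x) u"
            using u x eqv by (simp add: compose_def act_closed)
        qed (auto simp: compose_def)
        then show ?thesis using XB \<rho>B[OF x] \<rho>B[of "?\<psi> x"] g \<phi>c[OF x] by (simp add: BijGroup_def)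
      qed
      moreover have "\<rho> (?\<psi> x) \<in> carrier ?B" "?X \<in> carrier ?B" "\<rho> x \<in> carrier ?B"
        using XB \<rho>B[OF x] \<rho>B[of "?\<psi> x"] g \<phi>c[OF x] by (auto simp: BijGroup_def)
      ultimately show "\<rho> (?\<psi> x) = ?X \<otimes>\<^bsub>?B\<^esub> \<rho> x \<otimes>\<^bsub>?B\<^esub> inv\<^bsub>?B\<^esub> ?X"
        by (metis B.inv_solve_right B.m_closed)
    qed
    moreover have "?X v = v" using Xapp[OF v] gt by simp
    ultimately have "restrict ?X (children T v) \<in> local_action T G \<rho> v"
      using normal v \<psi> XI unfolding locally_normal_def by blast
    then obtain s where s: "s \<in> St (level T v)" "restrict ?X (children T v) = restrict (\<rho> s) (children T v)"
      unfolding local_action_def by blast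
    have "\<rho> s c = \<rho> g (t c)" if "c \<in> children T v" for c
      using fun_cong[OF s(2), of c] that Xapp[of c] children_iff by simp
    then show "\<exists>s\<in>St (level T v). \<forall>c\<in>children T v. \<rho> s c = \<rho> g (t c)" using s(1) by blast
  qed (use iso t eqv in auto)
qed

context twisted_action
begin

abbreviation tw :: "'b \<Rightarrow> 'v \<Rightarrow> 'v" where
  "tw g v \<equiv> \<rho> g (t v)"

lemma aut_closed: "g \<in> carrier G \<Longrightarrow> \<phi> g \<in> carrier G"
  using aut by (auto simp: iso_def hom_in_carrier)

lemma tw_in_verts: "g \<in> carrier G \<Longrightarrow> v \<in> verts T \<Longrightarrow> tw g v \<in> verts T"
  using act_closed Iso_in_verts[OF isometry] by blast

lemma tw_level: "g \<in> carrier G \<Longrightarrow> v \<in> verts T \<Longrightarrow> level T (tw g v) = level T v"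
  using act_level Iso_in_verts[OF isometry] Iso_level[OF isometry] by simp

lemma tw_inj: "g \<in> carrier G \<Longrightarrow> v \<in> verts T \<Longrightarrow> w \<in> verts T \<Longrightarrow> tw g v = tw g w \<Longrightarrow> v = w"
  using act_inj Iso_in_verts[OF isometry] Iso_inj[OF isometry] by metis

lemma tw_funpow_parent:
  "g \<in> carrier G \<Longrightarrow> v \<in> verts T \<Longrightarrow> tw g ((parent T ^^ n) v) = (parent T ^^ n) (tw g v)"
  by (simp add: Iso_funpow_parent[OF isometry] act_funpow_parent Iso_in_verts[OF isometry])

lemma tw_subtree:
  assumes g: "g \<in> carrier G" and w: "w \<in> subtree_verts T v"
  shows "tw g w \<in> subtree_verts T (tw g v)"
proof -
  obtain n where n: "(parent T ^^ n) w = v" "w \<in> verts T" using w unfolding subtree_verts_def by blast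
  then have "(parent T ^^ n) (tw g w) = tw g v" using tw_funpow_parent[OF g n(2), of n] by simp
  then show ?thesis using tw_in_verts[OF g n(2)] unfolding subtree_verts_def by blast
qed

lemma tw_mult: "a \<in> carrier G \<Longrightarrow> g \<in> carrier G \<Longrightarrow> v \<in> verts T \<Longrightarrow> tw (a \<otimes> g) v = \<rho> a (tw g v)"
  using act_mult Iso_in_verts[OF isometry] by blast

text \<open>Conjugacy of the restrictions of \<open>g t\<close> and \<open>h t\<close> to the first \<open>m\<close> levels.\<close>

definition conj_upto :: "nat \<Rightarrow> 'b \<Rightarrow> 'b \<Rightarrow> bool" where
  "conj_upto m g h \<longleftrightarrow>
     (\<exists>a\<in>carrier G. \<forall>v\<in>verts T. level T v \<le> m \<longrightarrow> tw h (\<rho> a v) = \<rho> a (tw g v))"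

lemma conj_upto_antimono: "m \<le> n \<Longrightarrow> conj_upto n g h \<Longrightarrow> conj_upto m g h"
  unfolding conj_upto_def by (meson le_trans)

lemma conj_upto_sym:
  assumes c: "g \<in> carrier G" "h \<in> carrier G" and gh: "conj_upto m g h"
  shows "conj_upto m h g"
proof -
  obtain a where a: "a \<in> carrier G" "\<And>v. v \<in> verts T \<Longrightarrow> level T v \<le> m \<Longrightarrow> tw h (\<rho> a v) = \<rho> a (tw g v)"
    using gh unfolding conj_upto_def by blast
  have "tw g (\<rho> (inv a) v) = \<rho> (inv a) (tw h v)" if v: "v \<in> verts T" "level T v \<le> m" for v
  proof -
    have iv: "\<rho> (inv a) v \<in> verts T" "level T (\<rho> (inv a) v) \<le> m" using a(1) v act_closed act_level by auto
    then have "tw h v = \<rho> a (tw g (\<rho> (inv a) v))" using a(2)[OF iv] act_inv'[OF a(1) v(1)] by simp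
    then show ?thesis using act_inv[OF a(1) tw_in_verts[OF c(1) iv(1)]] by simp
  qed
  then show ?thesis using a(1) inv_closed unfolding conj_upto_def by blast
qed

lemma conj_upto_trans:
  assumes c: "g \<in> carrier G" and gh: "conj_upto m g h" and hk: "conj_upto m h k"
  shows "conj_upto m g k"
proof -
  obtain a where a: "a \<in> carrier G" "\<And>v. v \<in> verts T \<Longrightarrow> level T v \<le> m \<Longrightarrow> tw h (\<rho> a v) = \<rho> a (tw g v)"
    using gh unfolding conj_upto_def by blast
  obtain b where b: "b \<in> carrier G" "\<And>v. v \<in> verts T \<Longrightarrow> level T v \<le> m \<Longrightarrow> tw k (\<rho> b v) = \<rho> b (tw h v)"
    using hk unfolding conj_upto_def by blast
  have "tw k (\<rho> (b \<otimes> a) v) = \<rho> (b \<otimes> a) (tw g v)" if v: "v \<in> verts T" "level T v \<le> m" for v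
    using a b v c by (simp add: act_mult act_closed act_level tw_in_verts)
  then show ?thesis using a(1) b(1) m_closed unfolding conj_upto_def by blast
qed

lemma conj_upto_if_twisted_conjugate:
  assumes "(g, h) \<in> twisted_conjugacy G \<phi>" shows "conj_upto m g h"
proof -
  obtain a where a: "a \<in> carrier G" "g \<in> carrier G" "h = a \<otimes> g \<otimes> \<phi> (inv a)"
    using assms unfolding twisted_conjugacy_def by blast
  have "tw h (\<rho> a v) = \<rho> a (tw g v)" if v: "v \<in> verts T" for v
  proof -
    have "tw h (\<rho> a v) = \<rho> a (\<rho> g (\<rho> (\<phi> (inv a)) (t (\<rho> a v))))"
      using a v aut_closed Iso_in_verts[OF isometry] by (simp add: act_mult act_closed)
    also have "\<rho> (\<phi> (inv a)) (t (\<rho> a v)) = t (\<rho> (inv a) (\<rho> a v))"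
      using equivariant[of "inv a" "\<rho> a v"] a v act_closed by simp
    also have "\<dots> = t v" using act_inv[OF a(1) v] by simp
    finally show ?thesis .
  qed
  then show ?thesis using a(1) unfolding conj_upto_def by blast
qed

text \<open>
  If there are finitely many Reidemeister classes, the relations \<open>conj_upto m\<close>, all of which are
  coarser than twisted conjugacy, can shrink only finitely often.
\<close>

lemma conj_upto_stabilizes:
  assumes fin: "finite (reidemeister_classes G \<phi>)"
  shows "\<exists>n0. \<forall>m. \<forall>g\<in>carrier G. \<forall>h\<in>carrier G. conj_upto n0 g h \<longrightarrow> conj_upto m g h"
proof -
  let ?Q = "reidemeister_classes G \<phi>"
  define P where "P m = {(C, D). C \<in> ?Q \<and> D \<in> ?Q \<and> (\<exists>g\<in>C. \<exists>h\<in>D. conj_upto m g h)}" for m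
  have finP: "finite (P m)" for m
    using finite_subset[of "P m" "?Q \<times> ?Q"] fin unfolding P_def by auto
  have anti: "P m \<subseteq> P n" if "n \<le> m" for m n
    using conj_upto_antimono[OF that] unfolding P_def by blast
  obtain n0 where n0: "\<And>m. card (P n0) \<le> card (P m)"
    using ex_has_least_nat[of "\<lambda>_. True" 0 "\<lambda>n. card (P n)"] by blast
  have eq: "P m = P n0" if "n0 \<le> m" for m
    using card_seteq[OF finP anti[OF that] n0] .
  have "conj_upto m g h" if g: "g \<in> carrier G" and h: "h \<in> carrier G" and gh: "conj_upto n0 g h" for m g h
  proof -
    let ?M = "max m n0"
    define cls where "cls k = twisted_conjugacy G \<phi> `` {k}" for k
    have \<phi>1: "\<phi> \<one> = \<one>" using aut hom_one[of \<phi> G G] is_group by (auto simp: iso_def)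
    have self: "k \<in> cls k" "cls k \<in> ?Q" if k: "k \<in> carrier G" for k
    proof -
      have "k = \<one> \<otimes> k \<otimes> \<phi> (inv \<one>)" using k \<phi>1 by simp
      then show "k \<in> cls k" using k unfolding cls_def twisted_conjugacy_def by blast
      show "cls k \<in> ?Q" using k unfolding cls_def reidemeister_classes_def by (rule quotientI)
    qed
    have "(cls g, cls h) \<in> P n0" unfolding P_def using self g h gh by blast
    then have "(cls g, cls h) \<in> P ?M" using eq[of ?M] by simp
    then obtain g' h' where gh': "g' \<in> cls g" "h' \<in> cls h" "conj_upto ?M g' h'" unfolding P_def by blast
    then have gg: "(g, g') \<in> twisted_conjugacy G \<phi>" "(h, h') \<in> twisted_conjugacy G \<phi>"
      unfolding cls_def by auto
    then have c': "g' \<in> carrier G" "h' \<in> carrier G" unfolding twisted_conjugacy_def by auto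
    have "conj_upto ?M g h"
      using conj_upto_trans[OF g conj_upto_if_twisted_conjugate[OF gg(1)]
          conj_upto_trans[OF c'(1) gh'(3) conj_upto_sym[OF h c'(2) conj_upto_if_twisted_conjugate[OF gg(2)]]]] .
    then show ?thesis using conj_upto_antimono[of m ?M] by simp
  qed
  then show ?thesis by blast
qed

text \<open>
  A path fixed by \<open>g t\<close> together with the siblings of its vertices: so every power of \<open>g t\<close> acts
  trivially next to the path.
\<close>

definition fixes_path_to :: "'b \<Rightarrow> 'v \<Rightarrow> bool" where
  "fixes_path_to g u \<longleftrightarrow> u \<in> verts T \<and>
     (\<forall>i<level T u. \<forall>c\<in>children T (ancestor T i u). tw g c = c)"

lemma fixes_path_end:
  assumes g: "g \<in> carrier G" and u: "fixes_path_to g u"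
  shows "tw g u = u"
proof (cases "u = root T")
  case True
  then show ?thesis
    using level_eq_0_iff[of "tw g u"] tw_in_verts[OF g] tw_level[OF g] root_in_verts level_root by simp
next
  case False
  have uv: "u \<in> verts T" using u unfolding fixes_path_to_def by blast
  have l: "level T u = Suc (level T (parent T u))" using level_parent_Suc[OF uv False] .
  have "ancestor T (level T (parent T u)) u = parent T u"
    using ancestor_Suc[OF uv, of "level T (parent T u)"] l ancestor_level_self[of u] by simp
  moreover have "u \<in> children T (parent T u)" using uv False unfolding children_def by blast
  ultimately show ?thesis using u l unfolding fixes_path_to_def by (metis lessI)
qed

lemma ancestor_child:
  assumes u: "u \<in> verts T" and c: "c \<in> children T u" and i: "i \<le> level T u"
  shows "ancestor T i c = ancestor T i u"
proof -
  have cv: "c \<in> verts T" "level T c = Suc (level T u)" "parent T c = u" using c children_iff by auto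
  have "ancestor T (level T u) c = u" using cv unfolding ancestor_def by simp
  then show ?thesis using ancestor_ancestor[OF cv(1) i] cv(2) by simp
qed

text \<open>
  By local normality some \<open>s\<close> in \<open>St m\<close> acts on the children of the end of the path as \<open>g t\<close> does; then
  \<open>s\<^sup>-\<^sup>1 g t\<close> fixes these children, and it agrees with \<open>g t\<close> on the first \<open>m\<close> levels.
\<close>

lemma fixed_path_exists: "\<exists>g\<in>carrier G. \<exists>u. level T u = m \<and> fixes_path_to g u"
proof (induction m)
  case 0
  have "fixes_path_to \<one> (root T)" unfolding fixes_path_to_def using root_in_verts level_root by simp
  then show ?case using level_root by blast
next
  case (Suc m)
  then obtain g u where g: "g \<in> carrier G" and u: "level T u = m" "fixes_path_to g u" by blast
  have uv: "u \<in> verts T" using u unfolding fixes_path_to_def by blast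
  obtain s where s: "s \<in> St m" "\<And>c. c \<in> children T u \<Longrightarrow> \<rho> s c = tw g c"
    using local_action_of_coset[OF g uv fixes_path_end[OF g u(2)]] u(1) by blast
  have sc: "s \<in> carrier G" using s unfolding level_stabilizer_def by blast
  obtain c where c: "c \<in> children T u" using has_child[OF uv] by blast
  have cl: "c \<in> verts T" "level T c = Suc m" using c children_iff u by auto
  have "tw (inv s \<otimes> g) d = d" if i: "i < Suc m" and d: "d \<in> children T (ancestor T i c)" for i d
  proof -
    have anc: "ancestor T i c = ancestor T i u" using ancestor_child[OF uv c] i u by simp
    have dv: "d \<in> verts T" "level T d = Suc (level T (ancestor T i u))" using d children_iff anc by auto
    have e: "tw (inv s \<otimes> g) d = \<rho> (inv s) (tw g d)" using tw_mult[of "inv s" g d] sc g dv by simp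
    show ?thesis
    proof (cases "i = m")
      case True
      then have "d \<in> children T u" using d anc u ancestor_level_self[of u] by simp
      then show ?thesis using e s(2) act_inv[OF sc dv(1)] by metis
    next
      case False
      then have im: "i < m" using i by simp
      then have "tw g d = d" using u d anc unfolding fixes_path_to_def by simp
      moreover have "level T d \<le> m" using dv(2) level_ancestor[OF uv, of i] u im by simp
      then have "\<rho> (inv s) d = d" using act_inv_fixed[OF sc dv(1)] St_fixes[OF s(1) dv(1)] by simp
      ultimately show ?thesis using e by simp
    qed
  qed
  then have "fixes_path_to (inv s \<otimes> g) c" unfolding fixes_path_to_def using cl by simp
  then show ?case using cl sc g by (meson inv_closed m_closed)
qed

lemma fixes_path_conj:
  assumes g: "g \<in> carrier G" and h: "h \<in> carrier G" and u: "fixes_path_to g u"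
    and gh: "conj_upto (level T u) g h"
  shows "\<exists>u'. level T u' = level T u \<and> fixes_path_to h u'"
proof -
  have uv: "u \<in> verts T" using u unfolding fixes_path_to_def by blast
  obtain a where a: "a \<in> carrier G"
      "\<And>v. v \<in> verts T \<Longrightarrow> level T v \<le> level T u \<Longrightarrow> tw h (\<rho> a v) = \<rho> a (tw g v)"
    using gh unfolding conj_upto_def by blast
  have "tw h d = d" if i: "i < level T u" and d: "d \<in> children T (ancestor T i (\<rho> a u))" for i d
  proof -
    have dv: "d \<in> verts T" using d children_iff by blast
    let ?c = "\<rho> (inv a) d"
    have "\<rho> (inv a) (ancestor T i (\<rho> a u)) = ancestor T i u"
      using act_ancestor[of "inv a" "\<rho> a u" i] a(1) uv act_closed act_inv by simp
    then have c: "?c \<in> children T (ancestor T i u)"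
      using act_children[OF inv_closed[OF a(1)] _ d] ancestor_in_verts[OF act_closed[OF a(1) uv]] by simp
    then have "level T ?c \<le> level T u" "?c \<in> verts T" using children_iff level_ancestor[OF uv, of i] i by auto
    then have "tw h (\<rho> a ?c) = \<rho> a (tw g ?c)" using a(2) by blast
    moreover have "tw g ?c = ?c" using u c i unfolding fixes_path_to_def by blast
    ultimately show ?thesis using act_inv'[OF a(1) dv] by simp
  qed
  then have "fixes_path_to h (\<rho> a u)"
    unfolding fixes_path_to_def using act_closed[OF a(1) uv] act_level[OF a(1) uv] by simp
  then show ?thesis using act_level[OF a(1) uv] by blast
qed

end


section \<open>Orbits of rigid stabilisers on one level\<close>

context saturated_action
begin

lemma St_conj_fixed_rist:
  assumes e: "e \<in> carrier G" "\<rho> e w = w" and w: "w \<in> verts T" and d: "d \<in> rist w \<inter> St j"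
  shows "e \<otimes> d \<otimes> inv e \<in> rist w \<inter> St j"
  using rist_conj[OF e(1) w, of d] St_conj[OF e(1), of d j] d e(2) by auto

lemma St_orbit_of_child:
  assumes u: "u \<in> verts T" "level T u = j" and c: "c \<in> children T u"
  shows "(\<lambda>d. \<rho> d c) ` St j = children T u"
proof
  show "(\<lambda>d. \<rho> d c) ` St j \<subseteq> children T u"
  proof
    fix x assume "x \<in> (\<lambda>d. \<rho> d c) ` St j"
    then obtain d where d: "d \<in> St j" "x = \<rho> d c" by blast
    then have "d \<in> carrier G" "\<rho> d u = u" using u unfolding level_stabilizer_def by blast+
    then show "x \<in> children T u" using act_children[OF _ u(1) c, of d] d(2) by simp
  qed
  show "children T u \<subseteq> (\<lambda>d. \<rho> d c) ` St j"
  proof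
    fix x assume x: "x \<in> children T u"
    then have "level T c = level T x" using c children_iff by simp
    then obtain h where "h \<in> H j" "\<rho> h c = x"
      using H_transitive[OF u] child_in_subtree[OF c] child_in_subtree[OF x]
      unfolding level_transitive_on_subtree_def by blast
    then show "x \<in> (\<lambda>d. \<rho> d c) ` St j" using H_le_St by blast
  qed
qed

lemma child_of_parent:
  assumes "c \<in> verts T" "level T c = Suc j"
  shows "parent T c \<in> verts T" "level T (parent T c) = j" "c \<in> children T (parent T c)"
  using assms parent_in_verts level_parent children_iff by auto

text \<open>
  Branching by \<open>p\<close> that comes from rigid stabilisers: it forces a Sylow \<open>p\<close>-subgroup to act
  nontrivially inside them.
\<close>

definition rist_orbits_divisible :: "nat \<Rightarrow> nat \<Rightarrow> nat \<Rightarrow> bool" where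
  "rist_orbits_divisible p n j \<longleftrightarrow> (\<forall>w\<in>verts T. level T w = n \<longrightarrow>
     (\<forall>c\<in>subtree_verts T w. level T c = Suc j \<longrightarrow> p dvd card ((\<lambda>d. \<rho> d c) ` (rist w \<inter> St j))))"

lemma rist_St_subgroup: "subgroup (rist w \<inter> St j) G"
  using subgroups_Inter_pair[OF rist_subgroup St_subgroup] .

text \<open>
  The group on the left is normalised by \<open>St j\<close>, which permutes the children of a vertex of level \<open>j\<close>
  transitively.
\<close>

lemma rist_orbit_dvd_children:
  assumes w: "w \<in> verts T" "level T w \<le> j" and c: "c \<in> verts T" "level T c = Suc j"
  shows "card ((\<lambda>d. \<rho> d c) ` (rist w \<inter> St j)) dvd card (children T (parent T c))"
proof -
  note p = child_of_parent[OF c]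
  have orb: "(\<lambda>d. \<rho> d c) ` St j = children T (parent T c)" using St_orbit_of_child[OF p] .
  have "card ((\<lambda>d. \<rho> d c) ` (rist w \<inter> St j)) dvd card ((\<lambda>d. \<rho> d c) ` St j)"
  proof (rule card_orbit_dvd_card_orbit_if_normalizes[OF rist_St_subgroup St_subgroup _ _ c(1)])
    fix e d assume e: "e \<in> St j" and d: "d \<in> rist w \<inter> St j"
    have "e \<in> carrier G" using e unfolding level_stabilizer_def by blast
    then show "e \<otimes> d \<otimes> inv e \<in> rist w \<inter> St j"
      using St_conj_fixed_rist[OF _ St_fixes[OF e w] w(1) d] by blast
  next
    show "finite ((\<lambda>d. \<rho> d c) ` St j)" using orb locally_finite[OF p(1)] by simp
  qed auto
  then show ?thesis using orb by simp
qed

lemma rist_orbits_divisible_children: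
  assumes div: "rist_orbits_divisible p n j" and nj: "n \<le> j" and u: "u \<in> verts T" "level T u = j"
  shows "p dvd card (children T u)"
proof -
  obtain c where c: "c \<in> children T u" using has_child[OF u(1)] by blast
  then have cv: "c \<in> verts T" "level T c = Suc j" "parent T c = u" using children_iff u by auto
  let ?w = "ancestor T n c"
  have w: "?w \<in> verts T" "level T ?w = n" "c \<in> subtree_verts T ?w"
    using ancestor_in_verts level_ancestor in_subtree_ancestor cv nj by auto
  have "p dvd card ((\<lambda>d. \<rho> d c) ` (rist ?w \<inter> St j))"
    using div w cv unfolding rist_orbits_divisible_def by blast
  also have "\<dots> dvd card (children T u)"
    using rist_orbit_dvd_children[OF w(1) _ cv(1,2)] w(2) nj cv(3) by simp
  finally show ?thesis .
qed

text \<open>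
  The contribution of a vertex of level \<open>n'\<close> is normalised by that of its ancestor of level \<open>n\<close>.
\<close>

lemma rist_orbits_divisible_antimono:
  assumes div: "rist_orbits_divisible p n' j" and n: "n \<le> n'" "n' \<le> j"
  shows "rist_orbits_divisible p n j"
  unfolding rist_orbits_divisible_def
proof (intro ballI impI)
  fix w c assume w: "w \<in> verts T" "level T w = n" and c: "c \<in> subtree_verts T w" "level T c = Suc j"
  have cv: "c \<in> verts T" using c subtree_in_verts by blast
  let ?w = "ancestor T n' c"
  have w': "?w \<in> verts T" "level T ?w = n'" "c \<in> subtree_verts T ?w"
    using ancestor_in_verts level_ancestor in_subtree_ancestor cv c n by auto
  have ww: "?w \<in> subtree_verts T w"
    using subtrees_meet_nested[OF w(1) w'(1) _ c(1) w'(3)] w w' n by simp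
  have "p dvd card ((\<lambda>d. \<rho> d c) ` (rist ?w \<inter> St j))"
    using div w' c unfolding rist_orbits_divisible_def by blast
  also have "card ((\<lambda>d. \<rho> d c) ` (rist ?w \<inter> St j)) dvd card ((\<lambda>d. \<rho> d c) ` (rist w \<inter> St j))"
  proof (rule card_orbit_dvd_card_orbit_if_normalizes[OF rist_St_subgroup rist_St_subgroup _ _ cv])
    show "rist ?w \<inter> St j \<subseteq> rist w \<inter> St j" using rist_mono[OF ww] by blast
    fix e d assume e: "e \<in> rist w \<inter> St j" and d: "d \<in> rist ?w \<inter> St j"
    have "e \<in> carrier G" using e unfolding level_stabilizer_def by blast
    then show "e \<otimes> d \<otimes> inv e \<in> rist ?w \<inter> St j"
      using St_conj_fixed_rist[OF _ St_fixes[of e j] w'(1) d] e w' n by auto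
  next
    have "(\<lambda>d. \<rho> d c) ` (rist w \<inter> St j) \<subseteq> (\<lambda>d. \<rho> d c) ` St j" by blast
    then show "finite ((\<lambda>d. \<rho> d c) ` (rist w \<inter> St j))"
      using St_orbit_of_child[OF child_of_parent[OF cv c(2)]] locally_finite[OF child_of_parent(1)[OF cv c(2)]]
      by (metis finite_subset)
  qed
  finally show "p dvd card ((\<lambda>d. \<rho> d c) ` (rist w \<inter> St j))" .
qed

text \<open>
  Take for \<open>j + 1\<close> the first level on which the rigid stabiliser of a vertex \<open>w\<^sub>0\<close> of level \<open>n\<close>
  acts nontrivially. By transitivity all its orbits below \<open>w\<^sub>0\<close> on that level have the same
  size, greater than 1.
\<close>

lemma rist_orbits_divisible_exists:
  "\<exists>j\<ge>n. \<exists>p. Factorial_Ring.prime p \<and> rist_orbits_divisible p n j"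
proof -
  obtain w0 where w0: "w0 \<in> verts T" "level T w0 = n"
    using has_descendant[OF root_in_verts, of n] level_root subtree_in_verts by auto
  let ?M = "\<lambda>l. \<exists>g\<in>rist w0. \<exists>y\<in>verts T. level T y = l \<and> \<rho> g y \<noteq> y"
  obtain g0 where g0: "g0 \<in> rist w0" "g0 \<noteq> \<one>" using rist_nontrivial[OF w0(1)] by blast
  then obtain y0 where y0: "y0 \<in> subtree_verts T w0" "\<rho> g0 y0 \<noteq> y0" using rist_moves[OF w0(1)] by blast
  have ex: "?M (level T y0)" using g0 y0 subtree_in_verts by blast
  define L where "L = (LEAST l. ?M l)"
  obtain g y where g: "g \<in> rist w0" and y: "y \<in> verts T" "level T y = L" "\<rho> g y \<noteq> y"
    using LeastI[of ?M, OF ex] unfolding L_def by blast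
  have least: "\<rho> h v = v" if "h \<in> rist w0" "v \<in> verts T" "level T v < L" for h v
    using not_less_Least[of "level T v" ?M] that unfolding L_def by blast
  have "\<not> L \<le> n"
  proof
    assume "L \<le> n"
    then have "g \<in> St L" using rist_le_St[OF w0(1), of L] g w0(2) by blast
    then show False using y unfolding level_stabilizer_def by blast
  qed
  then obtain j where j: "L = Suc j" "n \<le> j" by (metis Suc_le_mono not_less_eq_eq old.nat.exhaust zero_le)
  have "g \<in> carrier G" using g unfolding rist_def by blast
  moreover have "\<rho> g v = v" if "v \<in> verts T" "level T v = j" for v
    using least[OF g that(1)] that(2) j(1) by simp
  ultimately have gS: "g \<in> rist w0 \<inter> St j"
    using g unfolding level_stabilizer_def by blast
  let ?O = "(\<lambda>d. \<rho> d y) ` (rist w0 \<inter> St j)"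
  have yy: "level T y = Suc j" using y j by simp
  have finO: "finite ?O"
  proof -
    have "?O \<subseteq> (\<lambda>d. \<rho> d y) ` St j" by blast
    then show ?thesis
      using St_orbit_of_child[OF child_of_parent[OF y(1) yy]] locally_finite[OF child_of_parent(1)[OF y(1) yy]]
      by (metis finite_subset)
  qed
  have "y \<in> ?O" using mem_orbit[OF rist_St_subgroup y(1)] .
  moreover have "\<rho> g y \<in> ?O" using gS by blast
  ultimately have "card ?O \<noteq> 1"
    using y(3) card_1_singletonE by (metis singletonD)
  then obtain p where p: "Factorial_Ring.prime p" "p dvd card ?O" using prime_factor_nat by blast
  have "rist_orbits_divisible p n j"
    unfolding rist_orbits_divisible_def
  proof (intro ballI impI)
    fix w c assume w: "w \<in> verts T" "level T w = n" and c: "c \<in> subtree_verts T w" "level T c = Suc j"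
    have cv: "c \<in> verts T" using c subtree_in_verts by blast
    have "level_transitive_on_subtree T \<rho> (H 0) (root T)" using H_transitive[OF root_in_verts level_root] .
    moreover have "c \<in> subtree_verts T (root T)" "y \<in> subtree_verts T (root T)"
      using cv y funpow_level unfolding subtree_verts_def by blast+
    ultimately obtain a where a: "a \<in> H 0" "\<rho> a y = c"
      using c yy unfolding level_transitive_on_subtree_def by metis
    have ac: "a \<in> carrier G" using a H_carrier by blast
    have yw0: "y \<in> subtree_verts T w0" using y(1,3) g unfolding rist_def by blast
    have aw: "\<rho> a w0 = w"
      using mem_subtree_iff[OF w0(1) y(1)] mem_subtree_iff[OF w(1) cv] yw0 c(1) w(2) w0(2)
        act_ancestor[OF ac y(1), of n] a(2) by simp
    have "(\<lambda>d. \<rho> d c) ` (rist w \<inter> St j) = \<rho> a ` ?O"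
    proof (intro Set.set_eqI iffI)
      fix x assume "x \<in> (\<lambda>d. \<rho> d c) ` (rist w \<inter> St j)"
      then obtain d where d: "d \<in> rist w \<inter> St j" "x = \<rho> d c" by blast
      have dc: "d \<in> carrier G" using d unfolding rist_def by blast
      have "inv a \<otimes> d \<otimes> inv (inv a) \<in> rist (\<rho> (inv a) w) \<inter> St j"
        using rist_conj[of "inv a" w d] St_conj[of "inv a" d j] ac w d by simp
      then have "inv a \<otimes> d \<otimes> a \<in> rist w0 \<inter> St j" using aw act_inv[OF ac w0(1)] ac by simp
      moreover have "\<rho> a (\<rho> (inv a \<otimes> d \<otimes> a) y) = x"
        using ac dc d(2) a(2) y(1) cv by (simp add: act_mult act_closed act_inv')
      ultimately show "x \<in> \<rho> a ` ?O" by blast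
    next
      fix x assume "x \<in> \<rho> a ` ?O"
      then obtain d where d: "d \<in> rist w0 \<inter> St j" "x = \<rho> a (\<rho> d y)" by blast
      have dc: "d \<in> carrier G" using d unfolding rist_def by blast
      have "a \<otimes> d \<otimes> inv a \<in> rist w \<inter> St j"
        using rist_conj[OF ac w0(1), of d] St_conj[OF ac, of d j] d aw by simp
      moreover have "\<rho> (a \<otimes> d \<otimes> inv a) c = x"
        using ac dc d(2) a(2)[symmetric] y(1) by (simp add: act_mult act_closed act_inv)
      ultimately show "x \<in> (\<lambda>d. \<rho> d c) ` (rist w \<inter> St j)" by blast
    qed
    moreover have "inj_on (\<rho> a) ?O"
    proof (rule inj_onI)
      fix x x' assume xx: "x \<in> ?O" "x' \<in> ?O" "\<rho> a x = \<rho> a x'"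
      have "?O \<subseteq> verts T" using act_closed y(1) unfolding rist_def by blast
      then show "x = x'" using act_inj[OF ac] xx by blast
    qed
    ultimately show "p dvd card ((\<lambda>d. \<rho> d c) ` (rist w \<inter> St j))" using p(2) by (simp add: card_image)
  qed
  then show ?thesis using p(1) j(2) by blast
qed

end

section \<open>Truncation to finitely many levels\<close>

text \<open>
  Restricting to the first \<open>m\<close> levels turns \<open>G\<close> into a finite group of permutations, and \<open>G t\<close>
  into a coset of permutations normalising it.
\<close>

locale truncated_action = twisted_action +
  fixes m :: nat
begin

definition V where "V = {v \<in> verts T. level T v \<le> m}"

abbreviation A where "A \<equiv> BijGroup V"

abbreviation mult_A (infixl "\<cdot>" 70) where "a \<cdot> b \<equiv> a \<otimes>\<^bsub>A\<^esub> b"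

lemma finite_V: "finite V"
  unfolding V_def by (rule finite_levels_upto)

lemma V_in_verts: "v \<in> V \<Longrightarrow> v \<in> verts T" and V_level: "v \<in> V \<Longrightarrow> level T v \<le> m"
  unfolding V_def by auto

lemma in_V: "v \<in> verts T \<Longrightarrow> level T v \<le> m \<Longrightarrow> v \<in> V"
  unfolding V_def by simp

sublocale trunc: acting_group A V "\<lambda>f. f"
proof (rule acting_group.intro[OF group_BijGroup], unfold_locales)
  show "g \<in> carrier A \<Longrightarrow> x \<in> V \<Longrightarrow> g x \<in> V" for g x
    using Bij_imp_funcset by (fastforce simp: BijGroup_def)
  show "x \<in> V \<Longrightarrow> \<one>\<^bsub>A\<^esub> x = x" for x by (simp add: BijGroup_def)
  show "g \<in> carrier A \<Longrightarrow> h \<in> carrier A \<Longrightarrow> x \<in> V \<Longrightarrow> (g \<cdot> h) x = g (h x)" for g h x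
    by (simp add: BijGroup_def compose_def)
qed

lemma finite_A: "finite (carrier A)"
proof -
  have "f \<in> V \<rightarrow>\<^sub>E V" if "f \<in> carrier A" for f
    using that Bij_imp_funcset[of f V] Bij_imp_extensional[of f V] by (simp add: BijGroup_def PiE_def)
  then have "carrier A \<subseteq> V \<rightarrow>\<^sub>E V" by blast
  moreover have "finite (V \<rightarrow>\<^sub>E V)" by (rule finite_PiE[OF finite_V]) (rule finite_V)
  ultimately show ?thesis by (rule finite_subset)
qed

lemma perm_eqI:
  assumes "f \<in> carrier A" "h \<in> carrier A" "\<And>v. v \<in> V \<Longrightarrow> f v = h v"
  shows "f = h"
  using assms by (intro extensionalityI[of f V h]) (auto simp: BijGroup_def Bij_imp_extensional)

lemma conj_apply:
  assumes "x \<in> carrier A" "a \<in> carrier A" "v \<in> V"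
  shows "(x \<cdot> a \<cdot> inv\<^bsub>A\<^esub> x) v = x (a ((inv\<^bsub>A\<^esub> x) v))"
  using assms by (simp add: trunc.act_mult trunc.act_closed)

definition res :: "'b \<Rightarrow> 'a \<Rightarrow> 'a" where "res g = restrict (\<rho> g) V"
definition tres :: "'b \<Rightarrow> 'a \<Rightarrow> 'a" where "tres g = restrict (tw g) V"

lemma res_apply: "v \<in> V \<Longrightarrow> res g v = \<rho> g v" and tres_apply: "v \<in> V \<Longrightarrow> tres g v = tw g v"
  unfolding res_def tres_def by auto

lemma restrict_in_A:
  assumes "\<And>v. v \<in> V \<Longrightarrow> f v \<in> V" "\<And>v w. v \<in> V \<Longrightarrow> w \<in> V \<Longrightarrow> f v = f w \<Longrightarrow> v = w"
  shows "restrict f V \<in> carrier A"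
proof -
  have "inj_on f V" using assms(2) by (intro inj_onI)
  moreover have "f ` V \<subseteq> V" using assms(1) by blast
  ultimately have "bij_betw f V V" using endo_inj_surj[OF finite_V] unfolding bij_betw_def by blast
  then have "bij_betw (restrict f V) V V" using bij_betw_cong[of V "restrict f V" f V] by simp
  then show ?thesis by (simp add: BijGroup_def Bij_def)
qed

lemma act_V: "g \<in> carrier G \<Longrightarrow> v \<in> V \<Longrightarrow> \<rho> g v \<in> V"
  unfolding V_def by (simp add: act_closed act_level)

lemma tw_V: "g \<in> carrier G \<Longrightarrow> v \<in> V \<Longrightarrow> tw g v \<in> V"
  using in_V tw_in_verts tw_level V_in_verts V_level by simp

lemma res_in_A: "g \<in> carrier G \<Longrightarrow> res g \<in> carrier A"
  unfolding res_def by (rule restrict_in_A) (use act_V act_inj V_in_verts in blast)+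

lemma tres_in_A: "g \<in> carrier G \<Longrightarrow> tres g \<in> carrier A"
  unfolding tres_def by (rule restrict_in_A) (use tw_V tw_inj V_in_verts in blast)+

lemma res_mult: "g \<in> carrier G \<Longrightarrow> h \<in> carrier G \<Longrightarrow> res (g \<otimes> h) = res g \<cdot> res h"
  by (rule perm_eqI) (auto simp: res_in_A res_apply trunc.act_mult act_mult act_V V_in_verts)

lemma res_one: "res \<one> = \<one>\<^bsub>A\<^esub>"
  by (rule perm_eqI) (auto simp: res_in_A res_apply trunc.act_one act_one V_in_verts)

lemma res_inv:
  assumes "g \<in> carrier G" shows "res (inv g) = inv\<^bsub>A\<^esub> (res g)"
proof (rule trunc.inv_equality[symmetric])
  show "res (inv g) \<cdot> res g = \<one>\<^bsub>A\<^esub>" using assms res_mult[of "inv g" g] res_one by simp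
qed (use assms res_in_A in auto)

lemma res_tres: "a \<in> carrier G \<Longrightarrow> g \<in> carrier G \<Longrightarrow> res a \<cdot> tres g = tres (a \<otimes> g)"
  by (rule perm_eqI) (auto simp: res_in_A tres_in_A res_apply tres_apply trunc.act_mult tw_mult tw_V V_in_verts)

lemma tres_conj_res:
  assumes g: "g \<in> carrier G" and a: "a \<in> carrier G"
  shows "tres g \<cdot> res a \<cdot> inv\<^bsub>A\<^esub> (tres g) = res (g \<otimes> \<phi> a \<otimes> inv g)"
proof -
  let ?b = "g \<otimes> \<phi> a \<otimes> inv g"
  have b: "?b \<in> carrier G" using g a aut_closed by simp
  have "tres g \<cdot> res a = res ?b \<cdot> tres g"
  proof (rule perm_eqI)
    fix v assume v: "v \<in> V"
    have vv: "v \<in> verts T" "t v \<in> verts T" using v V_in_verts Iso_in_verts[OF isometry] by auto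
    have "\<rho> ?b (\<rho> g (t v)) = \<rho> g (\<rho> (\<phi> a) (t v))"
      using g a aut_closed vv by (simp add: act_mult act_closed act_inv)
    then show "(tres g \<cdot> res a) v = (res ?b \<cdot> tres g) v"
      using g a b v vv by (simp add: trunc.act_mult res_in_A tres_in_A res_apply tres_apply act_V tw_V equivariant)
  qed (use g a b in \<open>auto simp: res_in_A tres_in_A\<close>)
  then have "res ?b = tres g \<cdot> res a \<cdot> inv\<^bsub>A\<^esub> (tres g)"
    by (intro iffD2[OF trunc.inv_solve_right]) (simp_all add: tres_in_A[OF g] res_in_A[OF a] res_in_A[OF b])
  then show ?thesis by (rule sym)
qed

definition Gm where "Gm = res ` carrier G"
definition Stm where "Stm n = res ` St n"
definition ristm where "ristm w j = {a \<in> Stm j. \<forall>v\<in>V - subtree_verts T w. a v = v}"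

lemma res_image_subgroup:
  assumes "subgroup B G" shows "subgroup (res ` B) A"
proof (rule trunc.subgroupI)
  have c: "b \<in> carrier G" if "b \<in> B" for b using subgroup_memD[OF assms that] .
  show "res ` B \<subseteq> carrier A" using res_in_A c by blast
  show "res ` B \<noteq> {}" using subgroup.one_closed[OF assms] by blast
  fix a assume "a \<in> res ` B"
  then obtain g where g: "g \<in> B" "a = res g" by blast
  then have "inv\<^bsub>A\<^esub> a = res (inv g)" using res_inv[OF c[OF g(1)]] by simp
  then show "inv\<^bsub>A\<^esub> a \<in> res ` B" using subgroup.m_inv_closed[OF assms g(1)] by simp
  fix b assume "b \<in> res ` B"
  then obtain h where h: "h \<in> B" "b = res h" by blast
  then have "a \<cdot> b = res (g \<otimes> h)" using g(2) res_mult[OF c[OF g(1)] c[OF h(1)]] by simp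
  then show "a \<cdot> b \<in> res ` B" using subgroup.m_closed[OF assms g(1) h(1)] by simp
qed

lemma Gm_subgroup: "subgroup Gm A" and Stm_subgroup: "subgroup (Stm n) A"
  unfolding Gm_def Stm_def using res_image_subgroup subgroup_self St_subgroup by blast+

lemma Gm_carrier: "a \<in> Gm \<Longrightarrow> a \<in> carrier A" and Stm_carrier: "a \<in> Stm n \<Longrightarrow> a \<in> carrier A"
  using trunc.subgroup_memD[OF Gm_subgroup] trunc.subgroup_memD[OF Stm_subgroup] by blast+

lemma St_carrier: "g \<in> St n \<Longrightarrow> g \<in> carrier G"
  unfolding level_stabilizer_def by blast

lemma Stm_le_Gm: "Stm n \<subseteq> Gm"
  unfolding Stm_def Gm_def using St_carrier by blast

lemma Stm_antimono: "l \<le> n \<Longrightarrow> Stm n \<subseteq> Stm l"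
  unfolding Stm_def using St_antimono by blast

lemma Stm_fixes: "a \<in> Stm n \<Longrightarrow> v \<in> V \<Longrightarrow> level T v \<le> n \<Longrightarrow> a v = v"
  unfolding Stm_def using St_fixes V_in_verts res_apply by auto

lemma mem_Stm_iff:
  assumes "n \<le> m"
  shows "a \<in> Stm n \<longleftrightarrow> a \<in> Gm \<and> (\<forall>v\<in>V. level T v = n \<longrightarrow> a v = v)"
proof
  assume "a \<in> Stm n" then show "a \<in> Gm \<and> (\<forall>v\<in>V. level T v = n \<longrightarrow> a v = v)"
    using Stm_le_Gm Stm_fixes by blast
next
  assume a: "a \<in> Gm \<and> (\<forall>v\<in>V. level T v = n \<longrightarrow> a v = v)"
  then obtain g where g: "g \<in> carrier G" "a = res g" unfolding Gm_def by blast
  have "\<rho> g v = v" if "v \<in> verts T" "level T v = n" for v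
    using a g that assms in_V[of v] res_apply[of v g] by auto
  then show "a \<in> Stm n" using g unfolding Stm_def level_stabilizer_def by blast
qed

lemma Gm_subtree: "a \<in> Gm \<Longrightarrow> v \<in> V \<Longrightarrow> w \<in> V \<Longrightarrow> w \<in> subtree_verts T v \<Longrightarrow> a w \<in> subtree_verts T (a v)"
  unfolding Gm_def using act_subtree by (auto simp: res_apply)

lemma Gm_children: "a \<in> Gm \<Longrightarrow> v \<in> V \<Longrightarrow> c \<in> V \<Longrightarrow> c \<in> children T v \<Longrightarrow> a c \<in> children T (a v)"
  unfolding Gm_def using act_children V_in_verts by (auto simp: res_apply)

lemma Gm_level: "a \<in> Gm \<Longrightarrow> v \<in> V \<Longrightarrow> level T (a v) = level T v"
  unfolding Gm_def using act_level V_in_verts by (auto simp: res_apply)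

lemma Stm_orbit_of_child:
  assumes u: "u \<in> verts T" "level T u = j" and j: "Suc j \<le> m" and c: "c \<in> children T u"
  shows "(\<lambda>d. d c) ` Stm j = children T u"
proof -
  have "c \<in> V" using c children_iff u j in_V by simp
  then have "(\<lambda>d. d c) ` Stm j = (\<lambda>d. \<rho> d c) ` St j"
    unfolding Stm_def by (simp add: image_image res_apply)
  then show ?thesis using St_orbit_of_child[OF u c] by simp
qed

lemma Stm_normal:
  assumes k: "k \<in> Gm" and a: "a \<in> Stm n"
  shows "k \<cdot> a \<cdot> inv\<^bsub>A\<^esub> k \<in> Stm n"
proof -
  obtain g h where gh: "g \<in> carrier G" "k = res g" "h \<in> St n" "a = res h"
    using k a unfolding Gm_def Stm_def by blast
  have hc: "h \<in> carrier G" using gh St_carrier by blast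
  have "k \<cdot> a \<cdot> inv\<^bsub>A\<^esub> k = res (g \<otimes> h \<otimes> inv g)"
    unfolding gh using gh(1) hc by (simp add: res_mult res_inv)
  then show ?thesis unfolding Stm_def using St_conj[OF gh(1,3)] by blast
qed

lemma aut_St:
  assumes d: "d \<in> St n" shows "\<phi> d \<in> St n"
proof -
  have dc: "d \<in> carrier G" using d St_carrier by blast
  have "\<rho> (\<phi> d) v = v" if v: "v \<in> verts T" "level T v = n" for v
  proof -
    have "t ` verts T = verts T" using isometry unfolding Iso_def Bij_def bij_betw_def by blast
    then obtain u where u: "u \<in> verts T" "v = t u" using v(1) by blast
    have "level T u = n" using Iso_level[OF isometry u(1)] u(2) v(2) by simp
    then have "\<rho> d u = u" using d u(1) unfolding level_stabilizer_def by blast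
    then show ?thesis using equivariant[OF dc u(1)] u(2) by simp
  qed
  then show ?thesis using aut_closed[OF dc] unfolding level_stabilizer_def by blast
qed

lemma tres_normalizes_Stm:
  assumes g: "g \<in> carrier G" and a: "a \<in> Stm n"
  shows "tres g \<cdot> a \<cdot> inv\<^bsub>A\<^esub> (tres g) \<in> Stm n"
proof -
  obtain d where d: "d \<in> St n" "a = res d" using a unfolding Stm_def by blast
  then show ?thesis
    using tres_conj_res[OF g St_carrier[OF d(1)]] St_conj[OF g aut_St[OF d(1)]] unfolding Stm_def by auto
qed

lemma ristm_subgroup: "subgroup (ristm w j) A"
proof (rule trunc.subgroupI)
  show "ristm w j \<subseteq> carrier A" unfolding ristm_def using Stm_carrier by blast
  show "ristm w j \<noteq> {}" unfolding ristm_def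
    using subgroup.one_closed[OF Stm_subgroup] trunc.act_one by auto
  fix a assume a: "a \<in> ristm w j"
  then have ac: "a \<in> carrier A" unfolding ristm_def using Stm_carrier by blast
  have "(inv\<^bsub>A\<^esub> a) v = v" if "v \<in> V - subtree_verts T w" for v
    using trunc.act_inv[OF ac, of v] a that unfolding ristm_def by auto
  then show "inv\<^bsub>A\<^esub> a \<in> ristm w j"
    using a subgroup.m_inv_closed[OF Stm_subgroup] unfolding ristm_def by blast
  fix b assume b: "b \<in> ristm w j"
  then have bc: "b \<in> carrier A" unfolding ristm_def using Stm_carrier by blast
  have "(a \<cdot> b) v = v" if "v \<in> V - subtree_verts T w" for v
    using a b that ac bc unfolding ristm_def by (simp add: trunc.act_mult)
  then show "a \<cdot> b \<in> ristm w j"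
    using a b subgroup.m_closed[OF Stm_subgroup] unfolding ristm_def by blast
qed

lemma ristm_conj:
  assumes x: "x \<in> carrier A" and a: "a \<in> ristm w j"
    and norm: "x \<cdot> a \<cdot> inv\<^bsub>A\<^esub> x \<in> Stm j"
    and sub: "\<And>v. v \<in> V \<Longrightarrow> v \<in> subtree_verts T w \<Longrightarrow> x v \<in> subtree_verts T w"
  shows "x \<cdot> a \<cdot> inv\<^bsub>A\<^esub> x \<in> ristm w j"
proof -
  have ac: "a \<in> carrier A" using a Stm_carrier unfolding ristm_def by blast
  have "(x \<cdot> a \<cdot> inv\<^bsub>A\<^esub> x) v = v" if v: "v \<in> V - subtree_verts T w" for v
  proof -
    let ?u = "(inv\<^bsub>A\<^esub> x) v"
    have uV: "?u \<in> V" using v x trunc.act_closed by simp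
    have xu: "x ?u = v" using v x trunc.act_inv' by simp
    then have "?u \<notin> subtree_verts T w" using sub[OF uV] v by auto
    then have "a ?u = ?u" using a uV unfolding ristm_def by blast
    then show ?thesis using conj_apply[OF x ac, of v] v xu by simp
  qed
  then show ?thesis using norm unfolding ristm_def by blast
qed

end


section \<open>Centralizers in the truncated coset\<close>

context twisted_action
begin

definition centralizer_bound :: "nat \<Rightarrow> nat" where
  "centralizer_bound n = card ((\<lambda>g. restrict (\<rho> g) {v \<in> verts T. level T v \<le> n}) ` carrier G)"

end

text \<open>
  In the truncations, finiteness of the Reidemeister number appears as follows: conjugacy on the
  first \<open>n\<^sub>0\<close> levels implies conjugacy on any number of levels.
\<close>

locale stable_truncated_action = truncated_action +
  fixes n0 :: nat
  assumes n0_le: "n0 \<le> m"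
    and stable: "g \<in> carrier G \<Longrightarrow> h \<in> carrier G \<Longrightarrow> conj_upto n0 g h \<Longrightarrow> conj_upto k g h"
begin

definition cent :: "'b \<Rightarrow> ('a \<Rightarrow> 'a) set" where
  "cent g = {a \<in> Gm. tres g \<cdot> a = a \<cdot> tres g}"

lemma cent_subgroup: "g \<in> carrier G \<Longrightarrow> subgroup (cent g) A"
  unfolding cent_def using trunc.subgroup_centralizer[OF Gm_subgroup tres_in_A] .

lemma finite_Gm: "finite Gm"
  using finite_subset[OF subgroup.subset[OF Gm_subgroup] finite_A] .

lemma conj_upto_mult_St:
  assumes g: "g \<in> carrier G" and b: "b \<in> St n0"
  shows "conj_upto k g (b \<otimes> g)"
proof -
  have bc: "b \<in> carrier G" using b St_carrier by blast
  have "tw (b \<otimes> g) (\<rho> \<one> v) = \<rho> \<one> (tw g v)" if v: "v \<in> verts T" "level T v \<le> n0" for v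
    using v g bc St_fixes[OF b tw_in_verts[OF g v(1)]] tw_level[OF g v(1)]
    by (simp add: act_one tw_mult tw_in_verts)
  then have "conj_upto n0 g (b \<otimes> g)" unfolding conj_upto_def using one_closed by blast
  then show ?thesis using stable g bc by simp
qed

text \<open>
  The conjugacy class of \<open>g t\<close> contains all \<open>k (g t)\<close> with \<open>k\<close> in \<open>Stm n\<^sub>0\<close>. So it is as large as
  the kernel of the restriction to the first \<open>n\<^sub>0\<close> levels, and the centralizer is at most as large
  as the image of this restriction.
\<close>

lemma card_cent_le:
  assumes g: "g \<in> carrier G"
  shows "card (cent g) \<le> centralizer_bound n0"
proof -
  let ?x = "tres g"
  let ?f = "\<lambda>a. a \<cdot> ?x \<cdot> inv\<^bsub>A\<^esub> a"
  let ?V0 = "{v \<in> verts T. level T v \<le> n0}"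
  have x: "?x \<in> carrier A" using tres_in_A[OF g] .
  have "card Gm = card (cent g) * card (?f ` Gm)"
  proof (rule trunc.card_eq_stabilizer_times_image[OF Gm_subgroup finite_Gm cent_subgroup[OF g]])
    show "cent g \<subseteq> Gm" unfolding cent_def by blast
    fix a b assume ab: "a \<in> Gm" "b \<in> Gm"
    then have c: "a \<in> carrier A" "b \<in> carrier A" using Gm_carrier by blast+
    have "inv\<^bsub>A\<^esub> a \<cdot> b \<in> Gm"
      using ab subgroup.m_closed[OF Gm_subgroup] subgroup.m_inv_closed[OF Gm_subgroup] by blast
    moreover have "?f a = ?f b \<longleftrightarrow> ?x \<cdot> (inv\<^bsub>A\<^esub> a \<cdot> b) = (inv\<^bsub>A\<^esub> a \<cdot> b) \<cdot> ?x"
      using trunc.conj_eq_conj_iff[OF x c] .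
    ultimately show "(?f a = ?f b) = (inv\<^bsub>A\<^esub> a \<cdot> b \<in> cent g)" unfolding cent_def by simp
  qed
  moreover have "card (Stm n0) \<le> card (?f ` Gm)"
  proof (rule card_inj_on_le[of "\<lambda>k. k \<cdot> ?x"])
    show "inj_on (\<lambda>k. k \<cdot> ?x) (Stm n0)" using x Stm_carrier by (intro inj_onI) simp
    show "finite (?f ` Gm)" using finite_Gm by simp
    show "(\<lambda>k. k \<cdot> ?x) ` Stm n0 \<subseteq> ?f ` Gm"
    proof
      fix y assume "y \<in> (\<lambda>k. k \<cdot> ?x) ` Stm n0"
      then obtain b where b: "b \<in> St n0" "y = res b \<cdot> ?x" unfolding Stm_def by blast
      have bc: "b \<in> carrier G" using b St_carrier by blast
      have y: "y = tres (b \<otimes> g)" using b(2) res_tres[OF bc g] by simp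
      obtain a where a: "a \<in> carrier G"
          "\<And>v. v \<in> verts T \<Longrightarrow> level T v \<le> m \<Longrightarrow> tw (b \<otimes> g) (\<rho> a v) = \<rho> a (tw g v)"
        using conj_upto_mult_St[OF g b(1), of m] unfolding conj_upto_def by blast
      have bg: "b \<otimes> g \<in> carrier G" using bc g by simp
      have "y \<cdot> res a = res a \<cdot> ?x"
        unfolding y
      proof (rule perm_eqI)
        fix v assume v: "v \<in> V"
        show "(tres (b \<otimes> g) \<cdot> res a) v = (res a \<cdot> tres g) v"
          using v a(2)[OF V_in_verts[OF v] V_level[OF v]] a(1) g bg
          by (simp add: trunc.act_mult tres_in_A res_in_A tres_apply res_apply act_V tw_V)
      qed (use a g bg in \<open>auto simp: res_in_A tres_in_A\<close>)
      then have "y = ?f (res a)"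
        using trunc.inv_solve_right[of y "res a \<cdot> ?x" "res a"] x y tres_in_A[OF bg] res_in_A[OF a(1)] by simp
      then show "y \<in> ?f ` Gm" using a(1) unfolding Gm_def by blast
    qed
  qed
  moreover have "card Gm = card (Stm n0) * card ((\<lambda>a. restrict a ?V0) ` Gm)"
  proof (rule trunc.card_eq_stabilizer_times_image[OF Gm_subgroup finite_Gm Stm_subgroup Stm_le_Gm])
    fix a b assume ab: "a \<in> Gm" "b \<in> Gm"
    then have c: "a \<in> carrier A" "b \<in> carrier A" using Gm_carrier by blast+
    have V0: "v \<in> V" if "v \<in> ?V0" for v using that n0_le in_V by simp
    have ab': "inv\<^bsub>A\<^esub> a \<cdot> b \<in> Gm"
      using ab subgroup.m_closed[OF Gm_subgroup] subgroup.m_inv_closed[OF Gm_subgroup] by blast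
    have ptw: "a v = b v \<longleftrightarrow> (inv\<^bsub>A\<^esub> a \<cdot> b) v = v" if v: "v \<in> V" for v
    proof -
      have "(inv\<^bsub>A\<^esub> a \<cdot> b) v = (inv\<^bsub>A\<^esub> a) (b v)" using c v by (simp add: trunc.act_mult)
      then show ?thesis
        using trunc.act_inv[OF c(1) v] trunc.act_inv'[OF c(1) trunc.act_closed[OF c(2) v]] by metis
    qed
    have "restrict a ?V0 = restrict b ?V0 \<longleftrightarrow> (\<forall>v\<in>?V0. a v = b v)"
      by (metis (no_types, lifting) restrict_apply' restrict_ext)
    also have "\<dots> \<longleftrightarrow> (\<forall>v\<in>?V0. (inv\<^bsub>A\<^esub> a \<cdot> b) v = v)" using ptw V0 by blast
    also have "\<dots> \<longleftrightarrow> inv\<^bsub>A\<^esub> a \<cdot> b \<in> Stm n0"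
    proof
      assume "\<forall>v\<in>?V0. (inv\<^bsub>A\<^esub> a \<cdot> b) v = v"
      then show "inv\<^bsub>A\<^esub> a \<cdot> b \<in> Stm n0" using mem_Stm_iff[OF n0_le] ab' V_in_verts by auto
    next
      assume "inv\<^bsub>A\<^esub> a \<cdot> b \<in> Stm n0"
      then show "\<forall>v\<in>?V0. (inv\<^bsub>A\<^esub> a \<cdot> b) v = v" using Stm_fixes V0 by simp
    qed
    finally show "(restrict a ?V0 = restrict b ?V0) = (inv\<^bsub>A\<^esub> a \<cdot> b \<in> Stm n0)" .
  qed
  moreover have "(\<lambda>a. restrict a ?V0) ` Gm = (\<lambda>g. restrict (\<rho> g) ?V0) ` carrier G"
  proof -
    have "restrict (res g) ?V0 = restrict (\<rho> g) ?V0" for g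
      using n0_le in_V by (intro restrict_ext) (simp add: res_apply)
    then show ?thesis unfolding Gm_def by (simp add: image_image)
  qed
  ultimately have eq: "card (cent g) * card (?f ` Gm) = card (Stm n0) * centralizer_bound n0"
    and le: "card (Stm n0) \<le> card (?f ` Gm)"
    unfolding centralizer_bound_def by simp_all
  have "card (cent g) * card (Stm n0) \<le> card (cent g) * card (?f ` Gm)"
    using le by (rule mult_le_mono2)
  then have "card (cent g) * card (Stm n0) \<le> centralizer_bound n0 * card (Stm n0)"
    using eq by (simp only: mult.commute)
  moreover have "card (Stm n0) > 0"
    using subgroup.one_closed[OF Stm_subgroup] finite_subset[OF Stm_le_Gm finite_Gm] by (auto simp: card_gt_0_iff)
  ultimately show ?thesis by simp
qed

text \<open>
  Let \<open>x\<close> fix a vertex \<open>u\<close> of level \<open>j\<close> and all its children. On \<open>Stm j\<close> the map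
  \<open>d \<mapsto> d x d\<^sup>-\<^sup>1 x\<^sup>-\<^sup>1\<close> has values that fix a given child, while its fibres are cosets of the
  centralizer of \<open>x\<close>; so the index of the stabiliser of a child is bounded.
\<close>

lemma card_children_le:
  assumes j: "n0 \<le> j" "m = Suc j" and u0: "u0 \<in> verts T" "level T u0 = j"
  shows "card (children T u0) \<le> centralizer_bound n0"
proof -
  obtain g c where g: "g \<in> carrier G" and c: "level T c = Suc j" "fixes_path_to g c"
    using fixed_path_exists by blast
  have cv: "c \<in> verts T" using c unfolding fixes_path_to_def by blast
  note p = child_of_parent[OF cv c(1)]
  let ?u = "parent T c"
  have anc: "ancestor T j c = ?u"
    using ancestor_Suc[OF cv, of j] c ancestor_level_self[of c] by simp
  have fixch: "tw g d = d" if "d \<in> children T ?u" for d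
    using c that anc unfolding fixes_path_to_def by (metis lessI)
  let ?x = "tres g" and ?K = "Stm j"
  have x: "?x \<in> carrier A" using tres_in_A[OF g] .
  have chV: "d \<in> V" if "d \<in> children T ?u" for d using that children_iff p in_V j by simp
  have cV: "c \<in> V" using chV p by blast
  have finK: "finite ?K" using finite_subset[OF Stm_le_Gm finite_Gm] .
  let ?f = "\<lambda>d. d \<cdot> (?x \<cdot> inv\<^bsub>A\<^esub> d \<cdot> inv\<^bsub>A\<^esub> ?x)"
  let ?C = "{a \<in> ?K. ?x \<cdot> a = a \<cdot> ?x}"
  have "card ?K = card ?C * card (?f ` ?K)"
  proof (rule trunc.card_eq_stabilizer_times_image[OF Stm_subgroup finK trunc.subgroup_centralizer[OF Stm_subgroup x]])
    show "?C \<subseteq> ?K" by blast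
    fix a b assume ab: "a \<in> ?K" "b \<in> ?K"
    then have cc: "a \<in> carrier A" "b \<in> carrier A" using Stm_carrier by blast+
    have "inv\<^bsub>A\<^esub> a \<cdot> b \<in> ?K"
      using ab subgroup.m_closed[OF Stm_subgroup] subgroup.m_inv_closed[OF Stm_subgroup] by blast
    moreover have "?f a = ?f b \<longleftrightarrow> ?x \<cdot> (inv\<^bsub>A\<^esub> a \<cdot> b) = (inv\<^bsub>A\<^esub> a \<cdot> b) \<cdot> ?x"
    proof -
      have "?f a = (a \<cdot> ?x \<cdot> inv\<^bsub>A\<^esub> a) \<cdot> inv\<^bsub>A\<^esub> ?x" "?f b = (b \<cdot> ?x \<cdot> inv\<^bsub>A\<^esub> b) \<cdot> inv\<^bsub>A\<^esub> ?x"
        using cc x by (simp_all add: trunc.m_assoc)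
      then have "?f a = ?f b \<longleftrightarrow> a \<cdot> ?x \<cdot> inv\<^bsub>A\<^esub> a = b \<cdot> ?x \<cdot> inv\<^bsub>A\<^esub> b" using cc x by simp
      then show ?thesis using trunc.conj_eq_conj_iff[OF x cc] by simp
    qed
    ultimately show "(?f a = ?f b) = (inv\<^bsub>A\<^esub> a \<cdot> b \<in> ?C)" by simp
  qed
  moreover have "card (?f ` ?K) \<le> card {k \<in> ?K. k c = c}"
  proof (rule card_mono)
    show "finite {k \<in> ?K. k c = c}" using finK by simp
    show "?f ` ?K \<subseteq> {k \<in> ?K. k c = c}"
    proof
      fix y assume "y \<in> ?f ` ?K"
      then obtain d where d: "d \<in> ?K" "y = ?f d" by blast
      have dc: "d \<in> carrier A" using d Stm_carrier by blast
      have di: "inv\<^bsub>A\<^esub> d \<in> ?K" using subgroup.m_inv_closed[OF Stm_subgroup d(1)] .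
      have yK: "y \<in> ?K"
        using d subgroup.m_closed[OF Stm_subgroup d(1) tres_normalizes_Stm[OF g di]] by simp
      have "(inv\<^bsub>A\<^esub> ?x) c = c"
        using trunc.act_inv[OF x cV] tres_apply[OF cV] fixch[OF p(3)] by simp
      moreover have "(inv\<^bsub>A\<^esub> d) c \<in> children T ?u"
        using Stm_orbit_of_child[OF p(1,2) _ p(3)] di j by (metis image_eqI order_refl)
      then have "?x ((inv\<^bsub>A\<^esub> d) c) = (inv\<^bsub>A\<^esub> d) c" using fixch chV tres_apply by simp
      ultimately have "y c = c" using d(2) dc x cV trunc.act_inv'[OF dc cV]
        by (simp add: trunc.act_mult trunc.act_closed)
      then show "y \<in> {k \<in> ?K. k c = c}" using yK by blast
    qed
  qed
  moreover have "card ?K = card {k \<in> ?K. k c = c} * card (children T ?u)"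
    using trunc.card_orbit_stabilizer[OF Stm_subgroup finK cV, of]
      Stm_orbit_of_child[OF p(1,2) _ p(3)] j by simp
  ultimately have "card {k \<in> ?K. k c = c} * card (children T ?u) = card ?C * card (?f ` ?K)"
    and le: "card (?f ` ?K) \<le> card {k \<in> ?K. k c = c}"
    by simp_all
  then have "card {k \<in> ?K. k c = c} * card (children T ?u) \<le> card ?C * card {k \<in> ?K. k c = c}"
    using mult_le_mono2[OF le, of "card ?C"] by simp
  moreover have "card {k \<in> ?K. k c = c} > 0"
    using subgroup.one_closed[OF Stm_subgroup] trunc.act_one[OF cV] finK by (auto simp: card_gt_0_iff)
  ultimately have "card (children T ?u) \<le> card ?C" by (simp add: mult.commute)
  also have "\<dots> \<le> card (cent g)"
    using Stm_le_Gm finite_Gm unfolding cent_def by (intro card_mono) auto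
  also have "\<dots> \<le> centralizer_bound n0" using card_cent_le[OF g] .
  finally show ?thesis
    using spherically_symmetric[OF u0(1) p(1)] u0(2) p(2) unfolding branching_index_def by simp
qed

end

section \<open>Many commuting elements below a fixed path\<close>

context stable_truncated_action
begin

text \<open>
  The heart of the proof. Let \<open>x\<close> be a truncated element of the coset that normalises a Sylow
  \<open>p\<close>-subgroup \<open>S\<close> of \<open>Stm n\<^sub>0\<close>, and let \<open>z\<close> be the power of \<open>x\<close> that kills its \<open>p\<close>-part. If \<open>x\<close> fixes
  a path and the children of its vertices, then at a level \<open>i\<close> where \<open>p\<close> divides the number of children some
  \<open>h\<close> in \<open>S\<close> commutes with \<open>z\<close> and leads the path to another child \<open>w\<close> of its vertex. Hence \<open>z\<close>,
  unlike \<open>x\<close>, fixes a whole path below \<open>w\<close> too. There \<open>z\<close> acts trivially on the children of a vertex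
  whose children are moved by the \<open>p\<close>-group \<open>S \<inter> ristm w j\<close>, and so \<open>z\<close> centralises a nontrivial
  part of that group. On this part \<open>x\<close> has \<open>p\<close>-power order and fixes a nontrivial element.
\<close>

lemma centralizing_element_off_path:
  assumes p: "Factorial_Ring.prime (p::nat)" and g: "g \<in> carrier G"
    and u: "level T u = m" "fixes_path_to g u"
    and S: "trunc.sylow_subgroup p S (Stm n0)"
    and Snorm: "\<And>s. s \<in> S \<Longrightarrow> tres g \<cdot> s \<cdot> inv\<^bsub>A\<^esub> (tres g) \<in> S"
    and i: "n0 \<le> i" "\<And>v. v \<in> verts T \<Longrightarrow> level T v = i \<Longrightarrow> p dvd card (children T v)"
    and j: "Suc i \<le> j" "Suc j \<le> m" "rist_orbits_divisible p (Suc i) j"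
  shows "\<exists>w\<in>children T (ancestor T i u). w \<noteq> ancestor T (Suc i) u \<and>
    (\<exists>a\<in>cent g. a \<noteq> \<one>\<^bsub>A\<^esub> \<and> (\<forall>v\<in>V - subtree_verts T w. a v = v))"
proof -
  let ?x = "tres g"
  have x: "?x \<in> carrier A" using tres_in_A[OF g] .
  have uv: "u \<in> verts T" using u unfolding fixes_path_to_def by blast
  have fixch: "c \<in> V" "?x c = c" if "l < m" "c \<in> children T (ancestor T l u)" for l c
  proof -
    show "c \<in> V" using that children_iff level_ancestor[OF uv, of l] u(1) in_V by simp
    then show "?x c = c" using tres_apply that u unfolding fixes_path_to_def by simp
  qed
  have path: "ancestor T l u \<in> verts T" "level T (ancestor T l u) = l" if "l \<le> m" for l
    using ancestor_in_verts[OF uv] level_ancestor[OF uv] that u(1) by auto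
  have path_child: "ancestor T (Suc l) u \<in> children T (ancestor T l u)" if "l < m" for l
    using children_iff path[of l] path[of "Suc l"] ancestor_Suc[OF uv, of l] that u(1) by simp
  have finSt: "finite (Stm l)" for l using finite_subset[OF Stm_le_Gm finite_Gm] .

  \<comment> \<open>\<open>z\<close> is the power of \<open>x\<close> that has lost the \<open>p\<close>-part of its order\<close>
  have "order A \<noteq> 0" using finite_A trunc.one_closed unfolding order_def by auto
  then obtain n where n: "order A = p ^ multiplicity p (order A) * n" "\<not> p dvd n"
    using multiplicity_decompose'[of "order A" p] p by (metis not_prime_unit)
  define e where "e = multiplicity p (order A)"
  define z where "z = ?x [^]\<^bsub>A\<^esub> (p ^ e)"
  have z: "z \<in> carrier A" unfolding z_def using x by simp
  have zn: "z [^]\<^bsub>A\<^esub> n = \<one>\<^bsub>A\<^esub>"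
    unfolding z_def using trunc.nat_pow_pow[OF x, of "p ^ e" n] n(1) trunc.pow_order_eq_1[OF x] unfolding e_def by simp
  have zfix: "z v = v" if "v \<in> V" "?x v = v" for v
    unfolding z_def using trunc.act_pow_fixed[OF x that] .
  have znorm: "z \<cdot> s \<cdot> inv\<^bsub>A\<^esub> z \<in> B"
    if "subgroup B A" "\<And>s. s \<in> B \<Longrightarrow> ?x \<cdot> s \<cdot> inv\<^bsub>A\<^esub> ?x \<in> B" "s \<in> B" for B s
    unfolding z_def using trunc.pow_conj_closed[OF x subgroup.subset[OF that(1)] that(2,3)] .

  \<comment> \<open>\<open>S \<inter> Stm i\<close> is Sylow, so it moves every child of \<open>?v\<close>, while \<open>z\<close> fixes them all\<close>
  let ?v = "ancestor T i u" and ?c = "ancestor T (Suc i) u"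
  have im: "i < m" using j by simp
  have v: "?v \<in> verts T" "level T ?v = i" and c: "?c \<in> children T ?v" "?c \<in> V"
    using path[of i] path_child[of i] fixch(1)[of i] im by auto
  let ?Si = "S \<inter> Stm i"
  have syl_i: "trunc.sylow_subgroup p ?Si (Stm i)"
    using trunc.sylow_subgroup_Int_normal[OF Stm_subgroup finSt p S Stm_subgroup Stm_antimono[OF i(1)]]
      Stm_normal Stm_le_Gm by blast
  then obtain ei where Si: "subgroup ?Si A" "card ?Si = p ^ ei"
    unfolding trunc.sylow_subgroup_def by blast
  have orb_i: "(\<lambda>d. d ?c) ` Stm i = children T ?v"
    using Stm_orbit_of_child[OF v _ c(1)] im by simp
  then obtain s where s: "s \<in> ?Si" "s ?c \<noteq> ?c"
    using trunc.sylow_subgroup_moves_point[OF Stm_subgroup finSt p syl_i c(2)] i(2)[OF v] by auto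
  have "\<exists>h\<in>?Si. h ?c \<noteq> ?c \<and> z \<cdot> h = h \<cdot> z"
  proof (rule trunc.commuting_element_moving_point[OF p Si z _ zn n(2) _ _ _ s(1) c(1) s(2)])
    show "z \<cdot> b \<cdot> inv\<^bsub>A\<^esub> z \<in> ?Si" if "b \<in> ?Si" for b
      using znorm[OF Si(1) _ that] Snorm tres_normalizes_Stm[OF g] by blast
    show "children T ?v \<subseteq> V" using fixch(1)[OF im] by blast
    show "z y = y" if "y \<in> children T ?v" for y using zfix fixch[OF im that] by blast
    show "b y \<in> children T ?v" if "b \<in> ?Si" "y \<in> children T ?v" for b y
      using Stm_orbit_of_child[OF v _ that(2)] im that(1) by auto
  qed
  then obtain h where h: "h \<in> S" "h \<in> Stm i" "h ?c \<noteq> ?c" "z \<cdot> h = h \<cdot> z" by blast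
  have hA: "h \<in> carrier A" and hG: "h \<in> Gm" using h(2) Stm_carrier Stm_le_Gm by blast+
  define w where "w = h ?c"
  have w: "w \<in> children T ?v" unfolding w_def using orb_i h(2) by blast
  have wV: "w \<in> V" "?x w = w" using fixch[OF im w] by auto
  have wl: "w \<in> verts T" "level T w = Suc i" using w children_iff v(2) by auto

  \<comment> \<open>\<open>ristm w j\<close> is normal in \<open>Stm (Suc i)\<close>, which is normal in \<open>Stm n0\<close>; so \<open>S\<close> meets it in a Sylow
    subgroup\<close>
  let ?D = "ristm w j" and ?K1 = "Stm (Suc i)"
  have D_St: "?D \<subseteq> Stm j" unfolding ristm_def by blast
  have D_K1: "?D \<subseteq> ?K1" using D_St Stm_antimono[OF j(1)] by blast
  have finD: "finite ?D" using finite_subset[OF D_St finSt] .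
  have syl_1: "trunc.sylow_subgroup p (S \<inter> ?K1) ?K1"
    using trunc.sylow_subgroup_Int_normal[OF Stm_subgroup finSt p S Stm_subgroup Stm_antimono] i(1)
      Stm_normal Stm_le_Gm by (meson le_SucI subsetD)
  have "trunc.sylow_subgroup p ((S \<inter> ?K1) \<inter> ?D) ?D"
  proof (rule trunc.sylow_subgroup_Int_normal[OF Stm_subgroup finSt p syl_1 ristm_subgroup D_K1])
    fix k d assume k: "k \<in> ?K1" and d: "d \<in> ?D"
    have kG: "k \<in> Gm" using k Stm_le_Gm by blast
    have kw: "k w = w" using Stm_fixes[OF k wV(1)] wl by simp
    show "k \<cdot> d \<cdot> inv\<^bsub>A\<^esub> k \<in> ?D"
    proof (rule ristm_conj[OF Gm_carrier[OF kG] d])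
      show "k \<cdot> d \<cdot> inv\<^bsub>A\<^esub> k \<in> Stm j" using Stm_normal[OF kG] d D_St by blast
      show "k y \<in> subtree_verts T w" if "y \<in> V" "y \<in> subtree_verts T w" for y
        using Gm_subtree[OF kG wV(1) that] kw by simp
    qed
  qed
  moreover have "(S \<inter> ?K1) \<inter> ?D = S \<inter> ?D" using D_K1 by blast
  ultimately have syl_D: "trunc.sylow_subgroup p (S \<inter> ?D) ?D" by simp
  then obtain eD where SD: "subgroup (S \<inter> ?D) A" "card (S \<inter> ?D) = p ^ eD"
    unfolding trunc.sylow_subgroup_def by blast
  have SDnorm: "?x \<cdot> d \<cdot> inv\<^bsub>A\<^esub> ?x \<in> S \<inter> ?D" if d: "d \<in> S \<inter> ?D" for d
  proof -
    have "?x \<cdot> d \<cdot> inv\<^bsub>A\<^esub> ?x \<in> ?D"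
    proof (rule ristm_conj[OF x])
      show "d \<in> ?D" using d by blast
      show "?x \<cdot> d \<cdot> inv\<^bsub>A\<^esub> ?x \<in> Stm j" using tres_normalizes_Stm[OF g] d D_St by blast
      show "?x y \<in> subtree_verts T w" if "y \<in> V" "y \<in> subtree_verts T w" for y
        using tw_subtree[OF g that(2)] tres_apply[OF that(1)] tres_apply[OF wV(1)] wV(2) by simp
    qed
    then show ?thesis using Snorm d by blast
  qed

  \<comment> \<open>as \<open>z\<close> commutes with \<open>h\<close>, it acts trivially next to the image of the path under \<open>h\<close>, which passes
    through \<open>w\<close>\<close>
  let ?qj = "ancestor T j u" and ?cj = "ancestor T (Suc j) u"
  have jm: "j < m" using j(2) by simp
  have q0: "?qj \<in> verts T" "level T ?qj = j" and c0: "?cj \<in> children T ?qj" "?cj \<in> V" "level T ?cj = Suc j"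
    using path[of j] path_child[of j] fixch(1)[of j] jm children_iff by auto
  have q0V: "?qj \<in> V" using q0 jm in_V by simp
  define q where "q = h ?qj"
  define c' where "c' = h ?cj"
  have qV: "q \<in> V" "level T q = j" unfolding q_def using trunc.act_closed[OF hA q0V] Gm_level[OF hG q0V] q0 by auto
  have c': "c' \<in> children T q" "c' \<in> V" "level T c' = Suc j"
    unfolding c'_def q_def
    using Gm_children[OF hG q0V c0(2,1)] trunc.act_closed[OF hA c0(2)] Gm_level[OF hG c0(2)] c0(3) by auto
  have "ancestor T (Suc i) ?cj = ?c" using ancestor_ancestor[OF uv, of "Suc i" "Suc j"] j u(1) by simp
  then have "?cj \<in> subtree_verts T ?c"
    using in_subtree_ancestor[of ?cj "Suc i"] path[of "Suc j"] j by simp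
  then have c'w: "c' \<in> subtree_verts T w" unfolding c'_def w_def using Gm_subtree[OF hG c(2) c0(2)] by blast
  have chq: "y \<in> V" "z y = y" if y: "y \<in> children T q" for y
  proof -
    show yV: "y \<in> V" using y children_iff qV(2) j(2) in_V by simp
    let ?y = "(inv\<^bsub>A\<^esub> h) y"
    have "(inv\<^bsub>A\<^esub> h) q = ?qj" unfolding q_def using trunc.act_inv[OF hA q0V] .
    then have "?y \<in> children T ?qj"
      using Gm_children[OF subgroup.m_inv_closed[OF Gm_subgroup hG] qV(1) yV y] by simp
    then have y0: "?y \<in> V" "z ?y = ?y" using fixch[OF jm] zfix by blast+
    have "z (h ?y) = h (z ?y)" using h(4) trunc.act_mult[OF z hA y0(1)] trunc.act_mult[OF hA z y0(1)] by simp
    then show "z y = y" using y0(2) trunc.act_inv'[OF hA yV] by simp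
  qed
  have "p dvd card ((\<lambda>d. \<rho> d c') ` (rist w \<inter> St j))"
    using j(3) wl c'w c'(3) unfolding rist_orbits_divisible_def by blast
  also have "(\<lambda>d. \<rho> d c') ` (rist w \<inter> St j) = (\<lambda>d. d c') ` (res ` (rist w \<inter> St j))"
    using res_apply[OF c'(2)] by (simp add: image_image)
  also have "card \<dots> dvd card ((\<lambda>d. d c') ` ?D)"
  proof (rule trunc.card_orbit_dvd_card_orbit_if_normalizes[OF res_image_subgroup[OF rist_St_subgroup] ristm_subgroup _ _ c'(2)])
    show "res ` (rist w \<inter> St j) \<subseteq> ?D"
    proof
      fix a assume "a \<in> res ` (rist w \<inter> St j)"
      then obtain d where d: "d \<in> rist w" "d \<in> St j" "a = res d" by blast
      have "a y = y" if "y \<in> V - subtree_verts T w" for y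
        using that d(1,3) res_apply[of y d] V_in_verts[of y] unfolding rist_def by simp
      then show "a \<in> ?D" using d(2,3) unfolding ristm_def Stm_def by blast
    qed
    fix a d assume a: "a \<in> ?D" and d: "d \<in> res ` (rist w \<inter> St j)"
    obtain a' where a': "a' \<in> St j" "a = res a'" using a D_St unfolding Stm_def by blast
    obtain d' where d': "d' \<in> rist w \<inter> St j" "d = res d'" using d by blast
    have cc: "a' \<in> carrier G" "d' \<in> carrier G" using a' d' St_carrier by blast+
    have "a \<cdot> d \<cdot> inv\<^bsub>A\<^esub> a = res (a' \<otimes> d' \<otimes> inv a')"
      using a'(2) d'(2) cc by (simp add: res_mult res_inv)
    moreover have "\<rho> a' w = w" using St_fixes[OF a'(1) wl(1)] wl(2) j(1) by simp
    ultimately show "a \<cdot> d \<cdot> inv\<^bsub>A\<^esub> a \<in> res ` (rist w \<inter> St j)"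
      using St_conj_fixed_rist[OF cc(1) _ wl(1) d'(1)] by simp
  next
    show "finite ((\<lambda>d. d c') ` ?D)" using finD by simp
  qed
  finally have "p dvd card ((\<lambda>d. d c') ` ?D)" .
  then obtain s' where s': "s' \<in> S \<inter> ?D" "s' c' \<noteq> c'"
    using trunc.sylow_subgroup_moves_point[OF ristm_subgroup finD p syl_D c'(2)] by blast
  have "\<exists>b\<in>S \<inter> ?D. b c' \<noteq> c' \<and> z \<cdot> b = b \<cdot> z"
  proof (rule trunc.commuting_element_moving_point[OF p SD z _ zn n(2) _ _ _ s'(1) c'(1) s'(2)])
    show "z \<cdot> b \<cdot> inv\<^bsub>A\<^esub> z \<in> S \<inter> ?D" if "b \<in> S \<inter> ?D" for b
      using znorm[OF SD(1) SDnorm that] .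
    show "children T q \<subseteq> V" using chq(1) by blast
    show "z y = y" if "y \<in> children T q" for y using chq(2)[OF that] .
    show "b y \<in> children T q" if b: "b \<in> S \<inter> ?D" and y: "y \<in> children T q" for b y
    proof -
      have bj: "b \<in> Stm j" using b D_St by blast
      have "b q = q" using Stm_fixes[OF bj qV(1)] qV(2) by simp
      moreover have "b \<in> Gm" using bj Stm_le_Gm by blast
      ultimately show ?thesis using Gm_children[OF _ qV(1) chq(1)[OF y] y, of b] by simp
    qed
  qed
  then obtain b where b: "b \<in> S \<inter> ?D" "b c' \<noteq> c'" "z \<cdot> b = b \<cdot> z" by blast

  \<comment> \<open>\<open>x\<close> acts with \<open>p\<close>-power order on the centralizer of \<open>z\<close>, because \<open>z\<close> is a \<open>p\<close>-power power of \<open>x\<close>\<close>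
  let ?C = "{a \<in> S \<inter> ?D. z \<cdot> a = a \<cdot> z}"
  have C: "subgroup ?C A" using trunc.subgroup_centralizer[OF SD(1) z] .
  have "finite (S \<inter> ?D)" using finD by blast
  then have "card ?C dvd p ^ eD" using trunc.card_subgroup_dvd[OF SD(1) _ C] SD(2) by auto
  then obtain f where f: "card ?C = p ^ f" using divides_primepow_nat[OF p] by blast
  have "\<exists>a\<in>?C. a \<noteq> \<one>\<^bsub>A\<^esub> \<and> ?x \<cdot> a = a \<cdot> ?x"
  proof (rule trunc.p_power_conj_fixes_nontrivial[OF p C f _ x])
    have "b \<noteq> \<one>\<^bsub>A\<^esub>" using b(2) trunc.act_one[OF c'(2)] by auto
    then show "\<exists>a\<in>?C. a \<noteq> \<one>\<^bsub>A\<^esub>" using b by blast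
    show "?x [^]\<^bsub>A\<^esub> (p ^ e) \<cdot> a = a \<cdot> ?x [^]\<^bsub>A\<^esub> (p ^ e)" if "a \<in> ?C" for a
      using that unfolding z_def by blast
    fix a assume a: "a \<in> ?C"
    then have aA: "a \<in> carrier A" using trunc.subgroup_memD[OF C] by blast
    have xz: "?x \<cdot> z \<cdot> inv\<^bsub>A\<^esub> ?x = z"
    proof -
      have "?x \<cdot> z = z \<cdot> ?x" unfolding z_def using x by (metis trunc.nat_pow_Suc trunc.nat_pow_Suc2)
      then show ?thesis using trunc.commute_iff_conj_eq[OF x z] by blast
    qed
    let ?a = "?x \<cdot> a \<cdot> inv\<^bsub>A\<^esub> ?x"
    have "z \<cdot> ?a = ?x \<cdot> (z \<cdot> a) \<cdot> inv\<^bsub>A\<^esub> ?x"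
      using trunc.conj_mult[OF x z aA] xz by simp
    also have "\<dots> = ?x \<cdot> (a \<cdot> z) \<cdot> inv\<^bsub>A\<^esub> ?x" using a by simp
    also have "\<dots> = ?a \<cdot> z" using trunc.conj_mult[OF x aA z] xz by simp
    finally show "?a \<in> ?C" using SDnorm a by blast
  qed
  then obtain a where a: "a \<in> ?D" "a \<noteq> \<one>\<^bsub>A\<^esub>" "?x \<cdot> a = a \<cdot> ?x" by blast
  then have "a \<in> cent g" using D_St Stm_le_Gm unfolding cent_def by blast
  moreover have "\<forall>y\<in>V - subtree_verts T w. a y = y" using a(1) unfolding ristm_def by blast
  ultimately show ?thesis using w h(3) a(2) unfolding w_def by blast
qed

text \<open>
  The elements that the preceding lemma yields at the levels in \<open>I\<close> commute with the same element of the
  coset, and they are distinct because their supports are disjoint.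
\<close>

lemma card_branching_levels_le:
  assumes p: "Factorial_Ring.prime (p::nat)"
    and i: "\<And>i. i \<in> I \<Longrightarrow> n0 \<le> i"
      "\<And>i v. i \<in> I \<Longrightarrow> v \<in> verts T \<Longrightarrow> level T v = i \<Longrightarrow> p dvd card (children T v)"
      "\<And>i. i \<in> I \<Longrightarrow> \<exists>j. Suc i \<le> j \<and> Suc j \<le> m \<and> rist_orbits_divisible p (Suc i) j"
  shows "card I \<le> centralizer_bound n0"
proof -
  obtain g1 u1 where g1: "g1 \<in> carrier G" and u1: "level T u1 = m" "fixes_path_to g1 u1"
    using fixed_path_exists by blast
  have fin: "finite (Stm n0)" using finite_subset[OF Stm_le_Gm finite_Gm] .
  obtain k S where k: "k \<in> Stm n0" and S: "trunc.sylow_subgroup p S (Stm n0)"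
    and norm: "\<And>s. s \<in> S \<Longrightarrow> (k \<cdot> tres g1) \<cdot> s \<cdot> inv\<^bsub>A\<^esub> (k \<cdot> tres g1) \<in> S"
    using trunc.coset_element_normalizing_sylow_subgroup[OF Stm_subgroup fin p tres_in_A[OF g1]
        tres_normalizes_Stm[OF g1]] by blast
  obtain b where b: "b \<in> St n0" "k = res b" using k unfolding Stm_def by blast
  have bc: "b \<in> carrier G" using b St_carrier by blast
  let ?g = "b \<otimes> g1"
  have g: "?g \<in> carrier G" using bc g1 by simp
  have tg: "k \<cdot> tres g1 = tres ?g" using b(2) res_tres[OF bc g1] by simp
  \<comment> \<open>by stability the normalising element is conjugate to \<open>g1 t\<close>, hence it fixes such a path as well\<close>
  obtain u where u: "level T u = m" "fixes_path_to ?g u"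
    using fixes_path_conj[OF g1 g u1(2) conj_upto_mult_St[OF g1 b(1)]] u1(1) by metis
  have uv: "u \<in> verts T" using u unfolding fixes_path_to_def by blast
  define Q where "Q i w a \<longleftrightarrow> w \<in> children T (ancestor T i u) \<and> w \<noteq> ancestor T (Suc i) u \<and>
      a \<in> cent ?g \<and> a \<noteq> \<one>\<^bsub>A\<^esub> \<and> (\<forall>v\<in>V - subtree_verts T w. a v = v)" for i w a
  have "\<exists>x. Q i (fst x) (snd x)" if iI: "i \<in> I" for i
  proof -
    obtain j where "Suc i \<le> j" "Suc j \<le> m" "rist_orbits_divisible p (Suc i) j" using i(3)[OF iI] by blast
    then show ?thesis
      using centralizing_element_off_path[OF p g u S norm[unfolded tg] i(1)[OF iI] i(2)[OF iI]]
      unfolding Q_def by fastforce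
  qed
  then obtain f where f: "\<And>i. i \<in> I \<Longrightarrow> Q i (fst (f i)) (snd (f i))" by metis
  define w a where "w i = fst (f i)" and "a i = snd (f i)" for i
  have wa: "w i \<in> children T (ancestor T i u)" "w i \<noteq> ancestor T (Suc i) u" "a i \<in> cent ?g"
      "a i \<noteq> \<one>\<^bsub>A\<^esub>" "\<And>v. v \<in> V - subtree_verts T (w i) \<Longrightarrow> a i v = v" if "i \<in> I" for i
    using f[OF that] unfolding Q_def w_def a_def by blast+
  have im: "i < m" if "i \<in> I" for i using i(3)[OF that] by auto
  have disjoint: False
    if l: "l \<in> I" "l' \<in> I" "l < l'" and y: "y \<in> subtree_verts T (w l)" "y \<in> subtree_verts T (w l')" for l l' y
  proof -
    have yv: "y \<in> verts T" using y subtree_in_verts by blast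
    have wl: "w l \<in> verts T" "level T (w l) = Suc l" "w l' \<in> verts T" "level T (w l') = Suc l'"
        "parent T (w l') = ancestor T l' u"
      using wa(1)[OF l(1)] wa(1)[OF l(2)] children_iff level_ancestor[OF uv] im[OF l(1)] im[OF l(2)] u(1) by auto
    have y1: "ancestor T (Suc l) y = w l" using mem_subtree_iff[OF wl(1) yv] y(1) wl(2) by simp
    have y2: "ancestor T (Suc l') y = w l'" "Suc l' \<le> level T y"
      using mem_subtree_iff[OF wl(3) yv] y(2) wl(4) by auto
    have "ancestor T l' y = ancestor T l' u" using ancestor_Suc[OF yv, of l'] y2 wl(5) by simp
    then have "ancestor T (Suc l) y = ancestor T (Suc l) u"
      using ancestor_ancestor[OF yv, of "Suc l" l'] ancestor_ancestor[OF uv, of "Suc l" l'] l(3) y2(2) im[OF l(2)] u(1)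
      by simp
    then show False using y1 wa(2)[OF l(1)] by simp
  qed
  have distinct: "a l \<noteq> a l'" if l: "l \<in> I" "l' \<in> I" "l < l'" for l l'
  proof
    assume e: "a l = a l'"
    have aA: "a l \<in> carrier A" using wa(3)[OF l(1)] trunc.subgroup_memD[OF cent_subgroup[OF g]] by blast
    have "a l = \<one>\<^bsub>A\<^esub>"
    proof (rule perm_eqI[OF aA trunc.one_closed])
      fix y assume y: "y \<in> V"
      have "a l y = y"
      proof (cases "y \<in> subtree_verts T (w l)")
        case True
        then have "y \<notin> subtree_verts T (w l')" using disjoint[OF l] by blast
        then show ?thesis using wa(5)[OF l(2)] e y by simp
      next
        case False
        then show ?thesis using wa(5)[OF l(1)] y by simp
      qed
      then show "a l y = \<one>\<^bsub>A\<^esub> y" using trunc.act_one[OF y] by simp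
    qed
    then show False using wa(4)[OF l(1)] by blast
  qed
  have "inj_on a I"
  proof (rule inj_onI)
    fix l l' assume "l \<in> I" "l' \<in> I" "a l = a l'"
    then show "l = l'" using distinct[of l l'] distinct[of l' l] by (metis linorder_neqE_nat)
  qed
  moreover have "a ` I \<subseteq> cent ?g" using wa(3) by blast
  moreover have "finite (cent ?g)" using finite_Gm unfolding cent_def by simp
  ultimately have "card I \<le> card (cent ?g)" by (rule card_inj_on_le)
  then show ?thesis using card_cent_le[OF g] by simp
qed

end

section \<open>Infinitely many Reidemeister classes\<close>

context twisted_action
begin

text \<open>
  The set \<open>I\<close> of levels in the preceding bound can be made arbitrarily large once one prime serves for
  all levels.
\<close>

lemma infinite_reidemeister_classes: "infinite (reidemeister_classes G \<phi>)"
proof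
  assume "finite (reidemeister_classes G \<phi>)"
  then obtain n0 where stable: "\<And>g h k. g \<in> carrier G \<Longrightarrow> h \<in> carrier G \<Longrightarrow> conj_upto n0 g h \<Longrightarrow> conj_upto k g h"
    using conj_upto_stabilizes by blast
  have trunc: "stable_truncated_action T G \<rho> H \<phi> t m n0" if "n0 \<le> m" for m
    by unfold_locales (use that stable in auto)
  let ?c = "centralizer_bound n0"
  have degree: "card (children T v) \<le> ?c" if "v \<in> verts T" "n0 \<le> level T v" for v
  proof -
    interpret stable_truncated_action T G \<rho> H \<phi> t "Suc (level T v)" n0 using trunc that by simp
    show ?thesis using card_children_le[OF that(2) refl that(1)] by simp
  qed
  \<comment> \<open>one prime that works for all levels, as it is bounded by the number of children\<close>
  have "\<exists>p j. Factorial_Ring.prime p \<and> p \<le> ?c \<and> n \<le> j \<and> rist_orbits_divisible p n j" if "n0 \<le> n" for n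
  proof -
    obtain j p where jp: "n \<le> j" "Factorial_Ring.prime p" "rist_orbits_divisible p n j"
      using rist_orbits_divisible_exists by blast
    obtain v where v: "v \<in> verts T" "level T v = j"
      using has_descendant[OF root_in_verts, of j] level_root subtree_in_verts by auto
    have "card (children T v) > 0" using has_child[OF v(1)] locally_finite[OF v(1)] by (auto simp: card_gt_0_iff)
    then have "p \<le> card (children T v)"
      using rist_orbits_divisible_children[OF jp(3,1) v] by (rule dvd_imp_le[rotated])
    then show ?thesis using degree[OF v(1)] v(2) jp that by auto
  qed
  then obtain P where P: "\<And>n. n0 \<le> n \<Longrightarrow> Factorial_Ring.prime (P n) \<and> P n \<le> ?c \<and> (\<exists>j\<ge>n. rist_orbits_divisible (P n) n j)"
    by metis
  have "\<exists>k\<in>{n0..}. infinite {n \<in> {n0..}. P n = P k}"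
  proof (rule pigeonhole_infinite)
    show "infinite {n0..}" by (rule infinite_Ici)
    show "finite (P ` {n0..})" using P finite_subset[of "P ` {n0..}" "{..?c}"] by auto
  qed
  then obtain k where k: "n0 \<le> k" "infinite {n \<in> {n0..}. P n = P k}" by auto
  let ?p = "P k"
  have p: "Factorial_Ring.prime ?p" using P[OF k(1)] by blast
  have all: "\<exists>j\<ge>n. rist_orbits_divisible ?p n j" for n
  proof -
    obtain n' where n': "n \<le> n'" "n0 \<le> n'" "P n' = ?p"
      using k(2) unfolding infinite_nat_iff_unbounded_le by auto
    then obtain j where j: "n' \<le> j" "rist_orbits_divisible ?p n' j" using P[OF n'(2)] by auto
    then show ?thesis using rist_orbits_divisible_antimono[OF j(2) n'(1) j(1)] n'(1) le_trans by blast
  qed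
  then obtain J where J: "\<And>n. n \<le> J n" "\<And>n. rist_orbits_divisible ?p n (J n)" by metis
  let ?I = "{i. n0 \<le> i \<and> (\<forall>v\<in>verts T. level T v = i \<longrightarrow> ?p dvd card (children T v))}"
  have "infinite ?I"
    unfolding infinite_nat_iff_unbounded_le
  proof
    fix l
    have "J (max l n0) \<in> ?I"
      using rist_orbits_divisible_children[OF J(2) J(1)] J(1)[of "max l n0"] by auto
    moreover have "l \<le> J (max l n0)" using J(1)[of "max l n0"] by simp
    ultimately show "\<exists>n\<ge>l. n \<in> ?I" by blast
  qed
  then obtain I where I: "I \<subseteq> ?I" "finite I" "card I = Suc ?c"
    using infinite_arbitrarily_large[of ?I "Suc ?c"] by blast
  let ?m = "n0 + (\<Sum>i\<in>I. Suc (J (Suc i)))"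
  interpret stable_truncated_action T G \<rho> H \<phi> t ?m n0 using trunc by simp
  have "card I \<le> ?c"
  proof (rule card_branching_levels_le[OF p])
    fix i assume i: "i \<in> I"
    then show "n0 \<le> i" using I(1) by blast
    have "Suc (J (Suc i)) \<le> (\<Sum>i\<in>I. Suc (J (Suc i)))"
      by (rule member_le_sum[OF i _ I(2)]) simp
    then show "\<exists>j. Suc i \<le> j \<and> Suc j \<le> ?m \<and> rist_orbits_divisible ?p (Suc i) j"
      using J[of "Suc i"] by (intro exI[of _ "J (Suc i)"]) simp
  next
    fix i v assume "i \<in> I" "v \<in> verts T" "level T v = i"
    then show "?p dvd card (children T v)" using I(1) by blast
  qed
  then show False using I(3) by simp
qed

end

theorem theorem7p7:
  fixes T :: "'v tree"
    and G :: "('a, 'b) monoid_scheme"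
    and \<rho> :: "'a \<Rightarrow> 'v \<Rightarrow> 'v"
    and \<phi> :: "'a \<Rightarrow> 'a"
  assumes "spherically_symmetric_tree T"
    and "\<forall>v \<in> verts T. branching_index T v \<noteq> 4"
    and "weakly_branch T G \<rho>"
    and "saturated T G \<rho>"
    and "locally_normal T G \<rho>"
    and "\<phi> \<in> iso G G"
  shows "reidemeister_number G \<phi> = \<infinity>"
proof -
  obtain H where H: "saturated_action T G \<rho> H" "\<And>n. characteristic_subgroup (H n) G"
    using saturated_action_exists assms(1,3,4) by blast
  obtain t where t: "t \<in> Iso T" "\<And>g v. g \<in> carrier G \<Longrightarrow> v \<in> verts T \<Longrightarrow> t (\<rho> g v) = \<rho> (\<phi> g) (t v)"
    using automorphism_induced_by_isometry[OF H assms(6)] by blast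
  have "faithful_tree_action T G \<rho>" using assms(3) unfolding weakly_branch_def by blast
  then have "twisted_action T G \<rho> H \<phi> t"
    using twisted_action_if_locally_normal[OF H(1) assms(6) t] assms(5) by blast
  then have "infinite (reidemeister_classes G \<phi>)"
    by (rule twisted_action.infinite_reidemeister_classes)
  then show ?thesis unfolding reidemeister_number_def by simp
qed

end
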